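(* Let $k$ be a positive integer, let $m\ge 1$, let $1\le t_1<\cdots<t_m\le k$ be integers and let $a_1,\dots,a_m$ be positive integers. Then $$g^{(k)}_{R_{t_1}^{a_1}\cup\cdots\cup R_{t_m}^{a_m}}=g^{(k)}_{R_{t_1}^{a_1}}\,g^{(k)}_{R_{t_2}^{a_2}}\cdots g^{(k)}_{R_{t_m}^{a_m}}.$$
   Context: Partitions are identified with Young diagrams in French notation: the diagram of $\lambda=(\lambda_1\ge\lambda_2\ge\cdots)$ is the set of cells $(i,j)\in\mathbb{Z}_{>0}^2$ with $j\le\lambda_i$ (row $i$ counted from the bottom). $|\lambda|$ is the size, $l(\lambda)$ the number of nonzero parts, $\lambda'$ the conjugate, $\lambda\subset\mu$ means containment of diagrams. $\lambda\cup\mu$ is the partition whose multiset of parts is the union of the multisets of parts of $\lambda$ and $\mu$; $(s)$ is the one-part partition, and $\lambda\cup(0)=\lambda$. A partition is $k$-bounded if $\lambda_1\le k$; $\mathcal{P}^k$ denotes the set of $k$-bounded partitions. For $1\le t\le k$, $R_t=(t^{k+1-t})$ (the partition with $k+1-t$ parts equal to $t$) and $R_t^a$ is the union of $a$ copies of $R_t$. The hook length of a cell $c=(i,j)\in\lambda$ is $h_c(\lambda)=\lambda_i+\lambda'_j-i-j+1$. A $(k+1)$-core is a partition none of whose cells has hook length $k+1$; its length $|\kappa|_{k+1}$ is the number of its cells with hook length $<k+1$. The map $\mathfrak{p}$ with $\mathfrak{p}(\kappa)_i=\#\{j:(i,j)\in\kappa,\ h_{(i,j)}(\kappa)\le k\}$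 is a bijection from $(k+1)$-cores to $\mathcal{P}^k$; its inverse is denoted $\mathfrak{c}$. The residue of a cell $(i,j)$ is $j-i\bmod (k+1)$. For $(k+1)$-cores $\tau\subset\kappa$, $\kappa/\tau$ is a weak strip of size $r$ (weak $r$-strip) if $\kappa/\tau$ is a horizontal strip, $|\kappa|_{k+1}=|\tau|_{k+1}+r$, and the cells of $\kappa/\tau$ have exactly $r$ distinct residues. A removable corner of $\mu$ is a cell $(i,j)\in\mu$ with $(i+1,j),(i,j+1)\notin\mu$; a cell $(i,j)$ is $\lambda$-blocked if $(i+1,j)\in\lambda$; $r_{\lambda\mu}$ denotes the number of distinct residues of removable corners of $\mu$ that are not $\lambda$-blocked. Let $h_r$ be the complete homogeneous symmetric functions ($h_0=1$, $h_r=0$ for $r<0$) and $\Lambda^{(k)}=\mathbb{Z}[h_1,\dots,h_k]$. Binomial coefficients: $\binom{a}{b}=a(a-1)\cdots(a-b+1)/b!$ for $a\in\mathbb{Z}$, $b\in\mathbb{Z}_{\ge0}$, and $\binom ab=0$ for $b<0$. The $K$-$k$-Schur functions $\{g^{(k)}_\lambda\}_{\lambda\in\mathcal P^k}$ are the unique family of elements of $\Lambda^{(k)}$ with $g^{(k)}_\emptyset=1$ and, for all $\lambda\in\mathcal{P}^k$ and $0\le r\le k$, $$h_r\,g^{(k)}_\lambda=\sum_{s=0}^{r}(-1)^{r-s}\sum_{\mu\in\mathcal P^k:\ \mathfrak c(\mu)/\mathfrak c(\lambda)\text{ weak }s\text{-strip}}\binom{r_{\mathfrak c(\mu)\mathfrak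 c(\lambda)}}{r-s}g^{(k)}_\mu .$$ They form a $\mathbb{Z}$-basis of $\Lambda^{(k)}$ and $g^{(k)}_{(r)}=h_r$ for $1\le r\le k$. *)

theory Defs
  imports "HOL-Library.Multiset" "HOL-Library.Poly_Mapping" "HOL-Library.Function_Algebras"
begin

section \<open>Partitions and their diagrams\<close>

text \<open>
  A partition is the list of its nonzero parts, in weakly decreasing order. Rows and columns are
  numbered from 1, so \<open>\<nu>\<^sub>i\<close> is the list entry with index \<open>i - 1\<close>.
\<close>

definition is_partition :: "nat list \<Rightarrow> bool" where
  "is_partition \<nu> \<longleftrightarrow> sorted_wrt (\<ge>) \<nu> \<and> (\<forall>x\<in>set \<nu>. x > 0)"

definition bounded_partitions :: "nat \<Rightarrow> nat list set" where
  "bounded_partitions k = {\<nu>. is_partition \<nu> \<and> (\<forall>x\<in>set \<nu>. x \<le> k)}"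

definition part :: "nat list \<Rightarrow> nat \<Rightarrow> nat" where
  "part \<nu> i = (if 1 \<le> i \<and> i \<le> length \<nu> then \<nu> ! (i - 1) else 0)"

definition cells :: "nat list \<Rightarrow> (nat \<times> nat) set" where
  "cells \<nu> = {(i, j). 1 \<le> i \<and> 1 \<le> j \<and> j \<le> part \<nu> i}"

definition conj_part :: "nat list \<Rightarrow> nat \<Rightarrow> nat" where
  "conj_part \<nu> j = card {i. (i, j) \<in> cells \<nu>}"

definition part_union :: "nat list \<Rightarrow> nat list \<Rightarrow> nat list" where
  "part_union \<nu> \<mu> = rev (sort (\<nu> @ \<mu>))"

definition Union_parts :: "nat list list \<Rightarrow> nat list" where
  "Union_parts \<nu>s = foldr part_union \<nu>s []"

definition rect :: "nat \<Rightarrow> nat \<Rightarrow> nat list" where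
  "rect k t = replicate (k + 1 - t) t"

definition rect_power :: "nat \<Rightarrow> nat \<Rightarrow> nat \<Rightarrow> nat list" where
  "rect_power k t a = Union_parts (replicate a (rect k t))"

lemma is_partition_part_union:
  "is_partition \<nu> \<Longrightarrow> is_partition \<mu> \<Longrightarrow> is_partition (part_union \<nu> \<mu>)"
  by (auto simp: is_partition_def part_union_def sorted_wrt_rev)

lemma mset_part_union: "mset (part_union \<nu> \<mu>) = mset \<nu> + mset \<mu>"
  by (simp add: part_union_def)


section \<open>Cores\<close>

definition hook :: "nat list \<Rightarrow> nat \<times> nat \<Rightarrow> int" where
  "hook \<nu> c = (case c of (i, j) \<Rightarrow> int (part \<nu> i) + int (conj_part \<nu> j) - int i - int j + 1)"

text \<open>Throughout, \<open>k\<close> is the bound, so the cores in question are \<open>(k+1)\<close>-cores.\<close>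

definition is_core :: "nat \<Rightarrow> nat list \<Rightarrow> bool" where
  "is_core k \<kappa> \<longleftrightarrow> is_partition \<kappa> \<and> (\<forall>c\<in>cells \<kappa>. hook \<kappa> c \<noteq> int k + 1)"

definition core_length :: "nat \<Rightarrow> nat list \<Rightarrow> nat" where
  "core_length k \<kappa> = card {c \<in> cells \<kappa>. hook \<kappa> c < int k + 1}"

text \<open>
  In a \<open>(k+1)\<close>-core the last cell of every nonempty row has hook length at most \<open>k\<close>, so
  the list below has no zero entries.
\<close>

definition core_to_bounded :: "nat \<Rightarrow> nat list \<Rightarrow> nat list" where
  "core_to_bounded k \<kappa> =
     map (\<lambda>i. card {j. (i, j) \<in> cells \<kappa> \<and> hook \<kappa> (i, j) \<le> int k}) [1..<length \<kappa> + 1]"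

definition bounded_to_core :: "nat \<Rightarrow> nat list \<Rightarrow> nat list" where
  "bounded_to_core k = inv_into {\<kappa>. is_core k \<kappa>} (core_to_bounded k)"

definition residue :: "nat \<Rightarrow> nat \<times> nat \<Rightarrow> int" where
  "residue k c = (case c of (i, j) \<Rightarrow> (int j - int i) mod (int k + 1))"

definition horizontal_strip :: "nat list \<Rightarrow> nat list \<Rightarrow> bool" where
  "horizontal_strip \<kappa> \<tau> \<longleftrightarrow> cells \<tau> \<subseteq> cells \<kappa> \<and>
     (\<forall>i i' j. (i, j) \<in> cells \<kappa> - cells \<tau> \<longrightarrow> (i', j) \<in> cells \<kappa> - cells \<tau> \<longrightarrow> i = i')"

definition weak_strip :: "nat \<Rightarrow> nat \<Rightarrow> nat list \<Rightarrow> nat list \<Rightarrow> bool" where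
  "weak_strip k r \<kappa> \<tau> \<longleftrightarrow>
     is_core k \<kappa> \<and> is_core k \<tau> \<and> horizontal_strip \<kappa> \<tau> \<and>
     core_length k \<kappa> = core_length k \<tau> + r \<and>
     card (residue k ` (cells \<kappa> - cells \<tau>)) = r"

definition removable_corner :: "nat list \<Rightarrow> nat \<times> nat \<Rightarrow> bool" where
  "removable_corner \<mu> c \<longleftrightarrow>
     (case c of (i, j) \<Rightarrow> (i, j) \<in> cells \<mu> \<and> (i + 1, j) \<notin> cells \<mu> \<and> (i, j + 1) \<notin> cells \<mu>)"

definition blocked :: "nat list \<Rightarrow> nat \<times> nat \<Rightarrow> bool" where
  "blocked \<nu> c \<longleftrightarrow> (case c of (i, j) \<Rightarrow> (i + 1, j) \<in> cells \<nu>)"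

definition num_residues :: "nat \<Rightarrow> nat list \<Rightarrow> nat list \<Rightarrow> nat" where
  "num_residues k \<nu> \<mu> = card (residue k ` {c. removable_corner \<mu> c \<and> \<not> blocked \<nu> c})"


section \<open>Symmetric functions\<close>

text \<open>
  The ring \<open>\<Lambda>\<close> of symmetric functions over the integers is the (graded) inverse limit of the rings
  of symmetric polynomials in \<open>n\<close> variables: a symmetric function \<open>f\<close> is given by the sequence of
  polynomials \<open>f(x\<^sub>0, \<dots>, x\<^sub>n\<^sub>-\<^sub>1)\<close>, one for each \<open>n\<close>, with operations taken for each \<open>n\<close>
  separately (Function_Algebras). The type below is the ambient ring of all sequences of
  polynomials; the elements considered lie in the subring generated by the \<open>h\<^sub>r\<close>, hence
  in \<open>\<Lambda>\<close>. A monomial is its finitely supported exponent vector, and a polynomial a finitely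
  supported family of coefficients indexed by monomials.
\<close>

type_synonym monomial = "nat \<Rightarrow>\<^sub>0 nat"
type_synonym symfun = "nat \<Rightarrow> (monomial \<Rightarrow>\<^sub>0 int)"

definition monomials :: "nat \<Rightarrow> nat \<Rightarrow> monomial set" where
  "monomials n r =
     {m. Poly_Mapping.keys m \<subseteq> {..<n} \<and> (\<Sum>i<n. Poly_Mapping.lookup m i) = r}"

definition hsym :: "nat \<Rightarrow> symfun" where
  "hsym r = (\<lambda>n. \<Sum>m\<in>monomials n r. Poly_Mapping.single m 1)"

lemma finite_monomials: "finite (monomials n r)"
proof -
  let ?F = "{f. \<forall>i. (i \<in> {..<n} \<longrightarrow> f i \<in> {..r}) \<and> (i \<notin> {..<n} \<longrightarrow> f i = (0::nat))}"
  have "finite ?F"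
    by (rule finite_set_of_finite_funs) auto
  moreover have "Poly_Mapping.lookup ` monomials n r \<subseteq> ?F"
  proof (clarsimp simp: monomials_def)
    fix m :: monomial and i
    assume keys: "Poly_Mapping.keys m \<subseteq> {..<n}"
    show "(i < n \<longrightarrow> Poly_Mapping.lookup m i \<le> (\<Sum>i<n. Poly_Mapping.lookup m i)) \<and>
          (\<not> i < n \<longrightarrow> Poly_Mapping.lookup m i = 0)"
      using keys by (auto intro!: member_le_sum simp: in_keys_iff subset_iff)
  qed
  ultimately have "finite (Poly_Mapping.lookup ` monomials n r)"
    by (rule rev_finite_subset)
  then show ?thesis
    by (rule finite_imageD) (auto intro!: inj_onI poly_mapping_eqI)
qed

lemma hsym_0: "hsym 0 = 1"
proof -
  have "monomials n 0 = {0}" for n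
    by (auto simp: monomials_def subset_iff in_keys_iff intro!: poly_mapping_eqI)
  then show ?thesis
    by (simp add: hsym_def fun_eq_iff)
qed

text \<open>The ring \<open>\<Lambda>\<^sup>(\<^sup>k\<^sup>) = \<int>[h\<^sub>1, \<dots>, h\<^sub>k]\<close>, as a subring.\<close>

inductive_set Lambda_k :: "nat \<Rightarrow> symfun set" for k :: nat where
  one: "1 \<in> Lambda_k k"
| gen: "1 \<le> r \<Longrightarrow> r \<le> k \<Longrightarrow> hsym r \<in> Lambda_k k"
| diff: "f \<in> Lambda_k k \<Longrightarrow> g \<in> Lambda_k k \<Longrightarrow> f - g \<in> Lambda_k k"
| mult: "f \<in> Lambda_k k \<Longrightarrow> g \<in> Lambda_k k \<Longrightarrow> f * g \<in> Lambda_k k"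


section \<open>\<open>K\<close>-\<open>k\<close>-Schur functions\<close>

text \<open>
  The defining property of the family of \<open>K\<close>-\<open>k\<close>-Schur functions, which determines \<open>g\<close> uniquely on
  the \<open>k\<close>-bounded partitions (values of \<open>g\<close> on other lists are irrelevant). The inner sum is
  finite: \<open>\<mu>\<close> ranges over partitions of size \<open>|\<nu>| + s\<close>, since the core length of \<open>\<cc>(\<mu>)\<close> is \<open>|\<mu>|\<close>.
  In the binomial coefficient both arguments are natural numbers and \<open>s \<le> r\<close>.
\<close>

definition is_K_k_Schur :: "nat \<Rightarrow> (nat list \<Rightarrow> symfun) \<Rightarrow> bool" where
  "is_K_k_Schur k g \<longleftrightarrow>
     (\<forall>\<nu>\<in>bounded_partitions k. g \<nu> \<in> Lambda_k k) \<and>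
     g [] = 1 \<and>
     (\<forall>\<nu>\<in>bounded_partitions k. \<forall>r\<le>k.
        hsym r * g \<nu> =
          (\<Sum>s=0..r. (- 1) ^ (r - s) *
             (\<Sum>\<mu> | \<mu> \<in> bounded_partitions k \<and>
                     weak_strip k s (bounded_to_core k \<mu>) (bounded_to_core k \<nu>).
                of_nat (num_residues k (bounded_to_core k \<mu>) (bounded_to_core k \<nu>) choose (r - s))
                  * g \<mu>)))"

end

theory Submission
  imports Defs "HOL-Library.FuncSet"
begin

text \<open>
  If \<open>P = R\<^sub>t\<^sup>a\<close> and all parts of \<open>\<mu>\<close> exceed \<open>t\<close>, then \<open>g\<^sub>P\<^sub>\<union>\<^sub>\<mu> = g\<^sub>P g\<^sub>\<mu>\<close>; splitting off the
  rectangles in increasing order of \<open>t\<close> gives the theorem. To see this factorization, describe a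
  \<open>(k+1)\<close>-core by the largest bead in each residue class of its bead set. Adding copies of \<open>R\<^sub>t\<close> moves
  all but the \<open>t\<close> lowest of these beads up by a multiple of \<open>k+1\<close>. Hence, for \<open>\<nu>\<close> with all parts
  exceeding \<open>t\<close>, the weak strips over \<open>P \<union> \<nu>\<close> are the \<open>P \<union> \<mu>\<close> with \<open>\<mu>\<close> a weak strip over \<open>\<nu>\<close>,
  and the residue count \<open>r\<close> grows by one exactly if the new top row of \<open>\<mu>\<close> has length \<open>i < t\<close>. On the
  other hand \<open>r\<close> does not change when such a top row is lengthened from \<open>i\<close> to \<open>i + 1\<close>. By Pascal's
  rule the functions \<open>g\<^sub>P\<^sub>\<union>\<^sub>\<mu> - [1 \<le> i \<le> t] g\<^sub>P\<^sub>\<union>\<^sub>\<mu>\<^sub>-\<close>, where \<open>\<mu>\<^sub>-\<close> has the top row \<open>i\<close> replaced by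
  \<open>i - 1\<close>, satisfy the same recursion as the functions \<open>g\<^sub>P g\<^sub>\<mu>\<close>. Since the Pieri rule is triangular,
  the two families agree.
\<close>

section \<open>Beads of a partition\<close>

text \<open>A weak strip is defined by two counts only, its size and its number of residues, while
  adding rectangles changes both cores globally. The way around this is that the two counts force
  the old bead set united with the contents of the strip to be closed under subtracting
  \<open>n\<close> again. So a strip is a pair of runners M \<le> T, the residue count turns out to
  depend on T alone (\<open>ascents\<close>), and adding rectangles raises the values above t of
  both runners by the same multiple of \<open>n\<close>. For this the value t + 1 must be taken by a
  runner too. Hence the parts have to exceed t, and the rectangles are split off in increasing order
  of t. The additional residue arises where the raising tears apart the neighbouring values t and t
  + 1 of T. The Pieri rule over \<nu> also produces partitions with a short top row, for which the
  product formula needs a correction term. The induction therefore runs over all \<mu> whose parts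
  except possibly the last exceed t. As \<open>bounded_to_core\<close> is only an
  \<open>inv_into\<close>, the bijection between cores and bounded partitions has to be proved as
  well.\<close>

definition bead :: "nat list \<Rightarrow> nat \<Rightarrow> int" where
  "bead \<kappa> i = int (part \<kappa> i) - int i"

text \<open>The offset \<open>d\<close> is the charge of a Maya diagram. It is left free so that
  every set that is bounded above and contains all small integers is the bead set of exactly one
  pair of an offset and a partition.\<close>

definition beads :: "int \<Rightarrow> nat list \<Rightarrow> int set" where
  "beads d \<kappa> = {bead \<kappa> i + d | i. 1 \<le> i}"

text \<open>Column \<open>j\<close> is represented by an unoccupied position: beads and gaps
  together fill the integers, and a hook length is the bead of its row minus the gap of its
  column.\<close>

definition gap :: "nat list \<Rightarrow> nat \<Rightarrow> int" where
  "gap \<kappa> j = int j - 1 - int (conj_part \<kappa> j)"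

lemma part_antimono:
  assumes "is_partition \<kappa>" "1 \<le> i" "i \<le> j"
  shows "part \<kappa> j \<le> part \<kappa> i"
proof (cases "i = j \<or> j > length \<kappa>")
  case False
  then have "\<kappa> ! (j - 1) \<le> \<kappa> ! (i - 1)"
    using assms sorted_wrt_nth_less[of "(\<ge>)" \<kappa> "i - 1" "j - 1"]
    by (auto simp: is_partition_def)
  then show ?thesis
    using False assms by (auto simp: part_def)
qed (auto simp: part_def)

lemma part_pos_iff: "is_partition \<kappa> \<Longrightarrow> 0 < part \<kappa> i \<longleftrightarrow> 1 \<le> i \<and> i \<le> length \<kappa>"
  by (auto simp: part_def is_partition_def)

lemma bead_strict_antimono:
  "is_partition \<kappa> \<Longrightarrow> 1 \<le> i \<Longrightarrow> i < j \<Longrightarrow> bead \<kappa> j < bead \<kappa> i"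
  using part_antimono[of \<kappa> i j] by (simp add: bead_def)

lemma bead_less_iff:
  assumes "is_partition \<kappa>" "1 \<le> i" "1 \<le> j"
  shows "bead \<kappa> j < bead \<kappa> i \<longleftrightarrow> i < j"
  using bead_strict_antimono[OF assms(1), of i j] bead_strict_antimono[OF assms(1), of j i] assms
  by (metis linorder_cases order.asym)

lemma bead_le_iff:
  assumes "is_partition \<kappa>" "1 \<le> i" "1 \<le> j"
  shows "bead \<kappa> j \<le> bead \<kappa> i \<longleftrightarrow> i \<le> j"
  using bead_less_iff[OF assms(1,3,2)] by (simp add: not_less[symmetric])

lemma bead_inj: "is_partition \<kappa> \<Longrightarrow> 1 \<le> i \<Longrightarrow> 1 \<le> j \<Longrightarrow> bead \<kappa> i = bead \<kappa> j \<longleftrightarrow> i = j"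
  by (metis bead_le_iff order_antisym order_refl)

lemma bead_above_length: "length \<kappa> < i \<Longrightarrow> bead \<kappa> i = - int i"
  by (simp add: bead_def part_def)

lemma beads_iff_0: "y \<in> beads d \<kappa> \<longleftrightarrow> y - d \<in> beads 0 \<kappa>"
  by (auto simp: beads_def) (metis add_diff_cancel_right' diff_add_cancel)+

lemma downclosed_eq_atLeastAtMost:
  fixes H :: "nat set"
  assumes "finite H" "\<And>i. i \<in> H \<Longrightarrow> 1 \<le> i" "\<And>i j. i \<in> H \<Longrightarrow> 1 \<le> j \<Longrightarrow> j \<le> i \<Longrightarrow> j \<in> H"
  shows "H = {1..card H}"
proof (cases "H = {}")
  case False
  then have "i \<in> H \<longleftrightarrow> i \<in> {1..Max H}" for i
    using assms(2)[of i] assms(3)[of "Max H" i] Max_in[OF assms(1)] Max_ge[OF assms(1), of i] by auto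
  then have H: "H = {1..Max H}" by blast
  then have "card H = Max H"
    by (metis card_atLeastAtMost diff_Suc_1)
  then show ?thesis
    using H by simp
qed auto

lemma le_part_iff_le_conj_part:
  assumes "is_partition \<kappa>" "1 \<le> i" "1 \<le> j"
  shows "j \<le> part \<kappa> i \<longleftrightarrow> i \<le> conj_part \<kappa> j"
proof -
  let ?H = "{i. (i, j) \<in> cells \<kappa>}"
  have "?H \<subseteq> {1..length \<kappa>}"
    using assms part_pos_iff[OF assms(1)] by (fastforce simp: cells_def)
  then have "finite ?H"
    using finite_subset by blast
  then have "?H = {1..card ?H}"
    using assms part_antimono[OF assms(1)]
    by (intro downclosed_eq_atLeastAtMost) (auto simp: cells_def intro: order_trans)
  then have "?H = {1..conj_part \<kappa> j}"
    by (simp add: conj_part_def)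
  moreover have "i \<in> ?H \<longleftrightarrow> j \<le> part \<kappa> i"
    using assms by (auto simp: cells_def)
  ultimately show ?thesis
    using assms by auto
qed

lemma cell_iff_gap_less:
  assumes "is_partition \<kappa>" "1 \<le> i" "1 \<le> j"
  shows "(i, j) \<in> cells \<kappa> \<longleftrightarrow> gap \<kappa> j < bead \<kappa> i"
  using le_part_iff_le_conj_part[OF assms] assms
  by (cases "j \<le> part \<kappa> i") (auto simp: cells_def gap_def bead_def)

lemma hook_eq: "hook \<kappa> (i, j) = bead \<kappa> i - gap \<kappa> j"
  by (simp add: hook_def bead_def gap_def)

lemma gap_notin_beads:
  assumes "is_partition \<kappa>" "1 \<le> j"
  shows "gap \<kappa> j \<notin> beads 0 \<kappa>"
proof
  assume "gap \<kappa> j \<in> beads 0 \<kappa>"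
  then obtain i where "1 \<le> i" "gap \<kappa> j = bead \<kappa> i"
    by (auto simp: beads_def)
  then show False
    using le_part_iff_le_conj_part[OF assms(1), of i j] assms
    by (cases "j \<le> part \<kappa> i") (auto simp: gap_def bead_def)
qed

lemma notin_beads_is_gap:
  assumes "is_partition \<kappa>" "z \<notin> beads 0 \<kappa>"
  shows "\<exists>j\<ge>1. z = gap \<kappa> j"
proof -
  define P where "P = (\<lambda>i. 1 \<le> i \<and> bead \<kappa> i \<le> z)"
  have "P (Suc (length \<kappa>) + nat \<bar>z\<bar>)"
    by (auto simp: P_def bead_above_length)
  then have Pi: "P (Least P)" and least: "\<And>i. i < Least P \<Longrightarrow> \<not> P i"
    by (auto intro: LeastI dest: not_less_Least)
  define i where "i = Least P"
  have i: "1 \<le> i" "bead \<kappa> i < z"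
    using Pi assms(2) by (auto simp: P_def i_def beads_def order_less_le)
  \<comment> \<open>A column with \<open>i - 1\<close> cells has its gap at \<open>j - i\<close>, so
    \<open>z\<close> can only be the gap of this column.\<close>
  define j where "j = nat (z + int i)"
  have j: "part \<kappa> i < j" "int j = z + int i"
    using i by (auto simp: j_def bead_def)
  have "\<not> i \<le> conj_part \<kappa> j"
    using le_part_iff_le_conj_part[OF assms(1), of i j] i j by auto
  moreover have "i - 1 \<le> conj_part \<kappa> j"
  proof (cases "i = 1")
    case False
    then have "\<not> P (i - 1)" "1 \<le> i - 1"
      using i least[of "i - 1"] by (auto simp: i_def)
    then have "j \<le> part \<kappa> (i - 1)"
      using j by (auto simp: P_def bead_def)
    then show ?thesis
      using le_part_iff_le_conj_part[OF assms(1), of "i - 1" j] \<open>1 \<le> i - 1\<close> j by auto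
  qed auto
  ultimately show ?thesis
    using j i by (intro exI[of _ j]) (auto simp: gap_def)
qed

lemma gap_strict_mono:
  assumes "is_partition \<kappa>" "1 \<le> j" "j < j'"
  shows "gap \<kappa> j < gap \<kappa> j'"
proof -
  have "conj_part \<kappa> j' \<le> conj_part \<kappa> j"
  proof (cases "conj_part \<kappa> j' = 0")
    case False
    then show ?thesis
      using le_part_iff_le_conj_part[OF assms(1), of "conj_part \<kappa> j'" j']
        le_part_iff_le_conj_part[OF assms(1), of "conj_part \<kappa> j'" j] assms by auto
  qed auto
  then show ?thesis
    using assms by (auto simp: gap_def)
qed

lemma gap_inj_on: "is_partition \<kappa> \<Longrightarrow> inj_on (gap \<kappa>) {1..}"
  by (rule inj_onI) (metis atLeast_iff gap_strict_mono less_irrefl linorder_neqE_nat)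

lemma beads_lower: "y \<le> d - int (length \<kappa>) - 1 \<Longrightarrow> y \<in> beads d \<kappa>"
  unfolding beads_def
  by (rule CollectI, rule exI[of _ "nat (d - y)"]) (auto simp: bead_above_length)

lemma beads_upper: "is_partition \<kappa> \<Longrightarrow> y \<in> beads d \<kappa> \<Longrightarrow> y \<le> bead \<kappa> 1 + d"
  using bead_le_iff[of \<kappa> 1] by (auto simp: beads_def)

lemma partition_eqI:
  assumes "is_partition \<kappa>" "is_partition \<kappa>'" "mset \<kappa> = mset \<kappa>'"
  shows "\<kappa> = \<kappa>'"
proof -
  have "sorted (rev \<kappa>)" "sorted (rev \<kappa>')"
    using assms by (auto simp: is_partition_def sorted_wrt_rev)
  then have "rev \<kappa> = rev \<kappa>'"
    using assms(3) by (metis mset_rev properties_for_sort)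
  then show ?thesis by simp
qed

section \<open>Cores as bead sets closed under subtracting \<open>n\<close>\<close>

locale k_bound =
  fixes k :: nat
  assumes k_pos: "1 \<le> k"
begin

definition n :: int where "n = int k + 1"

lemma n_ge_2: "2 \<le> n"
  using k_pos by (simp add: n_def)

lemma n_pos: "0 < n"
  using n_ge_2 by simp

text \<open>By \<open>hook_eq\<close> a cell of hook length \<open>n\<close> is the same as a bead
  \<open>y\<close> for which \<open>y - n\<close> is a gap.\<close>

lemma is_core_iff:
  "is_core k \<kappa> \<longleftrightarrow> is_partition \<kappa> \<and> (\<forall>y\<in>beads d \<kappa>. y - n \<in> beads d \<kappa>)"
proof -
  have "(\<forall>c\<in>cells \<kappa>. hook \<kappa> c \<noteq> int k + 1) \<longleftrightarrow> (\<forall>y\<in>beads 0 \<kappa>. y - n \<in> beads 0 \<kappa>)"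
    if p: "is_partition \<kappa>"
  proof (intro iffI ballI)
    fix y assume h: "\<forall>c\<in>cells \<kappa>. hook \<kappa> c \<noteq> int k + 1" and "y \<in> beads 0 \<kappa>"
    then obtain i where i: "1 \<le> i" "y = bead \<kappa> i"
      by (auto simp: beads_def)
    show "y - n \<in> beads 0 \<kappa>"
    proof (rule ccontr)
      assume "y - n \<notin> beads 0 \<kappa>"
      then obtain j where "1 \<le> j" "y - n = gap \<kappa> j"
        using notin_beads_is_gap[OF p] by blast
      then show False
        using h i cell_iff_gap_less[OF p, of i j] n_ge_2
        by (auto simp: hook_eq n_def dest!: bspec[where x = "(i, j)"])
    qed
  next
    fix c assume h: "\<forall>y\<in>beads 0 \<kappa>. y - n \<in> beads 0 \<kappa>" and c: "c \<in> cells \<kappa>"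
    obtain i j where ij: "c = (i, j)" "1 \<le> i" "1 \<le> j"
      using c by (auto simp: cells_def)
    then have "bead \<kappa> i \<in> beads 0 \<kappa>"
      by (auto simp: beads_def)
    then have "bead \<kappa> i - n \<noteq> gap \<kappa> j"
      using h gap_notin_beads[OF p ij(3)] by auto
    then show "hook \<kappa> c \<noteq> int k + 1"
      using ij by (auto simp: hook_eq n_def)
  qed
  moreover have "(\<forall>y\<in>beads d \<kappa>. y - n \<in> beads d \<kappa>) \<longleftrightarrow> (\<forall>y\<in>beads 0 \<kappa>. y - n \<in> beads 0 \<kappa>)"
  proof (intro iffI ballI)
    fix y assume "\<forall>y\<in>beads d \<kappa>. y - n \<in> beads d \<kappa>" "y \<in> beads 0 \<kappa>"
    then show "y - n \<in> beads 0 \<kappa>"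
      using beads_iff_0[of "y + d" d \<kappa>] beads_iff_0[of "y + d - n" d \<kappa>] by (simp add: algebra_simps)
  next
    fix y assume "\<forall>y\<in>beads 0 \<kappa>. y - n \<in> beads 0 \<kappa>" "y \<in> beads d \<kappa>"
    then show "y - n \<in> beads d \<kappa>"
      using beads_iff_0[of y d \<kappa>] beads_iff_0[of "y - n" d \<kappa>] by (auto simp: algebra_simps)
  qed
  ultimately show ?thesis
    by (auto simp: is_core_def)
qed

definition gaps_below :: "int set \<Rightarrow> int \<Rightarrow> int set" where
  "gaps_below B x = {y. y \<notin> B \<and> x - n < y \<and> y < x}"

lemma finite_gaps_below: "finite (gaps_below B x)"
  by (rule finite_subset[of _ "{x-n..x}"]) (auto simp: gaps_below_def)

text \<open>The hook length is the distance from the bead of the row to the gap of the column, so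
  \<open>gap\<close> matches the counted cells with the empty positions at distance less than
  \<open>n\<close> below the bead.\<close>

lemma row_card:
  assumes p: "is_partition \<kappa>" and i: "1 \<le> i"
  shows "card {j. (i, j) \<in> cells \<kappa> \<and> hook \<kappa> (i, j) \<le> int k} = card (gaps_below (beads d \<kappa>) (bead \<kappa> i + d))"
proof -
  have "bij_betw (\<lambda>j. gap \<kappa> j + d) {j. (i, j) \<in> cells \<kappa> \<and> hook \<kappa> (i, j) \<le> int k}
     (gaps_below (beads d \<kappa>) (bead \<kappa> i + d))"
  proof (rule bij_betw_imageI)
    show "inj_on (\<lambda>j. gap \<kappa> j + d) {j. (i, j) \<in> cells \<kappa> \<and> hook \<kappa> (i, j) \<le> int k}"
      using gap_inj_on[OF p] by (auto simp: inj_on_def cells_def)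
    show "(\<lambda>j. gap \<kappa> j + d) ` {j. (i, j) \<in> cells \<kappa> \<and> hook \<kappa> (i, j) \<le> int k} =
      gaps_below (beads d \<kappa>) (bead \<kappa> i + d)" (is "?L = ?R")
    proof (intro set_eqI iffI)
      fix y assume "y \<in> ?L"
      then obtain j where j: "(i, j) \<in> cells \<kappa>" "hook \<kappa> (i, j) \<le> int k" "y = gap \<kappa> j + d"
        by auto
      then have "1 \<le> j" by (auto simp: cells_def)
      then show "y \<in> ?R"
        using j i cell_iff_gap_less[OF p i] gap_notin_beads[OF p]
        by (auto simp: gaps_below_def hook_eq n_def beads_iff_0[of _ d])
    next
      fix y assume y: "y \<in> ?R"
      then have "y - d \<notin> beads 0 \<kappa>"
        by (auto simp: gaps_below_def beads_iff_0[of _ d])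
      then obtain j where j: "1 \<le> j" "y - d = gap \<kappa> j"
        using notin_beads_is_gap[OF p] by blast
      then have "y = gap \<kappa> j + d" by simp
      then show "y \<in> ?L"
        using y i j cell_iff_gap_less[OF p i, of j]
        by (intro image_eqI[of _ _ j]) (auto simp: gaps_below_def hook_eq n_def)
    qed
  qed
  then show ?thesis by (rule bij_betw_same_card)
qed

lemma length_core_to_bounded [simp]: "length (core_to_bounded k \<kappa>) = length \<kappa>"
  by (simp add: core_to_bounded_def del: upt_Suc)

lemma nth_core_to_bounded:
  assumes "is_partition \<kappa>" "i < length \<kappa>"
  shows "core_to_bounded k \<kappa> ! i = card (gaps_below (beads d \<kappa>) (bead \<kappa> (Suc i) + d))"
  using assms row_card[OF assms(1), of "Suc i" d]
  by (simp add: core_to_bounded_def del: upt_Suc)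

lemma core_length_eq_sum_list: "is_partition \<kappa> \<Longrightarrow> core_length k \<kappa> = sum_list (core_to_bounded k \<kappa>)"
proof -
  assume p: "is_partition \<kappa>"
  let ?R = "\<lambda>i. {j. (i, j) \<in> cells \<kappa> \<and> hook \<kappa> (i, j) \<le> int k}"
  have "i \<in> {1..<length \<kappa> + 1}" if "(i, j) \<in> cells \<kappa>" for i j
    using that part_pos_iff[OF p, of i] by (auto simp: cells_def)
  then have "{c \<in> cells \<kappa>. hook \<kappa> c < int k + 1} = (SIGMA i:{1..<length \<kappa> + 1}. ?R i)"
    by fastforce
  moreover have "finite (?R i)" for i
    by (rule finite_subset[of _ "{..part \<kappa> i}"]) (auto simp: cells_def)
  ultimately have "core_length k \<kappa> = (\<Sum>i\<in>{1..<length \<kappa> + 1}. card (?R i))"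
    by (simp add: core_length_def card_SigmaI)
  also have "\<dots> = sum_list (core_to_bounded k \<kappa>)"
    unfolding core_to_bounded_def by (simp add: sum_set_upt_conv_sum_list_nat[symmetric] del: upt_Suc)
  finally show ?thesis .
qed

section \<open>Bead configurations of cores\<close>

lemma mod_gap: "a mod n = b mod n \<Longrightarrow> a < b \<Longrightarrow> a + n \<le> b"
proof -
  assume "a mod n = b mod n" "a < b"
  then have "n dvd b - a"
    by (metis mod_eq_dvd_iff)
  then show ?thesis
    using zdvd_imp_le[of n "b - a"] \<open>a < b\<close> by simp
qed

lemma n_simps [simp]: "n \<noteq> 0" "0 \<le> x mod n" "x mod n < n" "x mod n \<le> n"
  using n_pos pos_mod_sign[of n x] pos_mod_bound[of n x] by linarith+

lemma finite_classes [simp]: "finite {r. 0 \<le> r \<and> r < n \<and> P r}"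
  by (rule finite_subset[of _ "{0..<n}"]) auto

text \<open>
  A core is recorded by the function that sends an integer to the largest bead in its residue class
  modulo \<open>n\<close>; such a function is called a runner below.
\<close>

definition runner :: "(int \<Rightarrow> int) \<Rightarrow> bool" where
  "runner M \<longleftrightarrow> (\<forall>y. M y mod n = y mod n) \<and> (\<forall>y. M (y mod n) = M y)"

definition below :: "(int \<Rightarrow> int) \<Rightarrow> int set" where
  "below M = {y. y \<le> M y}"

lemma runner_mod: "runner M \<Longrightarrow> M y mod n = y mod n"
  by (simp add: runner_def)

lemma runner_cong: "runner M \<Longrightarrow> y mod n = z mod n \<Longrightarrow> M y = M z"
  unfolding runner_def by metis

lemma runner_shift [simp]: "runner M \<Longrightarrow> M (y + n) = M y" "runner M \<Longrightarrow> M (y - n) = M y"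
  by (rule runner_cong, assumption, simp)+

lemma runner_idem: "runner M \<Longrightarrow> M (M y) = M y"
  by (rule runner_cong, assumption, rule runner_mod)

lemma runner_le_iff: "runner M \<Longrightarrow> z mod n = y mod n \<Longrightarrow> z \<le> M y \<longleftrightarrow> z < M y + n"
  using mod_gap[of "M y" z] runner_mod[of M y] n_pos by linarith

lemma below_iff: "y \<in> below M \<longleftrightarrow> y \<le> M y"
  by (simp add: below_def)

lemma below_diff: "runner M \<Longrightarrow> y \<in> below M \<Longrightarrow> y - n \<in> below M"
  using n_pos by (simp add: below_iff)

lemma runner_in_below: "runner M \<Longrightarrow> M y \<in> below M"
  by (simp add: below_iff runner_idem)

lemma runner_notin_below: "runner M \<Longrightarrow> M y + n \<notin> below M"
  using n_pos by (simp add: below_iff runner_idem)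

lemma diff_mult_closed:
  assumes "\<And>y. y \<in> B \<Longrightarrow> y - n \<in> B" "y \<in> B"
  shows "y - int q * n \<in> B"
proof (induction q)
  case (Suc q)
  then show ?case
    using assms(1)[of "y - int q * n"] by (simp add: algebra_simps)
qed (use assms in auto)

lemma diff_closed_le:
  assumes "\<And>y. y \<in> B \<Longrightarrow> y - n \<in> B" "y \<in> B" "z \<le> y" "z mod n = y mod n"
  shows "z \<in> B"
proof -
  obtain q where q: "y - z = n * q"
    using assms(4) by (metis mod_eq_dvd_iff dvdE)
  then have "0 \<le> q"
    using assms(3) n_pos by (metis diff_ge_0_iff_ge zero_le_mult_iff not_less)
  then have "z = y - int (nat q) * n"
    using q by (simp add: algebra_simps)
  then show ?thesis
    using diff_mult_closed[of B y "nat q"] assms by metis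
qed

lemma runner_exists:
  assumes closed: "\<And>y. y \<in> B \<Longrightarrow> y - n \<in> B" and up: "\<And>y. y \<in> B \<Longrightarrow> y \<le> u"
    and lo: "\<And>y. y \<le> l \<Longrightarrow> y \<in> B"
  shows "\<exists>M. runner M \<and> below M = B"
proof -
  \<comment> \<open>The cut at \<open>l - n\<close> makes the set finite, and since all positions up
    to \<open>l\<close> lie in \<open>B\<close>, every class still has a member.\<close>
  define X where "X = (\<lambda>y. {x \<in> B. x mod n = y mod n \<and> l - n \<le> x})"
  define M where "M = (\<lambda>y. Max (X y))"
  have fin: "finite (X y)" for y
    by (rule finite_subset[of _ "{l - n..u}"]) (auto simp: X_def up)
  have "l - (l - y) mod n \<in> X y" for y
    using pos_mod_sign[OF n_pos, of "l - y"] pos_mod_bound[OF n_pos, of "l - y"]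
    by (auto simp: X_def intro!: lo) (metis mod_diff_right_eq diff_diff_eq2 add_diff_cancel_left')
  then have M_in: "M y \<in> X y" for y
    unfolding M_def using fin by (intro Max_in) auto
  have M_ge: "x \<le> M y" if "x \<in> X y" for x y
    unfolding M_def using fin that by (intro Max_ge)
  have "X (y mod n) = X y" for y
    by (simp add: X_def)
  then have "runner M"
    using M_in by (simp add: runner_def M_def) (simp add: X_def)
  moreover have "y \<in> below M \<longleftrightarrow> y \<in> B" for y
  proof
    assume "y \<in> below M"
    then show "y \<in> B"
      using M_in[of y] closed diff_closed_le[of B "M y" y] by (auto simp: below_iff X_def)
  next
    assume "y \<in> B"
    then show "y \<in> below M"
      using M_ge[of y y] M_in[of y] by (cases "l - n \<le> y") (auto simp: below_iff X_def)
  qed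
  ultimately show ?thesis by blast
qed

lemma runner_bounds:
  assumes "runner M"
  shows "\<exists>l u. \<forall>y. l \<le> M y \<and> M y \<le> u"
proof (intro exI allI conjI)
  let ?V = "M ` {0..<n}"
  have "M y \<in> ?V" for y
    using runner_cong[OF assms, of y "y mod n"] by force
  then show "Min ?V \<le> M y" "M y \<le> Max ?V" for y
    by simp_all
qed

text \<open>For a bead \<open>x\<close> this is the row of the bounded partition that belongs to \<open>x\<close>.\<close>

definition rank :: "(int \<Rightarrow> int) \<Rightarrow> int \<Rightarrow> nat" where
  "rank M x = card {r \<in> {0..<n}. M r < x - n}"

lemma rank_mono: "x \<le> y \<Longrightarrow> rank M x \<le> rank M y"
  unfolding rank_def by (rule card_mono) auto

lemma rank_pos_iff: "0 < rank M x \<longleftrightarrow> (\<exists>r\<in>{0..<n}. M r < x - n)"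
  by (auto simp: rank_def card_gt_0_iff)

lemma rep_between: "\<exists>y. y mod n = r mod n \<and> x \<le> y \<and> y < x + n" for x r :: int
proof (intro exI conjI)
  show "(x + (r - x) mod n) mod n = r mod n"
    by (simp add: mod_add_right_eq)
qed (use pos_mod_sign[OF n_pos, of "r - x"] pos_mod_bound[OF n_pos, of "r - x"] in auto)

text \<open>A class has at most one empty position strictly between \<open>x - n\<close> and
  \<open>x\<close>, and it has one exactly if its largest bead is below \<open>x - n\<close>; the
  class of the bead \<open>x\<close> itself has none.\<close>

lemma card_gaps_below:
  assumes M: "runner M" and x: "x \<in> below M"
  shows "card (gaps_below (below M) x) = rank M x"
  unfolding rank_def
proof (rule bij_betw_same_card, rule bij_betw_imageI)
  show "inj_on (\<lambda>y. y mod n) (gaps_below (below M) x)"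
  proof (rule inj_onI, rule ccontr)
    fix y z assume "y \<in> gaps_below (below M) x" "z \<in> gaps_below (below M) x"
      "y mod n = z mod n" "y \<noteq> z"
    then show False
      using mod_gap[of y z] mod_gap[of z y] by (auto simp: gaps_below_def neq_iff)
  qed
  show "(\<lambda>y. y mod n) ` gaps_below (below M) x = {r \<in> {0..<n}. M r < x - n}"
  proof (intro set_eqI iffI)
    fix r assume "r \<in> (\<lambda>y. y mod n) ` gaps_below (below M) x"
    then obtain y where y: "r = y mod n" "M y < y" "y < x"
      by (auto simp: gaps_below_def below_iff)
    then have "M y + n \<le> y"
      using mod_gap[of "M y" y] runner_mod[OF M, of y] by simp
    then show "r \<in> {r \<in> {0..<n}. M r < x - n}"
      using y runner_cong[OF M, of r y] by simp
  next
    fix r assume r: "r \<in> {r \<in> {0..<n}. M r < x - n}"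
    obtain y where y: "y mod n = r mod n" "x - n \<le> y" "y < x"
      using rep_between[of r "x - n"] by auto
    have My: "M y = M r"
      using runner_cong[OF M y(1)] .
    have "y \<noteq> x - n"
    proof
      assume "y = x - n"
      then have "M x = M y" using M by simp
      then show False
        using r x My n_pos by (simp add: below_iff)
    qed
    then show "r \<in> (\<lambda>y. y mod n) ` gaps_below (below M) x"
      using y r My by (intro image_eqI[of _ _ y]) (auto simp: gaps_below_def below_iff)
  qed
qed

lemma core_runner:
  assumes "is_core k \<kappa>"
  obtains M where "runner M" "below M = beads d \<kappa>"
proof -
  have p: "is_partition \<kappa>" and c: "\<And>y. y \<in> beads d \<kappa> \<Longrightarrow> y - n \<in> beads d \<kappa>"
    using assms is_core_iff[of \<kappa> d] by auto
  then show ?thesis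
    using runner_exists[OF c beads_upper[OF p] beads_lower] that by blast
qed

lemma core_if_runner: "is_partition \<kappa> \<Longrightarrow> runner M \<Longrightarrow> below M = beads d \<kappa> \<Longrightarrow> is_core k \<kappa>"
  using is_core_iff[of \<kappa> d] below_diff by metis

lemma bead_in_beads: "1 \<le> i \<Longrightarrow> bead \<kappa> i + d \<in> beads d \<kappa>"
  by (auto simp: beads_def)

lemma nth_core_to_bounded_rank:
  assumes "is_partition \<kappa>" "i < length \<kappa>" "runner M" "below M = beads d \<kappa>"
  shows "core_to_bounded k \<kappa> ! i = rank M (bead \<kappa> (Suc i) + d)"
  using nth_core_to_bounded[OF assms(1,2), of d] card_gaps_below[OF assms(3), of "bead \<kappa> (Suc i) + d"]
    assms(4) bead_in_beads[of "Suc i" \<kappa> d] by simp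

lemma rank_bead_pos_iff:
  assumes p: "is_partition \<kappa>" and M: "runner M" "below M = beads d \<kappa>" and i: "1 \<le> i"
  shows "0 < rank M (bead \<kappa> i + d) \<longleftrightarrow> i \<le> length \<kappa>"
proof
  assume "0 < rank M (bead \<kappa> i + d)"
  then obtain y where "y \<in> gaps_below (below M) (bead \<kappa> i + d)"
    using card_gaps_below[OF M(1), of "bead \<kappa> i + d"] M(2) bead_in_beads[OF i, of \<kappa> d]
    by (metis card_gt_0_iff ex_in_conv)
  then show "i \<le> length \<kappa>"
    using beads_lower[of y d \<kappa>] M(2) bead_above_length[of \<kappa> i]
    by (cases "i \<le> length \<kappa>") (auto simp: gaps_below_def)
next
  assume "i \<le> length \<kappa>"
  then have "(i, 1) \<in> cells \<kappa>"
    using part_pos_iff[OF p, of i] i by (auto simp: cells_def)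
  then have less: "gap \<kappa> 1 + d < bead \<kappa> i + d"
    using cell_iff_gap_less[OF p i, of 1] by simp
  define y where "y = gap \<kappa> 1 + d"
  have "y \<notin> below M"
    using gap_notin_beads[OF p, of 1] beads_iff_0[of y d \<kappa>] M(2) by (simp add: y_def)
  then have "M y + n \<le> y"
    using mod_gap[of "M y" y] runner_mod[OF M(1), of y] by (simp add: below_iff)
  then have "M (y mod n) < bead \<kappa> i + d - n"
    using less runner_cong[OF M(1), of "y mod n" y] by (simp add: y_def)
  then show "0 < rank M (bead \<kappa> i + d)"
    unfolding rank_pos_iff by (intro bexI[of _ "y mod n"]) auto
qed

lemma rank_le: "x \<in> below M \<Longrightarrow> runner M \<Longrightarrow> rank M x \<le> k"
proof -
  assume x: "x \<in> below M" and M: "runner M"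
  have "M (x mod n) = M x"
    using M by (simp add: runner_def)
  then have "{r \<in> {0..<n}. M r < x - n} \<subseteq> {0..<n} - {x mod n}"
    using x n_pos by (auto simp: below_iff)
  then have "rank M x \<le> card ({0..<n} - {x mod n})"
    unfolding rank_def by (intro card_mono) auto
  also have "\<dots> = k"
    by (subst card_Diff_singleton) (use n_pos in auto, simp add: n_def)
  finally show ?thesis .
qed

lemma core_to_bounded_in:
  assumes "is_core k \<kappa>"
  shows "core_to_bounded k \<kappa> \<in> bounded_partitions k"
proof -
  have p: "is_partition \<kappa>"
    using assms by (simp add: is_core_def)
  obtain M where M: "runner M" "below M = beads 0 \<kappa>"
    using core_runner[OF assms] by blast
  have nth: "core_to_bounded k \<kappa> ! i = rank M (bead \<kappa> (Suc i))" if "i < length \<kappa>" for i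
    using nth_core_to_bounded_rank[OF p that M] by simp
  have "sorted_wrt (\<ge>) (core_to_bounded k \<kappa>)"
    unfolding sorted_wrt_iff_nth_less
    using nth by (auto intro!: rank_mono less_imp_le[OF bead_strict_antimono[OF p]])
  moreover have "0 < x \<and> x \<le> k" if "x \<in> set (core_to_bounded k \<kappa>)" for x
  proof -
    obtain i where "i < length \<kappa>" "core_to_bounded k \<kappa> ! i = x"
      using \<open>x \<in> _\<close> unfolding in_set_conv_nth length_core_to_bounded by blast
    then have i: "i < length \<kappa>" "x = rank M (bead \<kappa> (Suc i))"
      using nth[of i] by simp_all
    then show ?thesis
      using rank_bead_pos_iff[OF p M, of "Suc i"] rank_le[of "bead \<kappa> (Suc i)" M]
        bead_in_beads[of "Suc i" \<kappa> 0] M by auto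
  qed
  ultimately show ?thesis
    by (auto simp: bounded_partitions_def is_partition_def)
qed

text \<open>Operations on runners are compared later through multiplicities of parts, which avoids
  numbering the rows. Rank 0 has to be excluded, because it belongs to the infinitely many beads of
  empty rows.\<close>

lemma count_core_to_bounded:
  assumes p: "is_partition \<kappa>" and M: "runner M" "below M = beads d \<kappa>" and t: "1 \<le> t"
  shows "count (mset (core_to_bounded k \<kappa>)) t = card {x \<in> below M. rank M x = t}"
proof -
  let ?I = "{i. i < length \<kappa> \<and> core_to_bounded k \<kappa> ! i = t}"
  have "count (mset (core_to_bounded k \<kappa>)) t = card ?I"
    by (simp add: count_mset length_filter_conv_card count_list_eq_length_filter eq_commute[of t])
  also have "\<dots> = card {x \<in> below M. rank M x = t}"
  proof (rule bij_betw_same_card, rule bij_betw_imageI)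
    show "inj_on (\<lambda>i. bead \<kappa> (Suc i) + d) ?I"
      using bead_inj[OF p] by (auto simp: inj_on_def)
    show "(\<lambda>i. bead \<kappa> (Suc i) + d) ` ?I = {x \<in> below M. rank M x = t}"
    proof (intro set_eqI iffI)
      fix x assume "x \<in> (\<lambda>i. bead \<kappa> (Suc i) + d) ` ?I"
      then show "x \<in> {x \<in> below M. rank M x = t}"
        using nth_core_to_bounded_rank[OF p _ M] bead_in_beads[of _ \<kappa> d] M(2) by auto
    next
      fix x assume x: "x \<in> {x \<in> below M. rank M x = t}"
      then obtain i where i: "1 \<le> i" "x = bead \<kappa> i + d"
        by (auto simp: M(2) beads_def)
      then have "i \<le> length \<kappa>"
        using rank_bead_pos_iff[OF p M, of i] x t by auto
      then show "x \<in> (\<lambda>i. bead \<kappa> (Suc i) + d) ` ?I"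
        using i x nth_core_to_bounded_rank[OF p _ M, of "i - 1"]
        by (intro image_eqI[of _ _ "i - 1"]) auto
    qed
  qed
  finally show ?thesis .
qed

lemma finite_rank_eq:
  assumes "runner M" "1 \<le> t"
  shows "finite {x \<in> below M. rank M x = t}"
proof -
  obtain l u where lu: "\<And>y. l \<le> M y" "\<And>y. M y \<le> u"
    using runner_bounds[OF assms(1)] by blast
  have "x \<in> {l..u}" if x: "x \<in> below M" "rank M x = t" for x
  proof -
    obtain r where "M r < x - n"
      using rank_pos_iff[of M x] x assms(2) by auto
    then show ?thesis
      using lu(1)[of r] lu(2)[of x] x(1) n_pos by (simp add: below_iff)
  qed
  then have "{x \<in> below M. rank M x = t} \<subseteq> {l..u}"
    by blast
  then show ?thesis
    using finite_subset by blast
qed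

lemma bead_cons_1: "bead (p # \<kappa>) (Suc 0) = int p - 1"
  by (simp add: bead_def part_def)

lemma bead_cons_Suc: "1 \<le> i \<Longrightarrow> bead (p # \<kappa>) (Suc i) = bead \<kappa> i - 1"
  by (auto simp: bead_def part_def nth_Cons')

lemma beads_cons: "beads d (p # \<kappa>) = insert (int p - 1 + d) (beads (d - 1) \<kappa>)"
proof (intro set_eqI iffI)
  fix y assume "y \<in> beads d (p # \<kappa>)"
  then obtain i where i: "1 \<le> i" "y = bead (p # \<kappa>) i + d"
    by (auto simp: beads_def)
  show "y \<in> insert (int p - 1 + d) (beads (d - 1) \<kappa>)"
  proof (cases "i = 1")
    case True
    then show ?thesis using i by (simp add: bead_cons_1)
  next
    case False
    then obtain i' where "i = Suc i'" "1 \<le> i'"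
      using i by (cases i) auto
    then show ?thesis
      using i bead_cons_Suc[of i' p \<kappa>] bead_in_beads[of i' \<kappa> "d - 1"]
      by (simp add: add.commute add_diff_eq diff_add_eq)
  qed
next
  fix y assume "y \<in> insert (int p - 1 + d) (beads (d - 1) \<kappa>)"
  then show "y \<in> beads d (p # \<kappa>)"
  proof
    assume "y = int p - 1 + d"
    then show ?thesis
      using bead_in_beads[of "Suc 0" "p # \<kappa>" d] by (simp add: bead_cons_1)
  next
    assume "y \<in> beads (d - 1) \<kappa>"
    then obtain i where "1 \<le> i" "y = bead \<kappa> i + (d - 1)"
      by (auto simp: beads_def)
    then show ?thesis
      using bead_in_beads[of "Suc i" "p # \<kappa>" d]
      by (simp add: bead_cons_Suc add.commute add_diff_eq diff_add_eq)
  qed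
qed

lemma beads_nil: "beads d [] = {..d - 1}"
proof (intro set_eqI iffI)
  fix y assume "y \<in> {..d - 1}"
  then show "y \<in> beads d []"
    using beads_lower[of y d "[]"] by simp
qed (auto simp: beads_def bead_def part_def)

lemma partition_of_beads_aux:
  assumes "finite X" "\<And>x. x \<in> X \<Longrightarrow> l < x"
  shows "\<exists>d \<kappa>. is_partition \<kappa> \<and> beads d \<kappa> = X \<union> {..l}"
  using assms
proof (induction X rule: finite_linorder_max_induct)
  case empty
  have "is_partition []"
    by (simp add: is_partition_def)
  then show ?case
    using beads_nil[of "l + 1"] by (intro exI[of _ "l + 1"] exI[of _ "[]"]) simp
next
  case (insert x X)
  then obtain d \<kappa> where \<kappa>: "is_partition \<kappa>" "beads d \<kappa> = X \<union> {..l}"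
    by auto
  have lt: "y < x" if "y \<in> beads d \<kappa>" for y
    using that insert.hyps(2) insert.prems[of x] by (fastforce simp: \<kappa>(2))
  have "bead \<kappa> 1 + d < x"
    by (rule lt) (simp add: bead_in_beads)
  then have p: "int (part \<kappa> 1) \<le> x - d"
    by (simp add: bead_def)
  show ?case
  proof (cases "x = d")
    \<comment> \<open>All positions below \<open>d\<close> are occupied and nothing else is, so the
      new bead fills the next position: the offset grows and the partition stays empty.\<close>
    case True
    then have "part \<kappa> 1 = 0" using p by simp
    then have "\<kappa> = []"
      using part_pos_iff[OF \<kappa>(1), of 1] by (simp add: Suc_le_eq)
    then have "beads (d + 1) \<kappa> = insert x (beads d \<kappa>)"
      using True by (simp add: beads_nil) (auto simp: set_eq_iff)
    then have "beads (d + 1) \<kappa> = insert x X \<union> {..l}"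
      using \<kappa>(2) by simp
    then show ?thesis
      using \<kappa>(1) by auto
  next
    case False
    then have x: "0 < x - d" using p by simp
    have "a \<le> nat (x - d)" if "a \<in> set \<kappa>" for a
    proof -
      obtain i where "i < length \<kappa>" "\<kappa> ! i = a"
        using \<open>a \<in> set \<kappa>\<close> by (auto simp: in_set_conv_nth)
      then have "a = part \<kappa> (Suc i)" by (simp add: part_def)
      then show ?thesis
        using part_antimono[OF \<kappa>(1), of 1 "Suc i"] p by simp
    qed
    then have "is_partition (nat (x - d) # \<kappa>)"
      using \<kappa>(1) x by (auto simp: is_partition_def)
    moreover have "beads (d + 1) (nat (x - d) # \<kappa>) = insert x X \<union> {..l}"
      using x by (simp add: beads_cons \<kappa>(2))
    ultimately show ?thesis by blast
  qed
qed

lemma partition_of_runner: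
  assumes "runner M"
  obtains d \<kappa> where "is_partition \<kappa>" "beads d \<kappa> = below M"
proof -
  obtain l u where lu: "\<And>y. l \<le> M y" "\<And>y. M y \<le> u"
    using runner_bounds[OF assms] by blast
  have "finite (below M \<inter> {l<..})"
  proof (rule finite_subset)
    show "below M \<inter> {l<..} \<subseteq> {l..u}"
    proof
      fix y assume "y \<in> below M \<inter> {l<..}"
      then show "y \<in> {l..u}"
        using lu(2)[of y] by (simp add: below_iff)
    qed
  qed simp
  moreover have "below M \<inter> {l<..} \<union> {..l} = below M"
  proof (intro set_eqI iffI)
    fix y assume "y \<in> below M"
    then show "y \<in> below M \<inter> {l<..} \<union> {..l}" by auto
  next
    fix y assume "y \<in> below M \<inter> {l<..} \<union> {..l}"
    then show "y \<in> below M"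
      using lu(1)[of y] by (auto simp: below_iff)
  qed
  ultimately show ?thesis
    using partition_of_beads_aux[of "below M \<inter> {l<..}" l] that by auto
qed

lemma exists_rank:
  fixes V :: "int set"
  assumes "finite V" "p < card V"
  shows "\<exists>v\<in>V. card {w \<in> V. w < v} = p"
proof -
  let ?f = "\<lambda>v. card {w \<in> V. w < v}"
  have less: "?f v < ?f w" if "v \<in> V" "w \<in> V" "v < w" for v w
    using assms(1) that by (intro psubset_card_mono) auto
  have "inj_on ?f V"
  proof (rule inj_onI, rule ccontr)
    fix v w assume "v \<in> V" "w \<in> V" "?f v = ?f w" "v \<noteq> w"
    then show False
      using less[of v w] less[of w v] by linarith
  qed
  then have "card (?f ` V) = card V"
    by (rule card_image)
  moreover have "?f v < card V" if "v \<in> V" for v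
    using that assms(1) by (intro psubset_card_mono) auto
  then have "?f ` V \<subseteq> {..<card V}"
    by blast
  ultimately have "?f ` V = {..<card V}"
    by (intro card_subset_eq) auto
  then have "p \<in> ?f ` V"
    using assms(2) by simp
  then show ?thesis
    by blast
qed

end

section \<open>Horizontal strips\<close>

definition num_ge :: "int set \<Rightarrow> int \<Rightarrow> nat" where
  "num_ge B y = card {x \<in> B. y \<le> x}"

text \<open>The beads decrease strictly, so those at or above \<open>y\<close> belong to an initial
  segment of the rows. This recovers the bead of each row from the bead set and allows bead sets to
  be compared by counting.\<close>

lemma le_num_ge_iff:
  assumes p: "is_partition \<kappa>" and i: "1 \<le> i"
  shows "i \<le> num_ge (beads d \<kappa>) y \<longleftrightarrow> y \<le> bead \<kappa> i + d"
proof -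
  define H where "H = {i. 1 \<le> i \<and> y \<le> bead \<kappa> i + d}"
  have "i \<le> length \<kappa> + nat (d - y)" if "i \<in> H" for i
    using that bead_above_length[of \<kappa> i] by (cases "length \<kappa> < i") (auto simp: H_def)
  then have fin: "finite H"
    by (intro finite_subset[of H "{..length \<kappa> + nat (d - y)}"]) auto
  have "y \<le> bead \<kappa> j + d" if "y \<le> bead \<kappa> i + d" "1 \<le> j" "j \<le> i" for i j
    using that bead_le_iff[OF p, of j i] by linarith
  with fin have H: "H = {1..card H}"
    by (intro downclosed_eq_atLeastAtMost) (auto simp: H_def)
  have "{x \<in> beads d \<kappa>. y \<le> x} = (\<lambda>i. bead \<kappa> i + d) ` H"
    by (auto simp: beads_def H_def)
  moreover have "inj_on (\<lambda>i. bead \<kappa> i + d) H"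
    using bead_inj[OF p] by (auto simp: inj_on_def H_def)
  ultimately have "num_ge (beads d \<kappa>) y = card H"
    by (simp add: num_ge_def card_image)
  moreover have "i \<in> H \<longleftrightarrow> i \<in> {1..card H}"
    using H by simp
  ultimately show ?thesis
    using i by (simp add: H_def)
qed

lemma partition_eq_partI:
  assumes "is_partition \<kappa>" "is_partition \<kappa>'" "\<And>i. 1 \<le> i \<Longrightarrow> part \<kappa> i = part \<kappa>' i"
  shows "\<kappa> = \<kappa>'"
proof (rule nth_equalityI)
  have "i \<le> length \<kappa> \<longleftrightarrow> i \<le> length \<kappa>'" if "1 \<le> i" for i
    using that assms part_pos_iff[of \<kappa> i] part_pos_iff[of \<kappa>' i] by auto
  from this[of "length \<kappa>"] this[of "length \<kappa>'"] show l: "length \<kappa> = length \<kappa>'"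
    by (cases "length \<kappa>"; cases "length \<kappa>'") auto
  fix i assume "i < length \<kappa>"
  then show "\<kappa> ! i = \<kappa>' ! i"
    using assms(3)[of "Suc i"] l by (simp add: part_def)
qed

lemma beads_unique:
  assumes p: "is_partition \<kappa>" "is_partition \<kappa>'" and eq: "beads d \<kappa> = beads d' \<kappa>'"
  shows "d = d'" "\<kappa> = \<kappa>'"
proof -
  have iff: "y \<le> bead \<kappa> i + d \<longleftrightarrow> y \<le> bead \<kappa>' i + d'" if "1 \<le> i" for i y
    using le_num_ge_iff[OF p(1) that, of d y] le_num_ge_iff[OF p(2) that, of d' y] eq by simp
  have bead: "bead \<kappa> i + d = bead \<kappa>' i + d'" if "1 \<le> i" for i
    using iff[OF that, of "bead \<kappa> i + d"] iff[OF that, of "bead \<kappa>' i + d'"] by simp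
  show "d = d'"
    using bead[of "length \<kappa> + length \<kappa>' + 1"] by (simp add: bead_above_length)
  then show "\<kappa> = \<kappa>'"
    using bead by (intro partition_eq_partI p) (simp add: bead_def)
qed

text \<open>This is interlacing: no column contains two new cells exactly if row i + 1 of \<kappa>
  is no longer than row i of \<tau>.\<close>

lemma horizontal_strip_iff:
  assumes p: "is_partition \<kappa>" "is_partition \<tau>"
  shows "horizontal_strip \<kappa> \<tau> \<longleftrightarrow>
    (\<forall>i\<ge>1. bead \<tau> i \<le> bead \<kappa> i \<and> bead \<kappa> (Suc i) < bead \<tau> i)"
proof (intro iffI allI impI)
  fix i :: nat assume h: "horizontal_strip \<kappa> \<tau>" and i: "1 \<le> i"
  have "part \<tau> i \<le> part \<kappa> i"
    using h i unfolding horizontal_strip_def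
    by (cases "part \<tau> i = 0") (auto simp: cells_def dest!: subsetD[where c = "(i, part \<tau> i)"])
  moreover have "part \<kappa> (Suc i) \<le> part \<tau> i"
  proof (rule ccontr)
    assume "\<not> part \<kappa> (Suc i) \<le> part \<tau> i"
    then have "(i, Suc (part \<tau> i)) \<in> cells \<kappa> - cells \<tau>" "(Suc i, Suc (part \<tau> i)) \<in> cells \<kappa> - cells \<tau>"
      using i part_antimono[OF p(1), of i "Suc i"] part_antimono[OF p(2), of i "Suc i"]
      by (auto simp: cells_def)
    then show False
      using h unfolding horizontal_strip_def by (metis n_not_Suc_n)
  qed
  ultimately show "bead \<tau> i \<le> bead \<kappa> i \<and> bead \<kappa> (Suc i) < bead \<tau> i"
    by (simp add: bead_def)
next
  assume h: "\<forall>i\<ge>1. bead \<tau> i \<le> bead \<kappa> i \<and> bead \<kappa> (Suc i) < bead \<tau> i"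
  have 1: "part \<tau> i \<le> part \<kappa> i" if "1 \<le> i" for i
    using h that by (simp add: bead_def)
  have 2: "part \<kappa> i' \<le> part \<tau> i" if "1 \<le> i" "i < i'" for i i'
  proof -
    have "part \<kappa> (Suc i) \<le> part \<tau> i"
      using h that(1) by (auto simp: bead_def)
    then show ?thesis
      using part_antimono[OF p(1), of "Suc i" i'] that by simp
  qed
  show "horizontal_strip \<kappa> \<tau>"
    unfolding horizontal_strip_def
  proof (intro conjI allI impI)
    show "cells \<tau> \<subseteq> cells \<kappa>"
      using 1 by (auto simp: cells_def intro: order_trans)
    fix i i' j assume "(i, j) \<in> cells \<kappa> - cells \<tau>" "(i', j) \<in> cells \<kappa> - cells \<tau>"
    then have "1 \<le> i" "1 \<le> i'" "part \<tau> i < j" "j \<le> part \<kappa> i" "part \<tau> i' < j" "j \<le> part \<kappa> i'"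
      by (auto simp: cells_def)
    then show "i = i'"
      using 2[of i i'] 2[of i' i] by (cases i i' rule: linorder_cases) auto
  qed
qed

definition contents :: "nat list \<Rightarrow> nat list \<Rightarrow> int set" where
  "contents \<kappa> \<tau> = (\<lambda>(i, j). int j - int i) ` (cells \<kappa> - cells \<tau>)"

lemma contents_eq: "contents \<kappa> \<tau> = {y. \<exists>i\<ge>1. bead \<tau> i < y \<and> y \<le> bead \<kappa> i}"
proof (intro set_eqI iffI)
  fix y assume "y \<in> contents \<kappa> \<tau>"
  then obtain i j where "(i, j) \<in> cells \<kappa> - cells \<tau>" "y = int j - int i"
    by (auto simp: contents_def)
  then show "y \<in> {y. \<exists>i\<ge>1. bead \<tau> i < y \<and> y \<le> bead \<kappa> i}"
    by (auto simp: cells_def bead_def intro!: exI[of _ i])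
next
  fix y assume "y \<in> {y. \<exists>i\<ge>1. bead \<tau> i < y \<and> y \<le> bead \<kappa> i}"
  then obtain i where i: "1 \<le> i" "bead \<tau> i < y" "y \<le> bead \<kappa> i"
    by auto
  then have "(i, nat (y + int i)) \<in> cells \<kappa> - cells \<tau>"
    by (auto simp: cells_def bead_def)
  then show "y \<in> contents \<kappa> \<tau>"
    unfolding contents_def by (rule rev_image_eqI) (use i in \<open>auto simp: bead_def\<close>)
qed

text \<open>
  A strip over the bead set \<open>B\<close> is given by the set \<open>C\<close> of contents of its cells: a bead at
  \<open>x\<close> slides to the right as long as the next position lies in \<open>C\<close>.
\<close>

definition strip :: "int set \<Rightarrow> int set \<Rightarrow> bool" where
  "strip B C \<longleftrightarrow> finite C \<and> B \<inter> C = {} \<and> (\<forall>y\<in>C. y - 1 \<in> B \<union> C)"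

definition moved :: "int set \<Rightarrow> int set \<Rightarrow> int set" where
  "moved B C = {y \<in> B \<union> C. y + 1 \<notin> C}"

lemma finite_contents: "is_partition \<kappa> \<Longrightarrow> finite (contents \<kappa> \<tau>)"
proof -
  assume p: "is_partition \<kappa>"
  have "cells \<kappa> \<subseteq> (SIGMA i:{..length \<kappa>}. {..part \<kappa> i})"
    using part_pos_iff[OF p] by (fastforce simp: cells_def)
  then have "finite (cells \<kappa>)"
    by (rule finite_subset) auto
  then show ?thesis
    by (simp add: contents_def)
qed

text \<open>The bead of row i slides from \<open>bead \<tau> i\<close> to
  \<open>bead \<kappa> i\<close>. By interlacing the positions passed in different rows are disjoint
  and contain no old bead.\<close>

lemma strip_of_horizontal_strip:
  assumes p: "is_partition \<kappa>" "is_partition \<tau>" and h: "horizontal_strip \<kappa> \<tau>"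
    and C: "C = (\<lambda>y. y + d) ` contents \<kappa> \<tau>"
  shows "strip (beads d \<tau>) C" "beads d \<kappa> = moved (beads d \<tau>) C"
proof -
  have le: "bead \<tau> i \<le> bead \<kappa> i" and less: "bead \<kappa> (Suc i) < bead \<tau> i" if "1 \<le> i" for i
    using h that horizontal_strip_iff[OF p] by auto
  have less': "bead \<kappa> i' < bead \<tau> i" if "1 \<le> i" "i < i'" for i i'
    using less[OF that(1)] bead_le_iff[OF p(1), of "Suc i" i'] that by auto
  have C_iff: "y \<in> C \<longleftrightarrow> (\<exists>i\<ge>1. bead \<tau> i + d < y \<and> y \<le> bead \<kappa> i + d)" for y
  proof -
    have "y \<in> C \<longleftrightarrow> y - d \<in> contents \<kappa> \<tau>"
      unfolding C by force
    then show ?thesis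
      by (auto simp: contents_eq algebra_simps)
  qed
  have disj: "bead \<tau> l + d \<notin> C" if "1 \<le> l" for l
  proof
    assume "bead \<tau> l + d \<in> C"
    then obtain i where i: "1 \<le> i" "bead \<tau> i < bead \<tau> l" "bead \<tau> l \<le> bead \<kappa> i"
      by (auto simp: C_iff)
    then show False
      using less'[of l i] bead_less_iff[OF p(2), of l i] that by auto
  qed
  have prev: "y - 1 \<in> beads d \<tau> \<union> C" if y: "y \<in> C" for y
  proof -
    obtain i where i: "1 \<le> i" "bead \<tau> i + d < y" "y \<le> bead \<kappa> i + d"
      using y by (auto simp: C_iff)
    show ?thesis
    proof (cases "y - 1 = bead \<tau> i + d")
      case True
      then show ?thesis
        using i by (auto simp: beads_def)
    next
      case False
      then show ?thesis using i by (auto simp: C_iff)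
    qed
  qed
  show "strip (beads d \<tau>) C"
    unfolding strip_def
  proof (intro conjI ballI)
    show "finite C"
      using finite_contents[OF p(1), of \<tau>] by (simp add: C)
  qed (use disj prev in \<open>auto simp: beads_def\<close>)
  show "beads d \<kappa> = moved (beads d \<tau>) C"
  proof (intro set_eqI iffI)
    fix y assume "y \<in> beads d \<kappa>"
    then obtain i where i: "1 \<le> i" "y = bead \<kappa> i + d"
      by (auto simp: beads_def)
    have "y + 1 \<notin> C"
    proof
      assume "y + 1 \<in> C"
      then obtain l where l: "1 \<le> l" "bead \<tau> l + d < y + 1" "y + 1 \<le> bead \<kappa> l + d"
        by (auto simp: C_iff)
      then have "l < i"
        using i bead_less_iff[OF p(1), of l i] by auto
      then show False
        using less'[of l i] l i by auto
    qed
    moreover have "y \<in> beads d \<tau> \<union> C"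
      using i le[of i] by (cases "bead \<tau> i = bead \<kappa> i") (auto simp: C_iff beads_def)
    ultimately show "y \<in> moved (beads d \<tau>) C"
      by (simp add: moved_def)
  next
    fix y assume "y \<in> moved (beads d \<tau>) C"
    then have "y + 1 \<notin> C" "y \<in> beads d \<tau> \<union> C"
      by (auto simp: moved_def)
    then obtain i where i: "1 \<le> i" "bead \<tau> i + d \<le> y" "y \<le> bead \<kappa> i + d"
      using le by (fastforce simp: beads_def C_iff)
    then have "y = bead \<kappa> i + d"
      using \<open>y + 1 \<notin> C\<close> by (auto simp: C_iff)
    then show "y \<in> beads d \<kappa>"
      using i by (auto simp: beads_def)
  qed
qed

lemma num_ge_rec:
  assumes "\<And>x. x \<in> B \<Longrightarrow> x \<le> u"
  shows "num_ge B y = num_ge B (y + 1) + of_bool (y \<in> B)"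
proof -
  have "finite {x \<in> B. y + 1 \<le> x}"
    by (rule finite_subset[of _ "{y..u}"]) (auto simp: assms)
  moreover have "{x \<in> B. y \<le> x} = (if y \<in> B then insert y {x \<in> B. y + 1 \<le> x} else {x \<in> B. y + 1 \<le> x})"
    by (auto simp: order_le_less)
  ultimately show ?thesis
    by (auto simp: num_ge_def)
qed

text \<open>Exactly one bead passes or reaches each position of \<open>C\<close>, coming from below
  it; no bead crosses any other position.\<close>

lemma num_ge_moved:
  assumes s: "strip B C" and u: "\<And>x. x \<in> B \<union> C \<Longrightarrow> x \<le> u"
  shows "num_ge (moved B C) y = num_ge B y + of_bool (y \<in> C)"
proof (induction "nat (u + 1 - y)" arbitrary: y)
  case 0
  then have "{x \<in> B. y \<le> x} = {}" "{x \<in> moved B C. y \<le> x} = {}" "y \<notin> C"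
    using u by (force simp: moved_def)+
  then show ?case
    unfolding num_ge_def by (simp del: Collect_empty_eq)
next
  case (Suc m)
  have "num_ge (moved B C) y = num_ge (moved B C) (y + 1) + of_bool (y \<in> moved B C)"
    using u by (intro num_ge_rec[of _ u]) (auto simp: moved_def)
  also have "num_ge (moved B C) (y + 1) = num_ge B (y + 1) + of_bool (y + 1 \<in> C)"
    using Suc by auto
  also have "num_ge B (y + 1) + of_bool (y + 1 \<in> C) + of_bool (y \<in> moved B C) =
     num_ge B (y + 1) + of_bool (y \<in> B) + of_bool (y \<in> C)"
    using s by (auto simp: strip_def moved_def)
  also have "num_ge B (y + 1) + of_bool (y \<in> B) = num_ge B y"
    using u by (intro num_ge_rec[of _ u, symmetric]) auto
  finally show ?case .
qed

lemma horizontal_strip_of_strip: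
  assumes p: "is_partition \<kappa>" "is_partition \<tau>" and s: "strip (beads d \<tau>) C"
    and B': "beads d' \<kappa> = moved (beads d \<tau>) C"
  shows "d' = d" "horizontal_strip \<kappa> \<tau>" "C = (\<lambda>y. y + d) ` contents \<kappa> \<tau>"
proof -
  have fin: "finite C"
    using s by (simp add: strip_def)
  define u where "u = Max (insert (bead \<tau> 1 + d) C)"
  have "bead \<tau> 1 + d \<le> u"
    using fin unfolding u_def by (intro Max_ge) auto
  then have "x \<le> u" if "x \<in> beads d \<tau> \<union> C" for x
    using that fin beads_upper[OF p(2), of x d] Max_ge[of "insert (bead \<tau> 1 + d) C" x]
    unfolding u_def by (metis Un_iff finite_insert insertI2 order_trans)
  note num = num_ge_moved[OF s this, folded B']
  have iff: "y \<le> bead \<kappa> i + d' \<longleftrightarrow> i \<le> num_ge (beads d \<tau>) y + of_bool (y \<in> C)"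
    and iff': "y \<le> bead \<tau> i + d \<longleftrightarrow> i \<le> num_ge (beads d \<tau>) y" if "1 \<le> i" for i y
    using le_num_ge_iff[OF p(1) that, of d' y] le_num_ge_iff[OF p(2) that, of d y] num[of y] by auto
  \<comment> \<open>A row without cells in both partitions, so far up that its position lies below
    all of \<open>C\<close>; there the two bead counts agree, and this identifies the
    offsets.\<close>
  define i where "i = length \<kappa> + length \<tau> + 1 + nat (d - Min (insert 0 C)) + nat (d' - Min (insert 0 C))"
  have low: "y \<notin> C" if "y < Min (insert 0 C)" for y
    using fin that Min_le[of "insert 0 C" y] by auto
  have 1: "d - int i \<notin> C" "d' - int i \<notin> C"
    by (auto intro!: low simp: i_def)
  have 2: "bead \<kappa> i = - int i" "bead \<tau> i = - int i"
    by (rule bead_above_length, simp add: i_def)+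
  have "1 \<le> i" by (simp add: i_def)
  note 3 = iff[OF this] iff'[OF this]
  have "d \<le> d'"
    using 3[of "d - int i"] 1 2 by simp
  moreover have "d' \<le> d"
    using 3[of "d' - int i"] 1 2 by simp
  ultimately show d: "d' = d" by simp
  have le: "bead \<tau> i \<le> bead \<kappa> i" if "1 \<le> i" for i
    using iff[OF that, of "bead \<tau> i + d"] iff'[OF that, of "bead \<tau> i + d"] d by auto
  have less: "bead \<kappa> (Suc i) < bead \<tau> i" if i: "1 \<le> i" for i
  proof (rule ccontr)
    assume c: "\<not> ?thesis"
    define y where "y = bead \<tau> i + d"
    have "y \<notin> C"
      using s i by (auto simp: strip_def y_def beads_def)
    then show False
      using c iff[of "Suc i" y] iff'[of "Suc i" y] d bead_strict_antimono[OF p(2), of i "Suc i"] i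
      by (auto simp: y_def)
  qed
  show "horizontal_strip \<kappa> \<tau>"
    unfolding horizontal_strip_iff[OF p] using le less by blast
  have C: "y \<in> C \<longleftrightarrow> (\<exists>i\<ge>1. bead \<tau> i + d < y \<and> y \<le> bead \<kappa> i + d)" for y
  proof
    assume "y \<in> C"
    then show "\<exists>i\<ge>1. bead \<tau> i + d < y \<and> y \<le> bead \<kappa> i + d"
      using iff[of "Suc (num_ge (beads d \<tau>) y)" y] iff'[of "Suc (num_ge (beads d \<tau>) y)" y] d
      by (intro exI[of _ "Suc (num_ge (beads d \<tau>) y)"]) auto
  next
    assume "\<exists>i\<ge>1. bead \<tau> i + d < y \<and> y \<le> bead \<kappa> i + d"
    then obtain i where i: "1 \<le> i" "bead \<tau> i + d < y" "y \<le> bead \<kappa> i + d" by blast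
    then show "y \<in> C"
      using iff[OF i(1), of y] iff'[OF i(1), of y] d by (cases "y \<in> C") auto
  qed
  show "C = (\<lambda>y. y + d) ` contents \<kappa> \<tau>"
  proof (intro set_eqI)
    fix y
    have "y \<in> (\<lambda>y. y + d) ` contents \<kappa> \<tau> \<longleftrightarrow> y - d \<in> contents \<kappa> \<tau>"
      by force
    then show "y \<in> C \<longleftrightarrow> y \<in> (\<lambda>y. y + d) ` contents \<kappa> \<tau>"
      by (auto simp: C contents_eq algebra_simps)
  qed
qed

section \<open>The bijection between cores and bounded partitions\<close>

context k_bound begin

text \<open>With the later rows fixed, the number of gaps in the window of row i increases strictly
  with its bead. Moving the bead from x up to x' creates the x' - x gaps from x to x' - 1, and loses
  only gaps strictly between x - n and x' - n, since x' - n is a bead of a core.\<close>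

lemma core_bead_not_less:
  assumes core: "is_core k \<kappa>" "is_core k \<kappa>'" and i: "1 \<le> i"
    and above: "\<And>j. i < j \<Longrightarrow> bead \<kappa> j = bead \<kappa>' j"
    and eq: "card (gaps_below (beads 0 \<kappa>) (bead \<kappa> i)) = card (gaps_below (beads 0 \<kappa>') (bead \<kappa>' i))"
  shows "\<not> bead \<kappa> i < bead \<kappa>' i"
proof
  assume less: "bead \<kappa> i < bead \<kappa>' i"
  have p: "is_partition \<kappa>" "is_partition \<kappa>'"
    using core by (auto simp: is_core_def)
  define G where "G = bead \<kappa> ` {i<..}"
  define x x' where "x = bead \<kappa> i" and "x' = bead \<kappa>' i"
  have mem: "y \<in> beads 0 \<kappa> \<longleftrightarrow> y \<in> G" if "y < x" for y
    using that i bead_less_iff[OF p(1) i] by (auto simp: beads_def G_def x_def)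
  have mem': "y \<in> beads 0 \<kappa>' \<longleftrightarrow> y \<in> G" if "y < x'" for y
    using that i bead_less_iff[OF p(2) i] above by (auto simp: beads_def G_def x'_def)
  have G_less: "y < x" if "y \<in> G" for y
    using that i bead_strict_antimono[OF p(1) i] by (auto simp: G_def x_def)
  have "x - n \<in> beads 0 \<kappa>" "x' - n \<in> beads 0 \<kappa>'"
    using core is_core_iff[of _ 0] bead_in_beads[OF i, of _ 0] unfolding x_def x'_def by auto
  then have nG: "x - n \<in> G" "x' - n \<in> G"
    using mem[of "x - n"] mem'[of "x' - n"] n_pos by auto
  define A where "A = {y. y \<notin> G \<and> x' - n < y \<and> y < x}"
  have fA: "finite A"
    by (rule finite_subset[of _ "{x' - n..x}"]) (auto simp: A_def)
  have "gaps_below (beads 0 \<kappa>') x' = A \<union> {x..<x'}"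
    using mem' G_less G_less[OF nG(2)] less by (force simp: gaps_below_def A_def x_def x'_def)
  moreover have "A \<inter> {x..<x'} = {}"
    by (auto simp: A_def)
  ultimately have 1: "card (gaps_below (beads 0 \<kappa>') x') = card A + nat (x' - x)"
    using fA by (simp add: card_Un_disjoint)
  have "gaps_below (beads 0 \<kappa>) x \<subseteq> A \<union> {x - n<..<x' - n}"
  proof
    fix y assume y: "y \<in> gaps_below (beads 0 \<kappa>) x"
    then have "y \<notin> G" "x - n < y" "y < x"
      using mem[of y] by (auto simp: gaps_below_def)
    moreover from this have "y \<noteq> x' - n"
      using nG(2) by auto
    ultimately show "y \<in> A \<union> {x - n<..<x' - n}"
      by (auto simp: A_def)
  qed
  then have "card (gaps_below (beads 0 \<kappa>) x) \<le> card (A \<union> {x - n<..<x' - n})"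
    using fA by (intro card_mono) auto
  also have "\<dots> \<le> card A + card {x - n<..<x' - n}"
    by (rule card_Un_le)
  also have "\<dots> < card A + nat (x' - x)"
    using less by (simp add: x_def x'_def)
  finally show False
    using 1 eq by (simp add: x_def x'_def)
qed

lemma core_to_bounded_inj:
  assumes core: "is_core k \<kappa>" "is_core k \<kappa>'" and eq: "core_to_bounded k \<kappa> = core_to_bounded k \<kappa>'"
  shows "\<kappa> = \<kappa>'"
proof -
  have p: "is_partition \<kappa>" "is_partition \<kappa>'"
    using core by (auto simp: is_core_def)
  have len: "length \<kappa> = length \<kappa>'"
    using eq length_core_to_bounded by metis
  have bead: "bead \<kappa> i = bead \<kappa>' i" if "1 \<le> i" for i
    using that
  \<comment> \<open>The beads are determined from the last row to the first; beyond the common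
    length they agree anyway.\<close>
  proof (induction "Suc (length \<kappa>) - i" arbitrary: i rule: less_induct)
    case less
    show ?case
    proof (cases "length \<kappa> < i")
      case True
      then show ?thesis using len by (simp add: bead_above_length)
    next
      case False
      have above: "bead \<kappa> j = bead \<kappa>' j" if "i < j" for j
        using False that less.prems by (intro less.hyps) auto
      have "card (gaps_below (beads 0 \<kappa>) (bead \<kappa> i)) = card (gaps_below (beads 0 \<kappa>') (bead \<kappa>' i))"
        using nth_core_to_bounded[OF p(1), of "i - 1" 0] nth_core_to_bounded[OF p(2), of "i - 1" 0]
          False less.prems len eq by simp
      then show ?thesis
        using core_bead_not_less[OF core less.prems above] core_bead_not_less[OF core(2,1) less.prems above[symmetric]]
        by simp
    qed
  qed
  then show ?thesis
    by (intro partition_eq_partI p) (auto simp: bead_def)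
qed

text \<open>A new largest part p is created by one more bead, placed at the first gap of the class
  that has exactly p classes below it. As no existing part exceeds p, this position lies above all
  beads, and so no other rank changes.\<close>

lemma core_to_bounded_surj:
  assumes "\<nu> \<in> bounded_partitions k"
  shows "\<exists>\<kappa>. is_core k \<kappa> \<and> core_to_bounded k \<kappa> = \<nu>"
  using assms
proof (induction \<nu>)
  case Nil
  have "is_core k []" "core_to_bounded k [] = []"
    by (auto simp: is_core_def is_partition_def cells_def part_def core_to_bounded_def)
  then show ?case by blast
next
  case (Cons p \<nu>)
  then have \<nu>: "\<nu> \<in> bounded_partitions k" and pk: "1 \<le> p" "p \<le> k" and ge: "\<And>a. a \<in> set \<nu> \<Longrightarrow> a \<le> p"
    by (auto simp: bounded_partitions_def is_partition_def)
  then obtain \<kappa> where \<kappa>: "is_core k \<kappa>" "core_to_bounded k \<kappa> = \<nu>"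
    using Cons.IH by blast
  have part: "is_partition \<kappa>"
    using \<kappa> by (simp add: is_core_def)
  obtain M where M: "runner M" "below M = beads 0 \<kappa>"
    using core_runner[OF \<kappa>(1)] .
  have injM: "inj_on M {0..<n}"
  proof (rule inj_onI)
    fix r s assume rs: "r \<in> {0..<n}" "s \<in> {0..<n}" "M r = M s"
    have "r = M r mod n" "s = M s mod n"
      using rs(1,2) runner_mod[OF M(1)] by simp_all
    then show "r = s"
      using rs(3) by simp
  qed
  then have "card (M ` {0..<n}) = Suc k"
    using card_image[OF injM] by (simp add: n_def nat_add_distrib)
  then obtain r where r: "r \<in> {0..<n}" "card {w \<in> M ` {0..<n}. w < M r} = p"
    using exists_rank[of "M ` {0..<n}" p] pk by auto
  have "{w \<in> M ` {0..<n}. w < M r} = M ` {s \<in> {0..<n}. M s < M r}"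
    by auto
  then have r_card: "card {s \<in> {0..<n}. M s < M r} = p"
    using r(2) card_image[of M "{s \<in> {0..<n}. M s < M r}"] injM by (auto simp: inj_on_def)
  have rank_le_p: "rank M b \<le> p" if b: "b \<in> below M" for b
  proof -
    obtain i where i: "1 \<le> i" "b = bead \<kappa> i + 0"
      using b M(2) by (auto simp: beads_def)
    show ?thesis
    proof (cases "i \<le> length \<kappa>")
      case True
      then have "rank M b = \<nu> ! (i - 1)"
        using nth_core_to_bounded_rank[OF part _ M, of "i - 1"] i \<kappa>(2) by simp
      then show ?thesis
        using ge True i \<kappa>(2) length_core_to_bounded[of \<kappa>] by simp
    next
      case False
      then show ?thesis
        using rank_bead_pos_iff[OF part M, of i] i by simp
    qed
  qed
  define x where "x = M r + n"
  \<comment> \<open>A bead beyond \<open>x\<close> would see the class \<open>r\<close> and the p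
    classes below it, so its rank would be at least p + 1.\<close>
  have lt: "b < x" if b: "b \<in> below M" for b
  proof (rule ccontr)
    assume "\<not> b < x"
    moreover have "b \<noteq> x"
      using b runner_notin_below[OF M(1), of r] by (auto simp: x_def)
    ultimately have "M r < b - n"
      by (simp add: x_def)
    then have "insert r {s \<in> {0..<n}. M s < M r} \<subseteq> {s \<in> {0..<n}. M s < b - n}"
      using r(1) by auto
    then have "card (insert r {s \<in> {0..<n}. M s < M r}) \<le> rank M b"
      unfolding rank_def by (intro card_mono) auto
    then show False
      using r_card rank_le_p[OF b] by simp
  qed
  define M' where "M' = (\<lambda>y. if y mod n = r then M y + n else M y)"
  have M': "runner M'"
    using M(1) r(1) by (auto simp: runner_def M'_def)
  have Mr: "M y = M r" if "y mod n = r" for y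
    using that r(1) by (intro runner_cong[OF M(1)]) simp
  have below: "below M' = insert x (below M)"
  proof (intro set_eqI iffI)
    fix y assume "y \<in> below M'"
    then show "y \<in> insert x (below M)"
      using Mr[of y] mod_gap[of y x] mod_gap[of "M y" y] runner_mod[OF M(1), of y] runner_mod[OF M(1), of r]
      by (cases "y \<le> M y") (auto simp: below_iff M'_def x_def split: if_splits)
  next
    fix y assume "y \<in> insert x (below M)"
    then show "y \<in> below M'"
    proof
      assume "y = x"
      moreover have "x mod n = r"
        using runner_mod[OF M(1), of r] r(1) by (simp add: x_def)
      ultimately show ?thesis
        using Mr[of x] by (simp add: below_iff M'_def x_def)
    qed (use n_pos in \<open>auto simp: below_iff M'_def\<close>)
  qed
  have rank_eq: "rank M' b = rank M b" if "b \<in> below M" for b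
  proof -
    have "M' s < b - n \<longleftrightarrow> M s < b - n" for s
    proof (cases "s mod n = r")
      case True
      then have "M s = M r" by (rule Mr)
      then show ?thesis
        using lt[OF that] n_pos True unfolding M'_def x_def by simp
    qed (simp add: M'_def)
    then show ?thesis by (simp add: rank_def)
  qed
  have rank_x: "rank M' x = p"
  proof -
    have "M' s < x - n \<longleftrightarrow> M s < M r" for s
      using n_pos Mr[of s] unfolding M'_def x_def by (cases "s mod n = r") simp_all
    then have "{s \<in> {0..<n}. M' s < x - n} = {s \<in> {0..<n}. M s < M r}"
      by simp
    then show ?thesis using r_card by (simp add: rank_def)
  qed
  obtain d \<kappa>' where \<kappa>': "is_partition \<kappa>'" "beads d \<kappa>' = below M'"
    using partition_of_runner[OF M'] .
  have core': "is_core k \<kappa>'"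
    using core_if_runner[OF \<kappa>'(1) M' \<kappa>'(2)[symmetric]] .
  have "mset (core_to_bounded k \<kappa>') = mset (p # \<nu>)"
  proof (rule multiset_eqI)
    fix t
    show "count (mset (core_to_bounded k \<kappa>')) t = count (mset (p # \<nu>)) t"
    proof (cases "t = 0")
      case True
      have "0 \<notin> set (core_to_bounded k \<kappa>')" "0 \<notin> set (p # \<nu>)"
        using core_to_bounded_in[OF core'] Cons.prems by (auto simp: bounded_partitions_def is_partition_def)
      then have "count (mset (core_to_bounded k \<kappa>')) 0 = 0" "count (mset (p # \<nu>)) 0 = 0"
        unfolding count_eq_zero_iff set_mset_mset by simp_all
      then show ?thesis
        unfolding True by (rule trans[OF _ sym])
    next
      case False
      then have t: "1 \<le> t" by simp
      have "{y \<in> below M'. rank M' y = t} =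
          (if t = p then insert x {y \<in> below M. rank M y = t} else {y \<in> below M. rank M y = t})"
      proof (intro set_eqI)
        fix y
        show "y \<in> {y \<in> below M'. rank M' y = t} \<longleftrightarrow>
          y \<in> (if t = p then insert x {y \<in> below M. rank M y = t} else {y \<in> below M. rank M y = t})"
          unfolding below using rank_eq[of y] rank_x lt[of x]
          by (cases "y = x"; cases "y \<in> below M") simp_all
      qed
      moreover have "x \<notin> below M"
        using lt[of x] by blast
      ultimately have "card {y \<in> below M'. rank M' y = t} = card {y \<in> below M. rank M y = t} + of_bool (t = p)"
        using finite_rank_eq[OF M(1) t] by (cases "t = p") simp_all
      then show ?thesis
        using count_core_to_bounded[OF \<kappa>'(1) M' \<kappa>'(2)[symmetric] t] count_core_to_bounded[OF part M t] \<kappa>(2)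
        by simp
    qed
  qed
  then have "core_to_bounded k \<kappa>' = p # \<nu>"
    using core_to_bounded_in[OF core'] Cons.prems
    by (intro partition_eqI) (simp_all add: bounded_partitions_def)
  then show ?case
    using core' by blast
qed

lemma bounded_to_core:
  assumes "\<nu> \<in> bounded_partitions k"
  shows "is_core k (bounded_to_core k \<nu>)" "core_to_bounded k (bounded_to_core k \<nu>) = \<nu>"
proof -
  have "\<nu> \<in> core_to_bounded k ` {\<kappa>. is_core k \<kappa>}"
    using core_to_bounded_surj[OF assms] by auto
  from inv_into_into[OF this] f_inv_into_f[OF this]
  show "is_core k (bounded_to_core k \<nu>)" "core_to_bounded k (bounded_to_core k \<nu>) = \<nu>"
    unfolding bounded_to_core_def mem_Collect_eq .
qed

lemma bounded_to_core_eq: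
  assumes "is_core k \<kappa>" "core_to_bounded k \<kappa> = \<nu>"
  shows "bounded_to_core k \<nu> = \<kappa>"
proof -
  have "\<nu> \<in> bounded_partitions k"
    using core_to_bounded_in[OF assms(1)] assms(2) by simp
  from bounded_to_core[OF this] show ?thesis
    using core_to_bounded_inj[OF _ assms(1)] assms(2) by simp
qed

section \<open>Weak strips\<close>

lemma mod_add_n_one: "(x + n + 1) mod n = (x + 1) mod n"
  using mod_add_self2[of "x + 1" n] by (simp add: ac_simps)

text \<open>
  The core length counts pairs of a bead and a gap below it at distance less than \<open>n\<close>; grouping
  these pairs by the class of the gap leaves only the first gap of each class.
\<close>

lemma core_length_eq_sum:
  assumes p: "is_partition \<kappa>" and M: "runner M" "below M = beads d \<kappa>"
  shows "core_length k \<kappa> = (\<Sum>r\<in>{0..<n}. num_ge (below M) (M r + n + 1))"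
proof -
  let ?x = "\<lambda>i. bead \<kappa> (Suc i) + d"
  have "core_length k \<kappa> = (\<Sum>i<length \<kappa>. core_to_bounded k \<kappa> ! i)"
    by (simp add: core_length_eq_sum_list[OF p] sum_list_sum_nth atLeast0LessThan)
  also have "\<dots> = (\<Sum>i<length \<kappa>. \<Sum>r\<in>{0..<n}. of_bool (M r < ?x i - n))"
    by (rule sum.cong) (simp_all add: nth_core_to_bounded_rank[OF p _ M] rank_def sum_of_bool_eq Int_def)
  also have "\<dots> = (\<Sum>r\<in>{0..<n}. \<Sum>i<length \<kappa>. of_bool (M r < ?x i - n))"
    by (rule sum.swap)
  also have "\<dots> = (\<Sum>r\<in>{0..<n}. num_ge (below M) (M r + n + 1))"
  proof (rule sum.cong)
    fix r
    let ?N = "num_ge (below M) (M r + n + 1)"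
    have iff: "i \<le> ?N \<longleftrightarrow> M r + n + 1 \<le> bead \<kappa> i + d" if "1 \<le> i" for i
      using le_num_ge_iff[OF p that] M(2) by simp
    have "?N \<le> length \<kappa>"
    proof (rule ccontr)
      assume "\<not> ?N \<le> length \<kappa>"
      then have "M r + n + 1 \<le> bead \<kappa> (Suc (length \<kappa>)) + d"
        using iff[of "Suc (length \<kappa>)"] by simp
      then have "M r + n \<in> beads d \<kappa>"
        using beads_lower[of "M r + n" d \<kappa>] by (simp add: bead_above_length)
      then show False
        using runner_notin_below[OF M(1), of r] M(2) by simp
    qed
    moreover have "M r < ?x i - n \<longleftrightarrow> i < ?N" for i
    proof -
      have "i < ?N \<longleftrightarrow> M r + n + 1 \<le> ?x i"
        unfolding Suc_le_eq[symmetric] by (rule iff) simp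
      moreover have "M r < ?x i - n \<longleftrightarrow> M r + n + 1 \<le> ?x i"
        by (rule iffI; linarith)
      ultimately show ?thesis by (rule trans[OF _ sym, rotated])
    qed
    ultimately have "{..<length \<kappa>} \<inter> {i. M r < ?x i - n} = {..<?N}"
      by (simp only:) (rule set_eqI, auto intro: less_le_trans)
    then show "(\<Sum>i<length \<kappa>. of_bool (M r < ?x i - n)) = ?N"
      by (simp add: sum_of_bool_eq)
  qed simp
  finally show ?thesis .
qed

text \<open>The first gap of a class is the only position of the class that is not a bead while its
  translate by - n is one. A sum over classes thus becomes a sum over an interval, ready for
  summation by parts.\<close>

lemma sum_first_gaps:
  fixes h :: "int \<Rightarrow> int"
  assumes N: "runner N" and ab: "\<And>y. a \<le> N y + n \<and> N y + n \<le> b"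
  shows "(\<Sum>r\<in>{0..<n}. h (N r + n)) =
    (\<Sum>y\<in>{a..b}. (of_bool (y - n \<in> below N) - of_bool (y \<in> below N)) * h y)"
proof -
  have eq: "of_bool (y - n \<in> below N) - of_bool (y \<in> below N) = (of_bool (y = N y + n) :: int)" for y
  proof -
    have "y - n \<le> N y \<longleftrightarrow> y \<le> N y \<or> y = N y + n"
      using runner_le_iff[OF N, of "y - n" y] mod_gap[of "N y" y] runner_mod[OF N, of y] n_pos
      by (cases "N y < y") auto
    then show ?thesis
      using N n_pos by (auto simp: below_iff)
  qed
  have inj: "inj_on (\<lambda>r. N r + n) {0..<n}"
  proof (rule inj_onI)
    fix r s assume rs: "r \<in> {0..<n}" "s \<in> {0..<n}" "N r + n = N s + n"
    have "r = N r mod n" "s = N s mod n"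
      using rs(1,2) runner_mod[OF N] by simp_all
    then show "r = s"
      using rs(3) by simp
  qed
  have img: "(\<lambda>r. N r + n) ` {0..<n} = {y \<in> {a..b}. y = N y + n}"
  proof (intro set_eqI iffI)
    fix y assume "y \<in> (\<lambda>r. N r + n) ` {0..<n}"
    then show "y \<in> {y \<in> {a..b}. y = N y + n}"
      using ab N by (auto simp: runner_idem)
  next
    fix y assume y: "y \<in> {y \<in> {a..b}. y = N y + n}"
    have "N (y mod n) = N y"
      using N by (simp add: runner_def)
    then show "y \<in> (\<lambda>r. N r + n) ` {0..<n}"
      using y n_pos by (intro image_eqI[of _ _ "y mod n"]) auto
  qed
  have "(\<Sum>r\<in>{0..<n}. h (N r + n)) = sum h ((\<lambda>r. N r + n) ` {0..<n})"
    using inj by (simp add: sum.reindex)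
  also have "\<dots> = (\<Sum>y\<in>{a..b}. of_bool (y = N y + n) * h y)"
    unfolding img
    by (subst sum.inter_filter) (auto simp: of_bool_def intro!: sum.cong)
  also have "\<dots> = (\<Sum>y\<in>{a..b}. (of_bool (y - n \<in> below N) - of_bool (y \<in> below N)) * h y)"
    by (rule sum.cong[OF refl]) (simp add: eq)
  finally show ?thesis .
qed

lemma num_ge_upper: "runner M \<Longrightarrow> \<exists>u. \<forall>x\<in>below M. x \<le> u"
  using runner_bounds[of M] unfolding below_iff by (metis (no_types) Collect_mem_eq below_iff order_trans)

text \<open>
  Summation by parts; the boundary-free remainder vanishes termwise because no bead of \<open>B\<close>, nor
  its translate by \<open>- n\<close>, lies in \<open>C\<close>.
\<close>

lemma sum_num_ge_moved:
  assumes M: "runner M" "runner M'" and s: "strip (below M) C" and M': "below M' = moved (below M) C"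
  shows "(\<Sum>r\<in>{0..<n}. num_ge (below M) (M' r + n + 1)) = (\<Sum>r\<in>{0..<n}. num_ge (below M) (M r + n + 1))"
proof -
  define h where "h = (\<lambda>y. int (num_ge (below M) (y + 1)))"
  define \<beta> where "\<beta> = (\<lambda>y. of_bool (y \<in> below M) :: int)"
  define e where "e = (\<lambda>y. of_bool (y \<in> C) :: int)"
  define \<epsilon> where "\<epsilon> = (\<lambda>y. e (y - n) - e y)"
  have finC: "finite C" and disj: "\<And>y. y \<in> below M \<Longrightarrow> y \<notin> C"
    using s by (auto simp: strip_def)
  obtain l1 u1 where 1: "\<And>y. l1 \<le> M y \<and> M y \<le> u1"
    using runner_bounds[OF M(1)] by blast
  obtain l2 u2 where 2: "\<And>y. l2 \<le> M' y \<and> M' y \<le> u2"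
    using runner_bounds[OF M(2)] by blast
  \<comment> \<open>The range contains all first gaps, and \<epsilon> vanishes at \<open>a\<close>
    and at \<open>b + 1\<close>, so that shifting the summation index leaves no boundary
    term.\<close>
  define a where "a = min (min l1 l2) (Min (insert 0 C)) - 1"
  define b where "b = max (max u1 u2) (Max (insert 0 C)) + n"
  have C_in: "a < y \<and> y \<le> b - n" if "y \<in> C" for y
  proof -
    have "Min (insert 0 C) \<le> y" "y \<le> Max (insert 0 C)"
      using that finC by simp_all
    then show ?thesis
      unfolding a_def b_def by linarith
  qed
  have ab1: "a \<le> M y + n \<and> M y + n \<le> b" for y
    using 1[of y] n_pos unfolding a_def b_def by linarith
  have ab2: "a \<le> M' y + n \<and> M' y + n \<le> b" for y
    using 2[of y] n_pos unfolding a_def b_def by linarith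
  have eps: "\<epsilon> a = 0" "\<epsilon> (b + 1) = 0"
    using C_in n_pos by (force simp: \<epsilon>_def e_def)+
  have "a \<le> b"
    using ab1[of 0] by linarith
  \<comment> \<open>The change of the indicator is a difference of neighbouring values of
    \<open>e\<close>, because a position to the left of one in \<open>C\<close> lies in
    \<open>below M\<close> or in \<open>C\<close>.\<close>
  have \<beta>': "of_bool (y \<in> below M') = \<beta> y + e y - e (y + 1)" for y
    using s disj[of y] by (auto simp: M' moved_def strip_def \<beta>_def e_def)
  obtain u where "\<And>x. x \<in> below M \<Longrightarrow> x \<le> u"
    using num_ge_upper[OF M(1)] by blast
  then have h: "h y - h (y - 1) = - \<beta> y" for y
    using num_ge_rec[of "below M" u y] by (simp add: h_def \<beta>_def)
  have g: "(\<Sum>r\<in>{0..<n}. h (M r + n)) = (\<Sum>y\<in>{a..b}. (\<beta> (y - n) - \<beta> y) * h y)"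
    unfolding \<beta>_def by (rule sum_first_gaps[OF M(1) ab1])
  have g': "(\<Sum>r\<in>{0..<n}. h (M' r + n)) = (\<Sum>y\<in>{a..b}.
      ((\<beta> (y - n) + e (y - n) - e (y - n + 1)) - (\<beta> y + e y - e (y + 1))) * h y)"
    unfolding \<beta>'[symmetric] by (rule sum_first_gaps[OF M(2) ab2])
  have "(\<Sum>r\<in>{0..<n}. h (M' r + n)) - (\<Sum>r\<in>{0..<n}. h (M r + n)) =
      (\<Sum>y\<in>{a..b}. \<epsilon> y * h y - \<epsilon> (y + 1) * h y)"
    unfolding g g' sum_subtractf[symmetric]
    by (rule sum.cong) (simp_all add: \<epsilon>_def algebra_simps)
  also have "\<dots> = (\<Sum>y\<in>{a..b}. \<epsilon> y * h y) - (\<Sum>y\<in>{a..b}. \<epsilon> (y + 1) * h y)"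
    by (rule sum_subtractf)
  also have "(\<Sum>y\<in>{a..b}. \<epsilon> (y + 1) * h y) = (\<Sum>y\<in>{a + 1..b + 1}. \<epsilon> y * h (y - 1))"
    by (rule sum.reindex_bij_witness[of _ "\<lambda>y. y - 1" "\<lambda>y. y + 1"]) auto
  also have "\<dots> = (\<Sum>y\<in>{a..b + 1}. \<epsilon> y * h (y - 1))"
  proof (rule sum.mono_neutral_left)
    have "{a..b + 1} - {a + 1..b + 1} \<subseteq> {a}"
      by auto
    then show "\<forall>i\<in>{a..b + 1} - {a + 1..b + 1}. \<epsilon> i * h (i - 1) = 0"
      using eps(1) by (metis mult_zero_left singletonD subsetD)
  qed auto
  also have "\<dots> = (\<Sum>y\<in>{a..b}. \<epsilon> y * h (y - 1))"
  proof (rule sum.mono_neutral_right)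
    have "{a..b + 1} - {a..b} \<subseteq> {b + 1}"
      by auto
    then show "\<forall>i\<in>{a..b + 1} - {a..b}. \<epsilon> i * h (i - 1) = 0"
      using eps(2) by (metis mult_zero_left singletonD subsetD)
  qed auto
  also have "(\<Sum>y\<in>{a..b}. \<epsilon> y * h y) - (\<Sum>y\<in>{a..b}. \<epsilon> y * h (y - 1)) = (\<Sum>y\<in>{a..b}. \<epsilon> y * (h y - h (y - 1)))"
    by (simp add: sum_subtractf right_diff_distrib)
  also have "\<dots> = 0"
  proof (rule sum.neutral, intro ballI)
    fix y
    show "\<epsilon> y * (h y - h (y - 1)) = 0"
      using disj[of y] disj[of "y - n"] below_diff[OF M(1), of y] by (auto simp: h \<beta>_def \<epsilon>_def e_def)
  qed
  finally have "(\<Sum>r\<in>{0..<n}. h (M' r + n)) = (\<Sum>r\<in>{0..<n}. h (M r + n))"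
    by simp
  then have "int (\<Sum>r\<in>{0..<n}. num_ge (below M) (M' r + n + 1)) =
      int (\<Sum>r\<in>{0..<n}. num_ge (below M) (M r + n + 1))"
    unfolding h_def of_nat_sum .
  then show ?thesis by linarith
qed

text \<open>In the formula \<open>core_length_eq_sum\<close> both the beads and the first gaps
  change. By \<open>sum_num_ge_moved\<close> the new first gaps alone make no difference, and by
  \<open>num_ge_moved\<close> the new beads add one for each first gap with right neighbour in
  \<open>C\<close>.\<close>

lemma core_length_moved:
  assumes p: "is_partition \<kappa>" "is_partition \<tau>" and M: "runner M" "below M = beads d \<tau>"
    and M': "runner M'" "below M' = beads d' \<kappa>" and s: "strip (below M) C" "below M' = moved (below M) C"
  shows "core_length k \<kappa> = core_length k \<tau> + card {r \<in> {0..<n}. M' r + n + 1 \<in> C}"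
proof -
  obtain u1 where u1: "\<And>x. x \<in> below M \<Longrightarrow> x \<le> u1"
    using num_ge_upper[OF M(1)] by blast
  have "finite C"
    using s by (simp add: strip_def)
  then have u: "x \<le> max u1 (Max (insert 0 C))" if "x \<in> below M \<union> C" for x
  proof (cases "x \<in> C")
    case True
    then have "x \<le> Max (insert 0 C)"
      using \<open>finite C\<close> by simp
    then show ?thesis by linarith
  next
    case False
    then show ?thesis using that u1[of x] by auto
  qed
  have "core_length k \<kappa> = (\<Sum>r\<in>{0..<n}. num_ge (moved (below M) C) (M' r + n + 1))"
    using core_length_eq_sum[OF p(1) M'] s by simp
  also have "\<dots> = (\<Sum>r\<in>{0..<n}. num_ge (below M) (M' r + n + 1)) + (\<Sum>r\<in>{0..<n}. of_bool (M' r + n + 1 \<in> C))"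
    using num_ge_moved[OF s(1) u] by (simp add: sum.distrib)
  also have "(\<Sum>r\<in>{0..<n}. num_ge (below M) (M' r + n + 1)) = core_length k \<tau>"
    using sum_num_ge_moved[OF M(1) M'(1) s] core_length_eq_sum[OF p(2) M] by simp
  also have "(\<Sum>r\<in>{0..<n}. of_bool (M' r + n + 1 \<in> C)) = card {r \<in> {0..<n}. M' r + n + 1 \<in> C}"
    by (simp add: sum_of_bool_eq Int_def)
  finally show ?thesis .
qed

text \<open>
  A weak strip with contents \<open>C\<close> over \<open>below M\<close> is encoded by the runner \<open>T\<close> of
  \<open>below M \<union> C\<close>. Admissibility says that within each block of consecutive moved classes the
  largest bead of the class preceding the block is carried to the end of the block, every other class
  being shifted down by one; \<open>step M T\<close> is the resulting runner.
\<close>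

definition adm :: "(int \<Rightarrow> int) \<Rightarrow> (int \<Rightarrow> int) \<Rightarrow> bool" where
  "adm M T \<longleftrightarrow> runner T \<and> (\<forall>y. M y \<le> T y) \<and> (\<forall>y. M y < T y \<longrightarrow> T y = T (y - 1) + 1)"

definition step :: "(int \<Rightarrow> int) \<Rightarrow> (int \<Rightarrow> int) \<Rightarrow> int \<Rightarrow> int" where
  "step M T y = (if M (y + 1) < T (y + 1) then M (y + 1) - 1 else T y)"

definition moved_classes :: "(int \<Rightarrow> int) \<Rightarrow> (int \<Rightarrow> int) \<Rightarrow> int set" where
  "moved_classes M T = {r \<in> {0..<n}. M r < T r}"

text \<open>These classes are the residues counted by \<open>num_residues\<close> for the strip
  encoded by \<open>T\<close>; see \<open>num_residues_adm\<close>.\<close>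

definition ascents :: "(int \<Rightarrow> int) \<Rightarrow> int set" where
  "ascents T = {r \<in> {0..<n}. T (r - 1) + 1 < T r}"

lemma admD:
  assumes "adm M T"
  shows "runner T" "M y \<le> T y" "M y < T y \<Longrightarrow> T y = T (y - 1) + 1"
  using assms by (auto simp: adm_def)

lemma mod_add_one_cong: "a mod n = b mod n \<Longrightarrow> (a + c) mod n = (b + c) mod n"
  by (metis mod_add_left_eq)

lemma mod_diff_one_cong: "a mod n = b mod n \<Longrightarrow> (a - c) mod n = (b - c) mod n"
  by (metis mod_diff_left_eq)

lemma runner_step:
  assumes "runner M" "adm M T"
  shows "runner (step M T)"
  unfolding runner_def
proof (intro conjI allI)
  have T: "runner T" by (rule admD[OF assms(2)])
  fix y
  show "step M T y mod n = y mod n"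
    using runner_mod[OF T, of y] mod_diff_one_cong[OF runner_mod[OF assms(1), of "y + 1"], of 1]
    by (simp add: step_def)
  have "(y mod n + 1) mod n = (y + 1) mod n"
    by (simp add: mod_add_left_eq)
  then show "step M T (y mod n) = step M T y"
    using T runner_cong[OF T] runner_cong[OF assms(1)] unfolding step_def
    by (metis mod_mod_trivial)
qed

lemma below_mono_adm: "adm M T \<Longrightarrow> below M \<subseteq> below T"
  using admD(2) by (force simp: below_iff intro: order_trans)

lemma adm_strip:
  assumes M: "runner M" and T: "adm M T"
  shows "strip (below M) (below T - below M)" "moved (below M) (below T - below M) = below (step M T)"
proof -
  obtain l u where "\<And>y. l \<le> M y \<and> M y \<le> u"
    using runner_bounds[OF M] by blast
  moreover obtain l' u' where "\<And>y. l' \<le> T y \<and> T y \<le> u'"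
    using runner_bounds[OF admD(1)[OF T]] by blast
  ultimately have "below T - below M \<subseteq> {l..u'}"
    by (auto simp: below_iff not_le) (meson dual_order.trans less_imp_le)+
  then have "finite (below T - below M)"
    using finite_subset by blast
  moreover have "y - 1 \<in> below T" if "y \<in> below T - below M" for y
    using that admD(3)[OF T, of y] by (auto simp: below_iff)
  ultimately show "strip (below M) (below T - below M)"
    by (auto simp: strip_def)
  show "moved (below M) (below T - below M) = below (step M T)"
  proof (rule set_eqI)
    fix y
    have "y \<in> moved (below M) (below T - below M) \<longleftrightarrow> y \<le> T y \<and> \<not> (M (y + 1) < y + 1 \<and> y + 1 \<le> T (y + 1))"
      using below_mono_adm[OF T] by (auto simp: moved_def below_iff)
    also have "\<dots> \<longleftrightarrow> y \<le> step M T y"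
      using admD(2)[OF T, of "y + 1"] admD(3)[OF T, of "y + 1"] by (auto simp: step_def)
    finally show "y \<in> moved (below M) (below T - below M) \<longleftrightarrow> y \<in> below (step M T)"
      by (simp add: below_iff)
  qed
qed

lemma mod_image_strip:
  assumes M: "runner M" and T: "adm M T"
  shows "(\<lambda>y. y mod n) ` (below T - below M) = moved_classes M T"
proof (intro set_eqI iffI)
  fix r assume "r \<in> (\<lambda>y. y mod n) ` (below T - below M)"
  then obtain y where y: "r = y mod n" "M y < y" "y \<le> T y"
    by (auto simp: below_iff)
  have "M r = M y" "T r = T y"
    using M admD(1)[OF T] y(1) by (simp_all add: runner_def)
  then show "r \<in> moved_classes M T"
    using y n_pos by (simp add: moved_classes_def)
next
  fix r assume r: "r \<in> moved_classes M T"
  have "T r mod n = r"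
    using runner_mod[OF admD(1)[OF T], of r] r by (simp add: moved_classes_def)
  moreover have "M (T r) = M r"
    using runner_cong[OF M] runner_mod[OF admD(1)[OF T]] by blast
  ultimately show "r \<in> (\<lambda>y. y mod n) ` (below T - below M)"
    using r runner_in_below[OF admD(1)[OF T], of r]
    by (intro image_eqI[of _ _ "T r"]) (auto simp: moved_classes_def below_iff)
qed

lemma card_periodic_shift:
  assumes "\<And>y. P (y mod n) = P y"
  shows "card {r \<in> {0..<n}. P (r + c)} = card {r \<in> {0..<n}. P r}"
proof (rule bij_betw_same_card, rule bij_betwI)
  show "(\<lambda>r. (r + c) mod n) \<in> {r \<in> {0..<n}. P (r + c)} \<rightarrow> {r \<in> {0..<n}. P r}"
    using assms n_pos by auto
  show "(\<lambda>r. (r - c) mod n) \<in> {r \<in> {0..<n}. P r} \<rightarrow> {r \<in> {0..<n}. P (r + c)}"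
  proof
    fix r assume r: "r \<in> {r \<in> {0..<n}. P r}"
    have "((r - c) mod n + c) mod n = r mod n"
      by (simp add: mod_add_left_eq)
    then have "P ((r - c) mod n + c) = P r"
      using assms by metis
    then show "(r - c) mod n \<in> {r \<in> {0..<n}. P (r + c)}"
      using r n_pos by auto
  qed
qed (auto simp: mod_diff_left_eq mod_add_left_eq)

text \<open>If class r + 1 moves, the first gap of class r after the step is
  \<open>M (r + 1) + n - 1\<close>, directly to the left of the lowest content of class r + 1. So
  the length grows by the number of moved classes.\<close>

lemma card_step_gaps:
  assumes M: "runner M" and T: "adm M T"
  shows "card {r \<in> {0..<n}. step M T r + n + 1 \<in> below T - below M} = card (moved_classes M T)"
proof -
  have rT: "runner T" by (rule admD[OF T])
  have "step M T r + n + 1 \<in> below T - below M \<longleftrightarrow> M (r + 1) < T (r + 1)" for r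
  proof -
    define z where "z = step M T r + n + 1"
    have "(step M T r + 1) mod n = (r + 1) mod n"
      by (intro mod_add_one_cong runner_mod runner_step M T)
    then have zmod: "z mod n = (r + 1) mod n"
      by (simp add: z_def mod_add_n_one)
    then have z: "M z = M (r + 1)" "T z = T (r + 1)"
      using runner_cong M rT by blast+
    show ?thesis
    proof (cases "M (r + 1) < T (r + 1)")
      case True
      then have "z = M (r + 1) + n"
        by (simp add: z_def step_def)
      then show ?thesis
        using z True mod_gap[of "M (r + 1)" "T (r + 1)"] runner_mod[OF M, of "r + 1"] runner_mod[OF rT, of "r + 1"] n_pos
        unfolding z_def[symmetric] by (simp add: below_iff)
    next
      case False
      then show ?thesis
        using z admD(2)[OF T, of "r + 1"] unfolding z_def[symmetric] by (simp add: below_iff)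
    qed
  qed
  then have "{r \<in> {0..<n}. step M T r + n + 1 \<in> below T - below M} = {r \<in> {0..<n}. M (r + 1) < T (r + 1)}"
    by simp
  moreover have "(M (y mod n) < T (y mod n)) = (M y < T y)" for y
    using M rT by (simp add: runner_def)
  ultimately show ?thesis
    using card_periodic_shift[of "\<lambda>y. M y < T y" 1] by (simp add: moved_classes_def)
qed

lemma card_residue_eq:
  "card (residue k ` (cells \<kappa> - cells \<tau>)) = card ((\<lambda>y. y mod n) ` (\<lambda>y. y + d) ` contents \<kappa> \<tau>)"
proof -
  have "residue k ` (cells \<kappa> - cells \<tau>) = (\<lambda>y. y mod n) ` contents \<kappa> \<tau>"
    unfolding contents_def image_image by (intro image_cong) (auto simp: residue_def n_def)
  moreover have "(\<lambda>y. y mod n) ` (\<lambda>y. y + d) ` contents \<kappa> \<tau> = (\<lambda>y. (y + d) mod n) ` (\<lambda>y. y mod n) ` contents \<kappa> \<tau>"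
    by (simp add: image_image mod_add_left_eq)
  moreover have "inj_on (\<lambda>y. (y + d) mod n) ((\<lambda>y. y mod n) ` contents \<kappa> \<tau>)"
  proof (rule inj_onI)
    fix x y assume xy: "x \<in> (\<lambda>y. y mod n) ` contents \<kappa> \<tau>" "y \<in> (\<lambda>y. y mod n) ` contents \<kappa> \<tau>"
      "(x + d) mod n = (y + d) mod n"
    then have "x mod n = y mod n"
      using mod_diff_one_cong[of "x + d" "y + d" d] by simp
    then show "x = y"
      using xy(1,2) by auto
  qed
  ultimately show ?thesis
    by (simp add: card_image)
qed

lemma adm_imp_weak_strip:
  assumes core: "is_core k \<tau>" and M: "runner M" "below M = beads d \<tau>" and T: "adm M T"
    and p: "is_partition \<kappa>" and \<kappa>: "beads d' \<kappa> = below (step M T)"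
  shows "weak_strip k (card (moved_classes M T)) \<kappa> \<tau>" "d' = d"
    "(\<lambda>y. y + d) ` contents \<kappa> \<tau> = below T - below M"
proof -
  have p\<tau>: "is_partition \<tau>"
    using core by (simp add: is_core_def)
  have rs: "runner (step M T)"
    by (rule runner_step) fact+
  note s = adm_strip[OF M(1) T]
  have \<kappa>': "beads d' \<kappa> = moved (beads d \<tau>) (below T - below M)"
    using \<kappa> s(2) M(2) by simp
  note h = horizontal_strip_of_strip[OF p p\<tau> s(1)[unfolded M(2)] \<kappa>'[unfolded M(2)]]
  show "d' = d" by (rule h)
  show C: "(\<lambda>y. y + d) ` contents \<kappa> \<tau> = below T - below M"
    using h(3) M(2) by simp
  have "core_length k \<kappa> = core_length k \<tau> + card (moved_classes M T)"
    using core_length_moved[OF p p\<tau> M rs \<kappa>[symmetric] s(1) s(2)[symmetric]] card_step_gaps[OF M(1) T] by simp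
  moreover have "card (residue k ` (cells \<kappa> - cells \<tau>)) = card (moved_classes M T)"
    unfolding card_residue_eq[of _ _ d] C mod_image_strip[OF M(1) T] ..
  ultimately show "weak_strip k (card (moved_classes M T)) \<kappa> \<tau>"
    using h(2) core core_if_runner[OF p rs \<kappa>[symmetric]] by (simp add: weak_strip_def)
qed

text \<open>
  By the previous lemmas the length grows by the number of classes whose first gap after the move
  lies directly to the left of \<open>C\<close>. If this is the number of residues, every moved class is preceded
  by such a class, which forces \<open>below M \<union> C\<close> to be closed under subtracting \<open>n\<close>; this is shown by going
  backwards along the classes from one that is not moved.
\<close>

lemma weak_strip_imp_adm:
  assumes w: "weak_strip k s \<kappa> \<tau>" and sk: "s \<le> k" and M: "runner M" "below M = beads d \<tau>"
  shows "\<exists>T. adm M T \<and> beads d \<kappa> = below (step M T) \<and> s = card (moved_classes M T)"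
proof -
  have core: "is_core k \<kappa>" "is_core k \<tau>" and hs: "horizontal_strip \<kappa> \<tau>"
    and len: "core_length k \<kappa> = core_length k \<tau> + s"
    and res: "card (residue k ` (cells \<kappa> - cells \<tau>)) = s"
    using w by (auto simp: weak_strip_def)
  have p: "is_partition \<kappa>" "is_partition \<tau>"
    using core by (auto simp: is_core_def)
  define C where "C = (\<lambda>y. y + d) ` contents \<kappa> \<tau>"
  note st = strip_of_horizontal_strip[OF p hs C_def]
  obtain M' where M': "runner M'" "below M' = beads d \<kappa>"
    using core_runner[OF core(1)] .
  define B where "B = below M"
  have C: "finite C" "\<And>y. y \<in> B \<Longrightarrow> y \<notin> C" "\<And>y. y \<in> C \<Longrightarrow> y - 1 \<in> B \<union> C"
    using st(1) unfolding strip_def M(2)[symmetric] B_def by auto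
  have B': "y \<in> below M' \<longleftrightarrow> y \<in> B \<union> C \<and> y + 1 \<notin> C" for y
    using st(2) M'(2) M(2) by (auto simp: moved_def B_def)
  have Bdiff: "y - n \<in> B" if "y \<in> B" for y
    using that below_diff[OF M(1)] by (simp add: B_def)
  define A where "A = (\<lambda>y. y mod n) ` C"
  have cardA: "card A = s"
    using res unfolding card_residue_eq[of _ _ d] A_def C_def .
  define X where "X = {r \<in> {0..<n}. M' r + n + 1 \<in> C}"
  have cardX: "card X = s"
    using core_length_moved[OF p M M', of C] st len M(2) M'(2) by (simp add: X_def)
  \<comment> \<open>The length condition fixes the size of \<open>X\<close> and the residue
    condition that of \<open>A\<close>; as they agree, the injective shift of \<open>X\<close> into
    \<open>A\<close> is onto.\<close>
  have "(\<lambda>r. (r + 1) mod n) ` X = A"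
  proof (rule card_subset_eq)
    show "finite A" using C(1) by (simp add: A_def)
    have "(r + 1) mod n \<in> A" if "r \<in> X" for r
    proof -
      have "(M' r + n + 1) mod n = (M' r + 1) mod n"
        by (rule mod_add_n_one)
      also have "\<dots> = (r + 1) mod n"
        by (intro mod_add_one_cong runner_mod M')
      finally show ?thesis
        using that unfolding A_def X_def by (metis (mono_tags, lifting) image_eqI mem_Collect_eq)
    qed
    then show "(\<lambda>r. (r + 1) mod n) ` X \<subseteq> A" by blast
    have "inj_on (\<lambda>r. (r + 1) mod n) X"
    proof (rule inj_onI)
      fix x y assume xy: "x \<in> X" "y \<in> X" "(x + 1) mod n = (y + 1) mod n"
      then have "x mod n = y mod n"
        using mod_diff_one_cong[of "x + 1" "y + 1" 1] by simp
      then show "x = y"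
        using xy(1,2) by (auto simp: X_def)
    qed
    then show "card ((\<lambda>r. (r + 1) mod n) ` X) = card A"
      by (simp add: card_image cardA cardX)
  qed
  have first: "M' (y - 1) + n + 1 \<in> C" if z: "z \<in> C" "z mod n = y mod n" for y z
  proof -
    have "y mod n \<in> A"
      using z unfolding A_def by (metis image_eqI)
    then obtain r where r: "r \<in> X" "(r + 1) mod n = y mod n"
      using \<open>_ ` X = A\<close> by auto
    then have "M' r = M' (y - 1)"
      using mod_diff_one_cong[of "r + 1" y 1] by (intro runner_cong[OF M'(1)]) simp
    then show ?thesis
      using r(1) by (simp add: X_def)
  qed
  have first_le: "M' (y - 1) + n + 1 \<le> z" if z: "z \<in> C" "z mod n = y mod n" for y z
  proof -
    have "(z - 1) mod n = (y - 1) mod n"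
      using z(2) by (rule mod_diff_one_cong)
    moreover have "M' (y - 1) < z - 1"
      using B'[of "z - 1"] z(1) runner_cong[OF M'(1) calculation] by (auto simp: below_iff)
    ultimately show ?thesis
      using mod_gap[of "M' (y - 1)" "z - 1"] runner_mod[OF M'(1), of "y - 1"] by simp
  qed
  define D where "D = B \<union> C"
  \<comment> \<open>Some class is not moved, because s \<le> k is less than the number of classes;
    the walk along the classes starts there.\<close>
  obtain y0 where y0: "y0 mod n \<notin> A"
  proof -
    have "A \<subseteq> {0..<n}"
      using n_pos by (auto simp: A_def)
    moreover have "card A \<noteq> card {0..<n}"
      using cardA sk by (simp add: n_def)
    ultimately obtain y0 where "y0 \<in> {0..<n}" "y0 \<notin> A"
      by (metis subset_antisym subsetI)
    then show ?thesis using that[of y0] by simp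
  qed
  have closed': "v - n \<in> D" if "v \<in> D" "v mod n = (y0 - int m) mod n" for m v
    using that
  proof (induction m arbitrary: v)
    case 0
    then have "v mod n \<notin> A" using y0 by simp
    then have "v \<notin> C" by (auto simp: A_def)
    then show ?case using 0 Bdiff by (auto simp: D_def)
  next
    case (Suc m)
    have v1: "(v + 1) mod n = (y0 - int m) mod n"
      using mod_add_one_cong[OF Suc.prems(2), of 1] by (simp add: algebra_simps)
    show ?case
    proof (cases "v + 1 \<in> C")
      case False
      then have "v \<in> below M'"
        using Suc.prems(1) by (simp add: B' D_def)
      then have "v - n \<in> below M'"
        by (rule below_diff[OF M'(1)])
      then show ?thesis by (simp add: B' D_def)
    next
      case True
      then have "v + 1 - n \<in> D"
        using Suc.IH[OF _ v1] by (simp add: D_def)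
      then consider "v + 1 - n \<in> C" | "v + 1 - n \<in> B"
        by (auto simp: D_def)
      then show ?thesis
      proof cases
        case 1
        then show ?thesis
          using C(3)[OF 1] by (simp add: D_def algebra_simps)
      next
        case 2
        \<comment> \<open>\<open>z\<close> lies directly to the right of the first gap after the
          move. Since \<open>v + 1 - n\<close> is an old bead, \<open>v + 1\<close> is the only
          element of \<open>C\<close> in its class at or below itself, so it must be
          \<open>z\<close>.\<close>
        define z where "z = M' v + n + 1"
        have z: "z \<in> C" "z \<le> v + 1"
          using first[OF True refl] first_le[OF True refl] by (simp_all add: z_def)
        have zmod: "z mod n = (v + 1) mod n"
        proof -
          have "z mod n = (M' v + 1) mod n"
            by (simp add: z_def mod_add_n_one)
          then show ?thesis
            using mod_add_one_cong[OF runner_mod[OF M'(1), of v], of 1] by simp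
        qed
        have "z = v + 1"
        proof (rule ccontr)
          assume "z \<noteq> v + 1"
          then have "z \<le> v + 1 - n"
            using z(2) mod_gap[OF zmod] by simp
          moreover have "M z = M (v + 1 - n)"
            using zmod by (intro runner_cong[OF M(1)]) (simp add: algebra_simps)
          ultimately have "z \<in> B"
            using 2 by (simp add: B_def below_iff)
          then show False using C(2) z(1) by blast
        qed
        then have "v - n = M' v" by (simp add: z_def)
        then show ?thesis
          using runner_in_below[OF M'(1), of v] by (simp add: B' D_def)
      qed
    qed
  qed
  have closed: "v - n \<in> D" if "v \<in> D" for v
  proof (rule closed'[OF that, of "nat ((y0 - v) mod n)"])
    show "v mod n = (y0 - int (nat ((y0 - v) mod n))) mod n"
      by (simp add: mod_diff_right_eq)
  qed
  obtain l u where lu: "\<And>y. l \<le> M y \<and> M y \<le> u"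
    using runner_bounds[OF M(1)] by blast
  have "y \<le> max u (Max (insert 0 C))" if "y \<in> D" for y
  proof (cases "y \<in> C")
    case True
    then have "y \<le> Max (insert 0 C)"
      using C(1) by simp
    then show ?thesis by linarith
  next
    case False
    then have "y \<le> M y" using that by (simp add: D_def B_def below_iff)
    then show ?thesis using lu[of y] by linarith
  qed
  moreover have "y \<in> D" if "y \<le> l" for y
    using that lu[of y] by (simp add: D_def B_def below_iff)
  ultimately obtain T where T: "runner T" "below T = D"
    using runner_exists[of D] closed by blast
  have MT: "M y \<le> T y" for y
  proof -
    have "M y \<in> D"
      using runner_in_below[OF M(1)] by (simp add: D_def B_def)
    then have "M y \<le> T (M y)"
      using T(2) by (auto simp: below_iff)
    then show ?thesis
      using runner_cong[OF T(1) runner_mod[OF M(1), of y]] by simp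
  qed
  have CT: "C = below T - below M"
    using T(2) C(2) by (auto simp: D_def B_def)
  have C_iff: "z \<in> C \<longleftrightarrow> M y < z \<and> z \<le> T y" if "z mod n = y mod n" for y z
    using runner_cong[OF M(1) that] runner_cong[OF T(1) that] by (auto simp: CT below_iff)
  \<comment> \<open>The strip condition gives \<le>. If the inequality were strict, the largest
    element of class y - 1 in \<open>D\<close> would remain a bead of \<kappa>, although the first
    gap \<open>M y + n - 1\<close> after the move shows that all such beads are below
    \<open>M y\<close>.\<close>
  have "T y = T (y - 1) + 1" if y: "M y < T y" for y
  proof -
    have TyC: "T y \<in> C"
      using C_iff[OF runner_mod[OF T(1), of y]] y by simp
    have M'y: "M' (y - 1) + n + 1 = M y + n"
    proof (rule order_antisym)
      have "M y + n \<in> C"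
        using C_iff[of "M y + n" y] runner_mod[OF M(1), of y] runner_mod[OF T(1), of y] mod_gap[of "M y" "T y"] y n_pos
        by simp
      then show "M' (y - 1) + n + 1 \<le> M y + n"
        by (rule first_le) (simp add: runner_mod[OF M(1)])
      have "M' (y - 1) + n + 1 \<in> C"
        by (rule first[OF TyC runner_mod[OF T(1)]])
      moreover have zmod: "(M' (y - 1) + n + 1) mod n = y mod n"
      proof -
        have "(M' (y - 1) + n + 1) mod n = (M' (y - 1) + 1) mod n"
          by (rule mod_add_n_one)
        then show ?thesis
          using mod_add_one_cong[OF runner_mod[OF M'(1), of "y - 1"], of 1] by simp
      qed
      ultimately have "M y < M' (y - 1) + n + 1"
        using C_iff[OF zmod] by simp
      then show "M y + n \<le> M' (y - 1) + n + 1"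
        using mod_gap[of "M y" "M' (y - 1) + n + 1"] runner_mod[OF M(1), of y] zmod by simp
    qed
    have "T y - 1 \<in> below T"
      using C(3)[OF TyC] T(2) by (simp add: D_def)
    moreover have "T (T y - 1) = T (y - 1)"
      by (intro runner_cong[OF T(1)] mod_diff_one_cong runner_mod T)
    ultimately have 1: "T y - 1 \<le> T (y - 1)"
      by (simp add: below_iff)
    have "T (y - 1) + 1 \<in> C"
    proof (rule ccontr)
      assume "T (y - 1) + 1 \<notin> C"
      then have "T (y - 1) \<in> below M'"
        using runner_in_below[OF T(1), of "y - 1"] T(2) by (simp add: B' D_def)
      then have "T (y - 1) \<le> M' (y - 1)"
        using runner_cong[OF M'(1) runner_mod[OF T(1), of "y - 1"]] by (simp add: below_iff)
      then show False
        using 1 M'y y by simp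
    qed
    moreover have "(T (y - 1) + 1) mod n = y mod n"
      using mod_add_one_cong[OF runner_mod[OF T(1), of "y - 1"], of 1] by simp
    ultimately have "T (y - 1) + 1 \<le> T y"
      using C_iff by blast
    then show ?thesis using 1 by simp
  qed
  then have adm: "adm M T"
    using T(1) MT by (simp add: adm_def)
  have b: "beads d \<kappa> = below (step M T)"
    using adm_strip(2)[OF M(1) adm] st(2) M(2) CT by simp
  have "s = card (moved_classes M T)"
    using mod_image_strip[OF M(1) adm] cardA CT by (simp add: A_def)
  then show ?thesis
    using adm b by blast
qed

text \<open>The last cell of row i has content \<open>bead \<tau> i\<close>. It is removable exactly
  if the position before this bead is no bead of \<tau>, and by interlacing it is blocked exactly if
  row i + 1 of \<kappa> ends in the same column, that is, if this position is a bead of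
  \<kappa>.\<close>

lemma card_corners:
  assumes p: "is_partition \<kappa>" "is_partition \<tau>" and h: "horizontal_strip \<kappa> \<tau>"
  shows "num_residues k \<kappa> \<tau> =
    card ((\<lambda>x. x mod n) ` {x \<in> beads d \<tau>. x - 1 \<notin> beads d \<tau> \<and> x - 1 \<notin> beads d \<kappa>})"
proof -
  let ?S = "{c. removable_corner \<tau> c \<and> \<not> blocked \<kappa> c}"
  let ?X = "{x \<in> beads d \<tau>. x - 1 \<notin> beads d \<tau> \<and> x - 1 \<notin> beads d \<kappa>}"
  have le: "bead \<tau> i \<le> bead \<kappa> i" and less: "bead \<kappa> (Suc i) < bead \<tau> i" if "1 \<le> i" for i
    using h that horizontal_strip_iff[OF p] by auto
  have in_beads: "bead \<tau> i - 1 + d \<in> beads d \<rho> \<longleftrightarrow> bead \<rho> (Suc i) = bead \<tau> i - 1"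
    if i: "1 \<le> i" and \<rho>: "is_partition \<rho>" and le: "bead \<tau> i \<le> bead \<rho> i" and less: "bead \<rho> (Suc i) < bead \<tau> i"
    for i \<rho>
  proof
    assume "bead \<tau> i - 1 + d \<in> beads d \<rho>"
    then obtain l where l: "1 \<le> l" "bead \<rho> l = bead \<tau> i - 1"
      by (auto simp: beads_def)
    have "i < l"
      using bead_less_iff[OF \<rho> i l(1)] l le by simp
    moreover have "l \<le> Suc i"
      using bead_le_iff[OF \<rho> l(1), of "Suc i"] l less by simp
    ultimately show "bead \<rho> (Suc i) = bead \<tau> i - 1"
      using l by (metis Suc_leI order_antisym)
  next
    assume "bead \<rho> (Suc i) = bead \<tau> i - 1"
    then show "bead \<tau> i - 1 + d \<in> beads d \<rho>"
      by (metis bead_in_beads le_add1 plus_1_eq_Suc)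
  qed
  have corner: "(i, j) \<in> ?S \<longleftrightarrow> 1 \<le> i \<and> j = part \<tau> i \<and> bead \<tau> i + d \<in> ?X" for i j
  proof (cases "1 \<le> i")
    case True
    have "bead \<tau> i + d \<in> ?X \<longleftrightarrow> bead \<tau> (Suc i) \<noteq> bead \<tau> i - 1 \<and> bead \<kappa> (Suc i) \<noteq> bead \<tau> i - 1"
      using in_beads[OF True p(2)] in_beads[OF True p(1) le[OF True] less[OF True]]
        bead_strict_antimono[OF p(2) True, of "Suc i"] bead_in_beads[OF True, of \<tau> d]
      by (simp add: add_diff_eq diff_add_eq)
    then show ?thesis
      using True less[OF True] bead_strict_antimono[OF p(2) True, of "Suc i"]
      by (auto simp: removable_corner_def blocked_def cells_def bead_def)
  qed (auto simp: removable_corner_def cells_def)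
  have "residue k ` ?S = (\<lambda>x. (x - d) mod n) ` ?X"
  proof (intro set_eqI iffI)
    fix r assume "r \<in> residue k ` ?S"
    then obtain i j where ij: "(i, j) \<in> ?S" "r = residue k (i, j)" by auto
    then show "r \<in> (\<lambda>x. (x - d) mod n) ` ?X"
      using corner[of i j] by (intro image_eqI[of _ _ "bead \<tau> i + d"]) (auto simp: residue_def bead_def n_def)
  next
    fix r assume "r \<in> (\<lambda>x. (x - d) mod n) ` ?X"
    then obtain x where x: "x \<in> ?X" "r = (x - d) mod n" by auto
    then obtain i where i: "1 \<le> i" "x = bead \<tau> i + d"
      by (auto simp: beads_def)
    then show "r \<in> residue k ` ?S"
      using corner[of i "part \<tau> i"] x
      by (intro image_eqI[of _ _ "(i, part \<tau> i)"]) (auto simp: residue_def bead_def n_def)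
  qed
  also have "\<dots> = (\<lambda>x. (x - d) mod n) ` (\<lambda>x. x mod n) ` ?X"
    by (simp add: image_image mod_diff_left_eq)
  finally have "num_residues k \<kappa> \<tau> = card ((\<lambda>x. (x - d) mod n) ` (\<lambda>x. x mod n) ` ?X)"
    by (simp add: num_residues_def)
  also have "\<dots> = card ((\<lambda>x. x mod n) ` ?X)"
  proof (intro card_image inj_onI)
    fix x y assume xy: "x \<in> (\<lambda>x. x mod n) ` ?X" "y \<in> (\<lambda>x. x mod n) ` ?X" "(x - d) mod n = (y - d) mod n"
    then have "x mod n = y mod n"
      using mod_add_one_cong[of "x - d" "y - d" d] by simp
    then show "x = y"
      using xy(1,2) by auto
  qed
  finally show ?thesis .
qed

text \<open>For a bead x of \<tau>, x - 1 is empty both before and after the move exactly if it lies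
  outside \<open>below T\<close>: an element of \<open>below T\<close> stays a bead unless its right
  neighbour is a content. The best candidate in class r is x = \<open>M r\<close>, and at an ascent
  \<open>M r = T r\<close>, as moved classes satisfy \<open>T r = T (r - 1) + 1\<close>.\<close>

lemma num_residues_adm:
  assumes p: "is_partition \<kappa>" "is_partition \<tau>" and h: "horizontal_strip \<kappa> \<tau>"
    and M: "runner M" "below M = beads d \<tau>" and T: "adm M T" and \<kappa>: "beads d \<kappa> = below (step M T)"
  shows "num_residues k \<kappa> \<tau> = card (ascents T)"
proof -
  have rT: "runner T" by (rule admD[OF T])
  have B': "y \<in> beads d \<kappa> \<longleftrightarrow> y \<le> T y \<and> \<not> (M (y + 1) < y + 1 \<and> y + 1 \<le> T (y + 1))" for y
    unfolding \<kappa> adm_strip(2)[OF M(1) T, symmetric] moved_def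
    using below_mono_adm[OF T] by (auto simp: below_iff subset_iff)
  have "(\<lambda>x. x mod n) ` {x \<in> beads d \<tau>. x - 1 \<notin> beads d \<tau> \<and> x - 1 \<notin> beads d \<kappa>} = ascents T"
  proof (intro set_eqI iffI)
    fix r assume "r \<in> (\<lambda>x. x mod n) ` {x \<in> beads d \<tau>. x - 1 \<notin> beads d \<tau> \<and> x - 1 \<notin> beads d \<kappa>}"
    then obtain x where x: "r = x mod n" "x \<le> M x" "M (x - 1) < x - 1" "x - 1 \<notin> beads d \<kappa>"
      unfolding M(2)[symmetric] by (auto simp: below_iff)
    have "T (x - 1) < x - 1"
      using x B'[of "x - 1"] by auto
    then have "T (x - 1) + 1 < T x"
      using x(2) admD(2)[OF T, of x] by simp
    moreover have "T r = T x" "T (r - 1) = T (x - 1)"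
      using x(1) by (auto intro!: runner_cong[OF rT] simp: mod_diff_left_eq)
    ultimately show "r \<in> ascents T"
      using x(1) n_pos by (simp add: ascents_def)
  next
    fix r assume "r \<in> ascents T"
    then have r: "0 \<le> r" "r < n" "T (r - 1) + 1 < T r"
      by (auto simp: ascents_def)
    define x where "x = M r"
    have Mr: "M r = T r"
      using admD(2)[OF T, of r] admD(3)[OF T, of r] r by fastforce
    have xmod: "x mod n = r"
      using runner_mod[OF M(1), of r] r by (simp add: x_def)
    have "x \<le> M x"
      by (simp add: x_def runner_idem M(1))
    have "T (x - 1) = T (r - 1)"
      unfolding x_def by (intro runner_cong[OF rT] mod_diff_one_cong runner_mod M)
    then have "T (x - 1) < x - 1"
      using r Mr by (simp add: x_def)
    moreover from this have "M (x - 1) < x - 1"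
      using admD(2)[OF T, of "x - 1"] by linarith
    ultimately show "r \<in> (\<lambda>x. x mod n) ` {x \<in> beads d \<tau>. x - 1 \<notin> beads d \<tau> \<and> x - 1 \<notin> beads d \<kappa>}"
      using \<open>x \<le> M x\<close> xmod B'[of "x - 1"] unfolding M(2)[symmetric]
      by (intro image_eqI[of _ _ x]) (auto simp: below_iff)
  qed
  then show ?thesis
    using card_corners[OF p h, of d] by simp
qed

section \<open>Operations on runners and their bounded partitions\<close>

text \<open>The offset is forgotten here; the chosen partition is unique by
  \<open>beads_unique\<close>.\<close>

definition shape :: "(int \<Rightarrow> int) \<Rightarrow> nat list" where
  "shape M = core_to_bounded k (SOME \<kappa>. is_partition \<kappa> \<and> (\<exists>d. beads d \<kappa> = below M))"

lemma shape_eq: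
  assumes M: "runner M" and \<kappa>: "is_partition \<kappa>" "beads d \<kappa> = below M"
  shows "shape M = core_to_bounded k \<kappa>" "bounded_to_core k (shape M) = \<kappa>"
proof -
  let ?P = "\<lambda>\<kappa>. is_partition \<kappa> \<and> (\<exists>d. beads d \<kappa> = below M)"
  have "?P (SOME \<kappa>. ?P \<kappa>)"
    by (rule someI[of ?P \<kappa>]) (use \<kappa> in blast)
  then obtain d' where "is_partition (SOME \<kappa>. ?P \<kappa>)" "beads d' (SOME \<kappa>. ?P \<kappa>) = below M"
    by blast
  then have "(SOME \<kappa>. ?P \<kappa>) = \<kappa>"
    using beads_unique(2)[of "SOME \<kappa>. ?P \<kappa>" \<kappa> d' d] \<kappa> by simp
  then show "shape M = core_to_bounded k \<kappa>"
    by (simp add: shape_def)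
  then show "bounded_to_core k (shape M) = \<kappa>"
    using bounded_to_core_eq core_if_runner[OF \<kappa>(1) M \<kappa>(2)[symmetric]] by simp
qed

lemma shape_core:
  assumes "runner M"
  obtains d where "beads d (bounded_to_core k (shape M)) = below M" "is_partition (bounded_to_core k (shape M))"
  using partition_of_runner[OF assms] shape_eq(2)[OF assms] by metis

lemma shape_in: "runner M \<Longrightarrow> shape M \<in> bounded_partitions k"
  using partition_of_runner[of M] shape_eq(1)[of M] core_to_bounded_in core_if_runner by metis

lemma bounded_partition_zero: "\<nu> \<in> bounded_partitions k \<Longrightarrow> count (mset \<nu>) 0 = 0"
  unfolding count_eq_zero_iff set_mset_mset by (auto simp: bounded_partitions_def is_partition_def)

lemma count_shape: "runner M \<Longrightarrow> 1 \<le> t \<Longrightarrow> count (mset (shape M)) t = card {x \<in> below M. rank M x = t}"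
  using partition_of_runner[of M] shape_eq(1)[of M] count_core_to_bounded[of _ M _ t] by metis

text \<open>If the runner of exactly \<open>t\<close> classes is at most \<open>\<theta>\<close>, this adjoins \<open>a\<close> copies of \<open>R\<^sub>t\<close> to the bounded partition.\<close>

definition lift :: "int \<Rightarrow> nat \<Rightarrow> (int \<Rightarrow> int) \<Rightarrow> int \<Rightarrow> int" where
  "lift \<theta> a M y = (if \<theta> < M y then M y + n * int a else M y)"

lemma runner_lift: "runner M \<Longrightarrow> runner (lift \<theta> a M)"
  by (simp add: runner_def lift_def)

lemma lift_Suc: "lift \<theta> (Suc a) M = lift \<theta> 1 (lift \<theta> a M)"
proof
  fix y
  have "M y \<le> M y + n * int a"
    using n_pos by simp
  then show "lift \<theta> (Suc a) M y = lift \<theta> 1 (lift \<theta> a M) y"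
    by (auto simp: lift_def algebra_simps)
qed

lemma card_window:
  assumes "\<And>y. P (y mod n) = P y"
  shows "card {x. c < x \<and> x \<le> c + n \<and> P x} = card {r \<in> {0..<n}. P r}"
proof -
  have "{x. c < x \<and> x \<le> c + n \<and> P x} = (\<lambda>r. r + (c + 1)) ` {r \<in> {0..<n}. P (r + (c + 1))}"
  proof (intro set_eqI iffI)
    fix x assume "x \<in> {x. c < x \<and> x \<le> c + n \<and> P x}"
    then show "x \<in> (\<lambda>r. r + (c + 1)) ` {r \<in> {0..<n}. P (r + (c + 1))}"
      by (intro image_eqI[of _ _ "x - (c + 1)"]) auto
  qed auto
  then show ?thesis
    using card_periodic_shift[of P "c + 1"] assms by (simp add: card_image inj_on_def)
qed

text \<open>There are three zones. Up to \<theta> + n nothing changes, and beyond \<theta> + 2n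
  beads and ranks are translated by n. The window between them contains one bead of each of the k +
  1 - t classes above \<theta>, all of rank t; these are the rows of the new rectangle.\<close>

lemma count_lift_one:
  assumes M: "runner M" and t: "card {r \<in> {0..<n}. M r \<le> \<theta>} = t" and s: "1 \<le> s"
  shows "count (mset (shape (lift \<theta> 1 M))) s = count (mset (shape M)) s + (if s = t then Suc k - t else 0)"
proof -
  define L where "L = lift \<theta> 1 M"
  have L: "runner L"
    unfolding L_def by (rule runner_lift[OF M])
  have Ly: "L y = (if \<theta> < M y then M y + n else M y)" for y
    by (simp add: L_def lift_def)
  have Lmod: "L y mod n = y mod n" for y
    by (rule runner_mod[OF L])
  have low: "x \<in> below L \<longleftrightarrow> x \<in> below M" "rank L x = rank M x" if x: "x \<le> \<theta> + n" for x
  proof -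
    have "x \<le> M x" if "\<theta> < M x"
      using that x runner_le_iff[OF M, of x x] by simp
    then show "x \<in> below L \<longleftrightarrow> x \<in> below M"
      using n_pos by (auto simp: below_iff Ly)
    have "L r < x - n \<longleftrightarrow> M r < x - n" for r
      using x n_pos by (auto simp: Ly)
    then show "rank L x = rank M x"
      by (simp add: rank_def)
  qed
  have mid: "x \<in> below L \<longleftrightarrow> \<theta> < M x" "rank L x = t" if x: "\<theta> + n < x" "x \<le> \<theta> + n + n" for x
  proof -
    have "x \<le> L x" if "\<theta> < M x"
      using that x runner_le_iff[OF L, of x x] by (simp add: Ly)
    moreover have "\<not> x \<le> L x" if "\<not> \<theta> < M x"
      using that x n_pos by (simp add: Ly)
    ultimately show "x \<in> below L \<longleftrightarrow> \<theta> < M x"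
      by (auto simp: below_iff)
    have "L r < x - n \<longleftrightarrow> M r \<le> \<theta>" for r
      using x n_pos by (auto simp: Ly)
    then show "rank L x = t"
      using t by (simp add: rank_def)
  qed
  have high: "x \<in> below L \<longleftrightarrow> x - n \<in> below M" "rank L x = rank M (x - n)" if x: "\<theta> + n + n < x" for x
  proof -
    show "x \<in> below L \<longleftrightarrow> x - n \<in> below M"
      using x n_pos M by (auto simp: below_iff Ly)
    have "L r < x - n \<longleftrightarrow> M r < x - n - n" for r
      using x n_pos by (auto simp: Ly)
    then show "rank L x = rank M (x - n)"
      by (simp add: rank_def)
  qed
  let ?F = "{x \<in> below M. rank M x = s}"
  let ?X = "{x \<in> below L. rank L x = s}"
  have finF: "finite ?F" and finX: "finite ?X"
    using finite_rank_eq M L s by blast+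
  let ?S2 = "{x. \<theta> + n < x \<and> x \<le> \<theta> + n + n \<and> \<theta> < M x \<and> s = t}"
  have "?X = ({x \<in> ?F. x \<le> \<theta> + n} \<union> (\<lambda>x. x + n) ` {x \<in> ?F. \<theta> + n < x}) \<union> ?S2" (is "_ = ?S1 \<union> ?S3 \<union> _")
  proof (intro set_eqI)
    fix x
    consider "x \<le> \<theta> + n" | "\<theta> + n < x" "x \<le> \<theta> + n + n" | "\<theta> + n + n < x"
      by linarith
    then show "x \<in> ?X \<longleftrightarrow> x \<in> ?S1 \<union> ?S3 \<union> ?S2"
    proof cases
      case 1
      then have "x \<notin> ?S3" "x \<notin> ?S2"
        using n_pos by auto
      then show ?thesis
        using low[OF 1] 1 by simp
    next
      case 2
      then have "x \<notin> ?S3" "x \<notin> ?S1"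
        by auto
      then show ?thesis
        using mid[OF 2] 2 by auto
    next
      case 3
      then have "x \<notin> ?S1" "x \<notin> ?S2"
        using n_pos by auto
      moreover have "x \<in> ?S3 \<longleftrightarrow> x - n \<in> ?F \<and> \<theta> + n < x - n"
        by force
      ultimately show ?thesis
        using high[OF 3] 3 by auto
    qed
  qed
  then have "card ?X = card (?S1 \<union> ?S3) + card ?S2"
    using finX finF by (subst card_Un_disjoint[symmetric]) (auto intro: finite_subset[of ?S2 "{\<theta> + n..\<theta> + n + n}"])
  also have "card (?S1 \<union> ?S3) = card ?S1 + card ?S3"
    using n_pos by (intro card_Un_disjoint finite_imageI finite_subset[OF _ finF]) auto
  also have "card ?S3 = card {x \<in> ?F. \<theta> + n < x}"
    by (rule card_image) simp
  also have "card ?S1 + \<dots> = card ({x \<in> ?F. x \<le> \<theta> + n} \<union> {x \<in> ?F. \<theta> + n < x})"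
    by (intro card_Un_disjoint[symmetric] finite_subset[OF _ finF]) auto
  also have "{x \<in> ?F. x \<le> \<theta> + n} \<union> {x \<in> ?F. \<theta> + n < x} = ?F"
    by auto
  also have "card ?S2 = (if s = t then Suc k - t else 0)"
  proof (cases "s = t")
    case True
    have "card {r \<in> {0..<n}. \<theta> < M r} = Suc k - t"
    proof -
      have "card {r \<in> {0..<n}. \<theta> < M r} = card ({0..<n} - {r \<in> {0..<n}. M r \<le> \<theta>})"
        by (rule arg_cong[of _ _ card]) auto
      also have "\<dots> = card {0..<n} - t"
        unfolding t[symmetric] by (rule card_Diff_subset) auto
      finally show ?thesis
        by (simp add: n_def nat_add_distrib)
    qed
    moreover have "(\<theta> < M (y mod n)) = (\<theta> < M y)" for y
      using M by (simp add: runner_def)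
    ultimately show ?thesis
      using card_window[of "\<lambda>x. \<theta> < M x" "\<theta> + n"] True by simp
  qed simp
  finally show ?thesis
    using count_shape[OF M s] count_shape[OF L s] by (simp add: L_def)
qed

lemma mset_shape_lift:
  assumes M: "runner M" and t: "card {r \<in> {0..<n}. M r \<le> \<theta>} = t" "1 \<le> t"
  shows "mset (shape (lift \<theta> a M)) = mset (shape M) + replicate_mset (a * (Suc k - t)) t"
proof (induction a)
  case 0
  have "lift \<theta> 0 M = M"
    by (rule ext) (simp add: lift_def)
  then show ?case by simp
next
  case (Suc a)
  have rl: "runner (lift \<theta> a M)"
    by (rule runner_lift[OF M])
  have "0 \<le> n * int a"
    using n_pos by simp
  then have "lift \<theta> a M r \<le> \<theta> \<longleftrightarrow> M r \<le> \<theta>" for r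
    by (auto simp: lift_def)
  then have "card {r \<in> {0..<n}. lift \<theta> a M r \<le> \<theta>} = t"
    using t by simp
  note one = count_lift_one[OF rl this]
  have "mset (shape (lift \<theta> (Suc a) M)) = mset (shape (lift \<theta> a M)) + replicate_mset (Suc k - t) t"
  proof (rule multiset_eqI)
    fix s
    show "count (mset (shape (lift \<theta> (Suc a) M))) s = count (mset (shape (lift \<theta> a M)) + replicate_mset (Suc k - t) t) s"
    proof (cases "s = 0")
      case True
      then show ?thesis
        unfolding True count_union count_replicate_mset bounded_partition_zero[OF shape_in[OF rl]]
          bounded_partition_zero[OF shape_in[OF runner_lift[OF M]]] using t(2) by simp
    next
      case False
      then show ?thesis
        using one[of s] unfolding lift_Suc[of \<theta> a M] by simp
    qed
  qed
  then show ?case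
    by (intro multiset_eqI) (simp add: Suc)
qed

text \<open>
  If \<open>N u > u\<close> and \<open>N (u + 1) = u + 1\<close>, this raises one part of the bounded partition by one, namely
  a part equal to the number of classes below \<open>u\<close>.
\<close>

definition bump :: "int \<Rightarrow> (int \<Rightarrow> int) \<Rightarrow> int \<Rightarrow> int" where
  "bump u N y = (if y mod n = u mod n then u
     else if y mod n = (u + 1) mod n then N u + 1 else N y)"

lemma Suc_mod_neq: "(u + 1) mod n \<noteq> u mod n"
  using mod_gap[of u "u + 1"] n_ge_2 by auto

lemma runner_bump: "runner N \<Longrightarrow> runner (bump u N)"
  using mod_add_one_cong[OF runner_mod[of N u], of 1] by (auto simp: runner_def bump_def)

lemma rank_split:
  assumes N: "runner N"
  shows "rank N x = card {r \<in> {0..<n}. r \<noteq> u mod n \<and> r \<noteq> (u + 1) mod n \<and> N r < x - n}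
    + of_bool (N u < x - n) + of_bool (N (u + 1) < x - n)"
proof -
  let ?A = "{r \<in> {0..<n}. r \<noteq> u mod n \<and> r \<noteq> (u + 1) mod n \<and> N r < x - n}"
  let ?B = "if N u < x - n then {u mod n} else {}"
  let ?C = "if N (u + 1) < x - n then {(u + 1) mod n} else {}"
  have "N (u mod n) = N u" "N ((u + 1) mod n) = N (u + 1)"
    using N by (simp_all add: runner_def)
  then have "{r \<in> {0..<n}. N r < x - n} = ?A \<union> (?B \<union> ?C)"
    using n_pos by auto
  then have "rank N x = card (?A \<union> (?B \<union> ?C))"
    by (simp add: rank_def)
  also have "\<dots> = card ?A + card (?B \<union> ?C)"
    by (rule card_Un_disjoint) auto
  also have "card (?B \<union> ?C) = card ?B + card ?C"
    using Suc_mod_neq[of u] by (intro card_Un_disjoint) auto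
  finally show ?thesis by simp
qed

text \<open>The beads of class u above u move one step into class u + 1 (the map \<open>f\<close>),
  and the two classes essentially trade places, so ranks persist. The exception is the lowest moved
  bead \<open>x0 = u + n\<close>: after the move class u lies below it as well, and its rank rises
  from i to i + 1.\<close>

lemma count_shape_bump:
  assumes N: "runner N" and u: "u < N u" "N (u + 1) = u + 1"
    and i: "card {r \<in> {0..<n}. N r < u} = i" and s: "1 \<le> s"
  shows "count (mset (shape (bump u N))) s + of_bool (s = i) = count (mset (shape N)) s + of_bool (s = Suc i)"
proof -
  define N' where "N' = bump u N"
  define H where "H = N u"
  have N': "runner N'"
    unfolding N'_def by (rule runner_bump[OF N])
  have Hu: "u + n \<le> H" "H mod n = u mod n"
    using mod_gap[of u H] u runner_mod[OF N, of u] by (simp_all add: H_def)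
  have vals: "N' u = u" "N' (u + 1) = H + 1"
    using Suc_mod_neq[of u] by (simp_all add: N'_def bump_def H_def)
  have classu: "N x = H" "N' x = u" if "x mod n = u mod n" for x
    using runner_cong[OF N that] runner_cong[OF N' that] vals by (simp_all add: H_def)
  have classu1: "N x = u + 1" "N' x = H + 1" if "x mod n = (u + 1) mod n" for x
    using runner_cong[OF N that] runner_cong[OF N' that] vals u by simp_all
  have other: "N' x = N x" if "x mod n \<noteq> u mod n" "x mod n \<noteq> (u + 1) mod n" for x
    using that by (simp add: N'_def bump_def)
  have restr: "{r \<in> {0..<n}. r \<noteq> u mod n \<and> r \<noteq> (u + 1) mod n \<and> N' r < x - n} =
      {r \<in> {0..<n}. r \<noteq> u mod n \<and> r \<noteq> (u + 1) mod n \<and> N r < x - n}" for x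
    using other by force
  have restr1: "{r \<in> {0..<n}. r \<noteq> u mod n \<and> r \<noteq> (u + 1) mod n \<and> N r < x + 1 - n} =
      {r \<in> {0..<n}. r \<noteq> u mod n \<and> r \<noteq> (u + 1) mod n \<and> N r < x - n}"
    if "x mod n = u mod n" for x
  proof -
    have "N r \<noteq> x - n" if "r \<in> {0..<n}" "r \<noteq> u mod n" for r
    proof
      assume "N r = x - n"
      then have "N r mod n = u mod n" using \<open>x mod n = u mod n\<close> by simp
      then show False using runner_mod[OF N, of r] that by simp
    qed
    moreover have "N r < x + 1 - n \<longleftrightarrow> N r < x - n \<or> N r = x - n" for r
      by linarith
    ultimately show ?thesis by blast
  qed
  note split = rank_split[OF N, of _ u] rank_split[OF N', of _ u]
  define f where "f = (\<lambda>x. if x mod n = u mod n \<and> u < x then x + 1 else x)"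
  define x0 where "x0 = u + n"
  have x0: "x0 \<in> below N" "x0 + 1 \<in> below N'" "f x0 = x0 + 1"
    using Hu n_pos classu[of x0] classu1[of "x0 + 1"] mod_add_n_one[of u]
    by (auto simp: x0_def below_iff f_def)
  have rank0: "rank N x0 = i" "rank N' (x0 + 1) = Suc i"
  proof -
    show "rank N x0 = i"
      using i by (simp add: rank_def x0_def)
    then show "rank N' (x0 + 1) = Suc i"
      using split[of x0] split[of "x0 + 1"] restr[of "x0 + 1"] restr1[of x0] vals Hu u n_pos
      by (simp add: x0_def H_def)
  qed
  have f_rank: "f x \<in> below N' \<and> f x \<noteq> x0 + 1 \<and> rank N' (f x) = rank N x" if x: "x \<in> below N" "x \<noteq> x0" for x
  proof (cases "x mod n = u mod n \<and> u < x")
    case True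
    then have x1: "(x + 1) mod n = (u + 1) mod n"
      by (intro mod_add_one_cong) simp
    have "u + n < x"
      using True x mod_gap[of u x] by (auto simp: x0_def)
    then have ge: "u + n + n \<le> x"
      using mod_gap[of "u + n" x] True by simp
    have le: "x \<le> H"
      using x True classu by (simp add: below_iff)
    have "f x = x + 1" "x + 1 \<in> below N'"
      using True le classu1[OF x1] by (simp_all add: f_def below_iff)
    moreover have "rank N' (x + 1) = rank N x"
      using split[of x] split[of "x + 1"] restr[of "x + 1"] restr1[of x] True vals u ge le n_ge_2
      by (simp add: H_def)
    ultimately show ?thesis using x by simp
  next
    case False
    then have fx: "f x = x" by (auto simp: f_def)
    have "x \<in> below N'"
    proof (cases "x mod n = u mod n")
      case True
      then show ?thesis using False classu[of x] by (simp add: below_iff)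
    next
      case F: False
      then show ?thesis
        using x classu1[of x] other[of x] Hu n_pos
        by (cases "x mod n = (u + 1) mod n") (simp_all add: below_iff)
    qed
    moreover have ne: "x \<noteq> x0 + 1" "x \<noteq> H + 1 + n"
    proof -
      have "x mod n \<noteq> (u + 1) mod n \<or> x \<le> u + 1"
        using x classu1[of x] by (auto simp: below_iff)
      moreover have "(x0 + 1) mod n = (u + 1) mod n"
        unfolding x0_def by (rule mod_add_n_one)
      moreover have "(H + 1 + n) mod n = (u + 1) mod n"
        using mod_add_one_cong[OF Hu(2), of 1] by simp
      ultimately show "x \<noteq> x0 + 1" "x \<noteq> H + 1 + n"
        using n_pos Hu by (auto simp: x0_def)
    qed
    moreover have "rank N' x = rank N x"
    proof -
      have "of_bool (N u < x - n) + of_bool (N (u + 1) < x - n) =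
          (of_bool (N' u < x - n) + of_bool (N' (u + 1) < x - n) :: nat)"
        using vals ne u by (auto simp: H_def[symmetric] x0_def)
      then show ?thesis
        using split[of x] restr[of x] by simp
    qed
    ultimately show ?thesis using fx by simp
  qed
  have f_surj: "\<exists>x\<in>below N. x \<noteq> x0 \<and> f x = y" if y: "y \<in> below N'" "y \<noteq> x0 + 1" for y
  proof (cases "y mod n = (u + 1) mod n \<and> u + 1 < y")
    case True
    then have y1: "(y - 1) mod n = u mod n"
      using mod_diff_one_cong[of y "u + 1" 1] by simp
    then have "y - 1 \<in> below N"
      using classu[OF y1] classu1[of y] True y by (simp add: below_iff)
    moreover have "f (y - 1) = y"
      using True y1 by (simp add: f_def)
    ultimately show ?thesis
      using y(2) by (intro bexI[of _ "y - 1"]) auto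
  next
    case False
    have "y \<le> u" if "y mod n = u mod n"
      using y classu[OF that] by (simp add: below_iff)
    then have "f y = y" by (auto simp: f_def)
    moreover have "y \<in> below N"
    proof (cases "y mod n = u mod n")
      case True
      then show ?thesis using classu[of y] y Hu n_pos by (simp add: below_iff)
    next
      case F: False
      then show ?thesis
        using y classu1[of y] other[of y] False
        by (cases "y mod n = (u + 1) mod n") (simp_all add: below_iff)
    qed
    moreover have "y \<noteq> x0"
    proof
      assume "y = x0"
      then show False
        using y classu[of x0] n_pos by (simp add: x0_def below_iff)
    qed
    ultimately show ?thesis by blast
  qed
  have f_inj: "inj_on f (below N)"
  proof (rule inj_onI)
    have *: False if "x \<in> below N" "x' \<in> below N" "x mod n = u mod n" "u < x" "x' = x + 1" for x x'
    proof -
      have "x' mod n = (u + 1) mod n"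
        unfolding that(5) by (intro mod_add_one_cong that(3))
      then show False
        using that classu1[of x'] by (simp add: below_iff)
    qed
    fix x x' assume x: "x \<in> below N" "x' \<in> below N" "f x = f x'"
    show "x = x'"
    proof (cases "(x mod n = u mod n \<and> u < x) = (x' mod n = u mod n \<and> u < x')")
      case True
      then show ?thesis using x(3) by (simp add: f_def split: if_splits)
    next
      case False
      then consider "x mod n = u mod n" "u < x" "f x = x + 1" "f x' = x'"
        | "x' mod n = u mod n" "u < x'" "f x' = x' + 1" "f x = x"
        unfolding f_def by argo
      then show ?thesis
        using *[of x x'] *[of x' x] x by cases simp_all
    qed
  qed
  define X where "X = {x \<in> below N. rank N x = s}"
  define Y where "Y = {x \<in> below N'. rank N' x = s}"
  have fin: "finite X" "finite Y"
    unfolding X_def Y_def using finite_rank_eq N N' s by blast+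
  have "f ` (X - {x0}) = Y - {x0 + 1}"
  proof (intro set_eqI iffI)
    fix y assume "y \<in> f ` (X - {x0})"
    then show "y \<in> Y - {x0 + 1}"
      using f_rank by (force simp: X_def Y_def)
  next
    fix y assume y: "y \<in> Y - {x0 + 1}"
    then obtain x where x: "x \<in> below N" "x \<noteq> x0" "f x = y"
      using f_surj[of y] by (auto simp: Y_def)
    then show "y \<in> f ` (X - {x0})"
      using y f_rank[OF x(1,2)] by (auto simp: X_def Y_def)
  qed
  moreover have "inj_on f (X - {x0})"
    using f_inj by (rule inj_on_subset) (auto simp: X_def)
  ultimately have "card (X - {x0}) = card (Y - {x0 + 1})"
    using card_image by metis
  moreover have "x0 \<in> X \<longleftrightarrow> s = i" "x0 + 1 \<in> Y \<longleftrightarrow> s = Suc i"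
    using x0 rank0 by (auto simp: X_def Y_def)
  moreover have "card X = card (X - {x0}) + of_bool (x0 \<in> X)"
    using fin card_Suc_Diff1[of X x0] by (cases "x0 \<in> X") simp_all
  moreover have "card Y = card (Y - {x0 + 1}) + of_bool (x0 + 1 \<in> Y)"
    using fin card_Suc_Diff1[of Y "x0 + 1"] by (cases "x0 + 1 \<in> Y") simp_all
  ultimately show ?thesis
    using count_shape[OF N s] count_shape[OF N' s] by (simp add: X_def Y_def N'_def)
qed

section \<open>Weak strips above a partition with large parts\<close>

definition weak_succ :: "nat \<Rightarrow> nat list \<Rightarrow> nat list set" where
  "weak_succ r \<nu> = {\<mu> \<in> bounded_partitions k. \<exists>s\<le>r. weak_strip k s (bounded_to_core k \<mu>) (bounded_to_core k \<nu>)}"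

definition num_res :: "nat list \<Rightarrow> nat list \<Rightarrow> nat" where
  "num_res \<mu> \<nu> = num_residues k (bounded_to_core k \<mu>) (bounded_to_core k \<nu>)"

lemma weak_strip_sum:
  assumes "\<mu> \<in> bounded_partitions k" "\<nu> \<in> bounded_partitions k"
    "weak_strip k s (bounded_to_core k \<mu>) (bounded_to_core k \<nu>)"
  shows "sum_list \<mu> = sum_list \<nu> + s"
proof -
  have "core_length k (bounded_to_core k \<rho>) = sum_list \<rho>" if "\<rho> \<in> bounded_partitions k" for \<rho>
    using core_length_eq_sum_list[of "bounded_to_core k \<rho>"] bounded_to_core[OF that]
    by (simp add: is_core_def)
  then show ?thesis
    using assms by (simp add: weak_strip_def)
qed

lemma shape_step:
  assumes M: "runner M" and T: "adm M T"
  defines "\<mu> \<equiv> shape (step M T)"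
  shows "\<mu> \<in> bounded_partitions k"
    and "weak_strip k (card (moved_classes M T)) (bounded_to_core k \<mu>) (bounded_to_core k (shape M))"
    and "sum_list \<mu> = sum_list (shape M) + card (moved_classes M T)"
    and "num_res \<mu> (shape M) = card (ascents T)"
proof -
  have rs: "runner (step M T)"
    by (rule runner_step) fact+
  show in\<mu>: "\<mu> \<in> bounded_partitions k"
    unfolding \<mu>_def by (rule shape_in[OF rs])
  obtain d where d: "beads d (bounded_to_core k (shape M)) = below M"
    "is_partition (bounded_to_core k (shape M))"
    using shape_core[OF M] .
  obtain d' where d': "beads d' (bounded_to_core k \<mu>) = below (step M T)"
    "is_partition (bounded_to_core k \<mu>)"
    using shape_core[OF rs] unfolding \<mu>_def .
  have core: "is_core k (bounded_to_core k (shape M))"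
    by (rule core_if_runner[OF d(2) M d(1)[symmetric]])
  note w = adm_imp_weak_strip[OF core M d(1)[symmetric] T d'(2,1)]
  show "weak_strip k (card (moved_classes M T)) (bounded_to_core k \<mu>) (bounded_to_core k (shape M))"
    by (rule w)
  then show "sum_list \<mu> = sum_list (shape M) + card (moved_classes M T)"
    by (rule weak_strip_sum[OF in\<mu> shape_in[OF M]])
  have "horizontal_strip (bounded_to_core k \<mu>) (bounded_to_core k (shape M))"
    using w(1) by (simp add: weak_strip_def)
  then show "num_res \<mu> (shape M) = card (ascents T)"
    unfolding num_res_def using num_residues_adm[OF d'(2) d(2) _ M d(1)[symmetric] T] d'(1) w(2) by simp
qed

text \<open>From here on weak strips are handled only as runners \<open>T\<close> admissible over
  \<open>M\<close>.\<close>

lemma weak_succ_shape: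
  assumes M: "runner M" and r: "r \<le> k"
  shows "weak_succ r (shape M) = (\<lambda>T. shape (step M T)) ` {T. adm M T \<and> card (moved_classes M T) \<le> r}"
proof (intro set_eqI iffI)
  fix \<mu> assume "\<mu> \<in> weak_succ r (shape M)"
  then obtain s where \<mu>: "\<mu> \<in> bounded_partitions k" and s: "s \<le> r"
    and w: "weak_strip k s (bounded_to_core k \<mu>) (bounded_to_core k (shape M))"
    by (auto simp: weak_succ_def)
  obtain d where d: "beads d (bounded_to_core k (shape M)) = below M"
    using shape_core[OF M] .
  obtain T where T: "adm M T" "beads d (bounded_to_core k \<mu>) = below (step M T)" "s = card (moved_classes M T)"
    using weak_strip_imp_adm[OF w _ M d[symmetric]] s r by auto
  have "is_partition (bounded_to_core k \<mu>)"
    using bounded_to_core[OF \<mu>] by (simp add: is_core_def)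
  then have "shape (step M T) = \<mu>"
    using shape_eq(1)[OF runner_step[OF M T(1)] _ T(2)] bounded_to_core[OF \<mu>] by simp
  then show "\<mu> \<in> (\<lambda>T. shape (step M T)) ` {T. adm M T \<and> card (moved_classes M T) \<le> r}"
    using T s by blast
next
  fix \<mu> assume "\<mu> \<in> (\<lambda>T. shape (step M T)) ` {T. adm M T \<and> card (moved_classes M T) \<le> r}"
  then show "\<mu> \<in> weak_succ r (shape M)"
    using shape_step[OF M] unfolding weak_succ_def by blast
qed

text \<open>
  The normal form of a core whose bounded partition has no part below \<open>q\<close>: the offset is chosen such
  that the lowest \<open>q\<close> runners sit at \<open>1, \<dots>, q\<close>. A strip moves an initial segment of
  these classes, whose length is the new top row.
\<close>

definition based :: "(int \<Rightarrow> int) \<Rightarrow> nat \<Rightarrow> bool" where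
  "based M q \<longleftrightarrow> runner M \<and> q \<le> Suc k \<and> (\<forall>y. 1 \<le> M y) \<and> (\<forall>j. 1 \<le> j \<and> j \<le> int q \<longrightarrow> M j = j)"

lemma basedD:
  assumes "based M q"
  shows "runner M" "q \<le> Suc k" "1 \<le> M y" "1 \<le> j \<Longrightarrow> j \<le> int q \<Longrightarrow> M j = j"
  using assms by (auto simp: based_def)

lemma part_core_to_bounded_le:
  assumes "is_partition \<kappa>"
  shows "part (core_to_bounded k \<kappa>) i \<le> part \<kappa> i"
proof (cases "1 \<le> i \<and> i \<le> length \<kappa>")
  case True
  then obtain m where "i = Suc m" "m < length \<kappa>"
    by (cases i) auto
  then have "part (core_to_bounded k \<kappa>) i = card {j. (i, j) \<in> cells \<kappa> \<and> hook \<kappa> (i, j) \<le> int k}"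
    by (simp add: part_def core_to_bounded_def del: upt_Suc)
  also have "\<dots> \<le> card {1..part \<kappa> i}"
    by (rule card_mono) (auto simp: cells_def)
  finally show ?thesis by simp
qed (auto simp: part_def)

lemma exists_based:
  assumes \<nu>: "\<nu> \<in> bounded_partitions k" and q: "\<And>x. x \<in> set \<nu> \<Longrightarrow> q \<le> x" "q \<le> Suc k"
  obtains M where "based M q" "shape M = \<nu>"
    "below M = beads (int (length \<nu>) + 1 + n) (bounded_to_core k \<nu>)"
    "\<And>i. 1 \<le> i \<Longrightarrow> i \<le> length \<nu> \<Longrightarrow> q \<le> part (bounded_to_core k \<nu>) i"
proof -
  define \<kappa> where "\<kappa> = bounded_to_core k \<nu>"
  define l where "l = length \<nu>"
  \<comment> \<open>With this offset the beads of the empty rows are the positions up to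
    \<open>n\<close>. All rows have at least \<open>q\<close> cells, so \<open>n + 1\<close> to
    \<open>n + q\<close> are empty, which puts the largest beads of the classes 1 to
    \<open>q\<close> at 1 to \<open>q\<close>.\<close>
  define d where "d = int l + 1 + n"
  have core: "is_core k \<kappa>" and cb: "core_to_bounded k \<kappa> = \<nu>"
    using bounded_to_core[OF \<nu>] by (simp_all add: \<kappa>_def)
  have p: "is_partition \<kappa>"
    using core by (simp add: is_core_def)
  have len: "length \<kappa> = l"
    using cb length_core_to_bounded[of \<kappa>] by (simp add: l_def)
  obtain M where M: "runner M" "below M = beads d \<kappa>"
    using core_runner[OF core] .
  have "shape M = \<nu>"
    using shape_eq(1)[OF M(1) p M(2)[symmetric]] cb by simp
  have part: "q \<le> part \<kappa> i" if "1 \<le> i" "i \<le> l" for i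
  proof -
    have "q \<le> part \<nu> i"
      using that q(1) by (simp add: part_def l_def)
    then show ?thesis
      using part_core_to_bounded_le[OF p, of i] cb by simp
  qed
  have low: "z \<in> below M" if "z \<le> n" for z
    using that beads_lower[of z d \<kappa>] len M(2) by (simp add: d_def)
  have ge1: "1 \<le> M y" for y
  proof -
    obtain z where z: "z mod n = y mod n" "1 \<le> z" "z < 1 + n"
      using rep_between[of y 1] by blast
    then have "z \<le> M z"
      using low[of z] by (simp add: below_iff)
    then show ?thesis
      using z runner_cong[OF M(1) z(1)] by simp
  qed
  have "M j = j" if j: "1 \<le> j" "j \<le> int q" for j
  proof -
    have "j + n \<notin> beads d \<kappa>"
    proof
      assume "j + n \<in> beads d \<kappa>"
      then obtain i where i: "1 \<le> i" "j + n = bead \<kappa> i + d"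
        by (auto simp: beads_def)
      show False
      proof (cases "i \<le> l")
        case True
        then show False
          using i part[OF i(1) True] j by (simp add: bead_def d_def)
      next
        case False
        then show False
          using i len j by (simp add: bead_above_length d_def)
      qed
    qed
    then have "j + n \<notin> below M"
      unfolding M(2) .
    then have "M j < j + n"
      using M(1) by (simp add: below_iff)
    moreover have "j \<le> n"
      using j q(2) by (simp add: n_def)
    then have "j \<le> M j"
      using low[of j] by (simp add: below_iff)
    ultimately show ?thesis
      using mod_gap[of j "M j"] runner_mod[OF M(1), of j] by force
  qed
  then have "based M q"
    using M(1) ge1 q(2) by (simp add: based_def)
  then show ?thesis
    using that \<open>shape M = \<nu>\<close> M(2) part by (simp add: d_def l_def \<kappa>_def)
qed

text \<open>At most one row is new, namely row l + 1, whose bead starts at position n. Its contents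
  n + 1, ..., n + i lie in the classes 1 to i, while the contents of the other rows all lie above n
  + q. The lower rows of \<mu> keep at least q cells of small hook length.\<close>

lemma step_rows:
  assumes \<nu>: "\<nu> \<in> bounded_partitions k" and b: "based M q" and sh: "shape M = \<nu>"
    and bel: "below M = beads (int (length \<nu>) + 1 + n) (bounded_to_core k \<nu>)"
    and part: "\<And>i. 1 \<le> i \<Longrightarrow> i \<le> length \<nu> \<Longrightarrow> q \<le> part (bounded_to_core k \<nu>) i"
    and qk: "\<nu> \<noteq> [] \<Longrightarrow> q \<le> k"
    and T: "adm M T"
  defines "\<mu> \<equiv> shape (step M T)"
  defines "i \<equiv> part \<mu> (Suc (length \<nu>))"
  shows "length \<nu> \<le> length \<mu>" "length \<mu> \<le> Suc (length \<nu>)"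
    and "1 \<le> j \<Longrightarrow> j \<le> int i \<Longrightarrow> M j < T j"
    and "Suc i \<le> q \<Longrightarrow> T (int i + 1) = int i + 1"
    and "x \<in> set (take (length \<nu>) \<mu>) \<Longrightarrow> q \<le> x"
proof -
  define \<tau> where "\<tau> = bounded_to_core k \<nu>"
  define l where "l = length \<nu>"
  define d where "d = int l + 1 + n"
  define \<kappa> where "\<kappa> = bounded_to_core k \<mu>"
  have M: "runner M" by (rule basedD[OF b])
  have rs: "runner (step M T)" by (rule runner_step[OF M T])
  have \<mu>: "\<mu> \<in> bounded_partitions k"
    unfolding \<mu>_def by (rule shape_in[OF rs])
  have core: "is_core k \<tau>" "is_core k \<kappa>" and cb: "core_to_bounded k \<tau> = \<nu>" "core_to_bounded k \<kappa> = \<mu>"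
    using bounded_to_core[OF \<nu>] bounded_to_core[OF \<mu>] by (simp_all add: \<tau>_def \<kappa>_def)
  have p: "is_partition \<tau>" "is_partition \<kappa>"
    using core by (auto simp: is_core_def)
  have len: "length \<tau> = l" "length \<kappa> = length \<mu>"
    using cb length_core_to_bounded by (metis l_def)+
  have M\<tau>: "below M = beads d \<tau>"
    using bel by (simp add: \<tau>_def d_def l_def)
  obtain d' where "beads d' \<kappa> = below (step M T)"
    using shape_core[OF rs] unfolding \<mu>_def[symmetric] \<kappa>_def[symmetric] .
  note w = adm_imp_weak_strip[OF core(1) M M\<tau> T p(2) this]
  have B': "below (step M T) = beads d \<kappa>"
    using \<open>beads d' \<kappa> = _\<close> w(2) by simp
  have hs: "bead \<tau> i \<le> bead \<kappa> i" "bead \<kappa> (Suc i) < bead \<tau> i" if "1 \<le> i" for i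
    using w(1) that horizontal_strip_iff[OF p(2,1)] by (auto simp: weak_strip_def)
  have C: "y \<in> below T - below M \<longleftrightarrow> (\<exists>i\<ge>1. bead \<tau> i + d < y \<and> y \<le> bead \<kappa> i + d)" for y
  proof -
    have "y \<in> below T - below M \<longleftrightarrow> y - d \<in> contents \<kappa> \<tau>"
      unfolding w(3)[symmetric] by force
    then show ?thesis by (auto simp: contents_eq algebra_simps)
  qed
  have top\<tau>: "bead \<tau> (Suc l) + d = n"
    using len by (simp add: bead_above_length d_def)
  have "part \<kappa> (Suc (Suc l)) = 0"
    using hs(2)[of "Suc l"] len by (simp add: bead_def part_def)
  then have len\<kappa>: "length \<kappa> \<le> Suc l"
    using part_pos_iff[OF p(2), of "Suc (Suc l)"] by simp
  then show "length \<mu> \<le> Suc (length \<nu>)"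
    using len by (simp add: l_def)
  have "0 < part \<kappa> l" if "1 \<le> l"
    using hs(1)[OF that] part_pos_iff[OF p(1), of l] len that by (simp add: bead_def)
  then show len\<mu>: "length \<nu> \<le> length \<mu>"
    using part_pos_iff[OF p(2), of l] len by (cases "l = 0") (auto simp: l_def)
  define i' where "i' = part \<kappa> (Suc l)"
  have top\<kappa>: "bead \<kappa> (Suc l) + d = n + int i'"
    by (simp add: bead_def d_def i'_def)
  have lowbead: "y \<in> beads d \<kappa> \<longleftrightarrow> y \<le> n - 1 \<or> y = n + int i'" if "y \<le> n + int i'" for y
  proof
    assume "y \<in> beads d \<kappa>"
    then obtain j where j: "1 \<le> j" "y = bead \<kappa> j + d" by (auto simp: beads_def)
    then have "Suc l \<le> j"
      using bead_le_iff[OF p(2), of "Suc l" j] that top\<kappa> by simp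
    then show "y \<le> n - 1 \<or> y = n + int i'"
      using j top\<kappa> len\<kappa> by (cases "j = Suc l") (auto simp: bead_above_length d_def)
  next
    assume "y \<le> n - 1 \<or> y = n + int i'"
    then show "y \<in> beads d \<kappa>"
    proof
      assume "y \<le> n - 1"
      then show ?thesis
        using beads_lower[of y d \<kappa>] len\<kappa> by (simp add: d_def)
    next
      assume "y = n + int i'"
      then show ?thesis
        using bead_in_beads[of "Suc l" \<kappa> d] top\<kappa> by simp
    qed
  qed
  have core_closed: "y - n \<in> beads d \<kappa>" if "y \<in> beads d \<kappa>" for y
    using core(2) that is_core_iff[of \<kappa> d] by blast
  \<comment> \<open>Otherwise the core condition would put a bead at \<open>i'\<close>, between
    \<open>n\<close> and \<open>n + i' - 1\<close>, where the new row has left only gaps.\<close>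
  have i'n: "int i' < n"
  proof (rule ccontr)
    assume "\<not> int i' < n"
    moreover have "int i' \<in> beads d \<kappa>"
      using core_closed[of "n + int i'"] lowbead[of "n + int i'"] by simp
    ultimately show False
      using lowbead[of "int i'"] n_pos by simp
  qed
  \<comment> \<open>All cells of the new row count: its window contains exactly the gaps
    \<open>n\<close> to \<open>n + i' - 1\<close>, because \<open>i' < n\<close>.\<close>
  have "i = i'"
  proof (cases "length \<kappa> = Suc l")
    case True
    then have "i = card (gaps_below (beads d \<kappa>) (n + int i'))"
      using nth_core_to_bounded[OF p(2), of l d] cb(2) len top\<kappa>
      by (simp add: i_def part_def l_def)
    also have "gaps_below (beads d \<kappa>) (n + int i') = {n..<n + int i'}"
      using lowbead i'n by (auto simp: gaps_below_def)
    finally show ?thesis by simp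
  next
    case False
    then show ?thesis
      using len len\<kappa> by (simp add: i_def i'_def part_def l_def)
  qed
  show "M j < T j" if "1 \<le> j" "j \<le> int i"
  proof -
    have "n + j \<in> below T - below M"
      unfolding C using that top\<tau> top\<kappa> \<open>i = i'\<close> by (intro exI[of _ "Suc l"]) simp
    moreover have "M (n + j) = M j" "T (n + j) = T j"
      using runner_shift(1)[OF M, of j] runner_shift(1)[OF admD(1)[OF T], of j] by (simp_all add: add.commute)
    ultimately show ?thesis
      by (auto simp: below_iff)
  qed
  show "T (int i + 1) = int i + 1" if "Suc i \<le> q"
  proof -
    have "n + int i + 1 \<notin> below T - below M"
    proof
      assume "n + int i + 1 \<in> below T - below M"
      then obtain r where r: "1 \<le> r" "bead \<tau> r + d < n + int i + 1" "n + int i + 1 \<le> bead \<kappa> r + d"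
        unfolding C by blast
      have "r < Suc l"
        using bead_less_iff[OF p(2), of r "Suc l"] r top\<kappa> \<open>i = i'\<close> by simp
      then have "q \<le> part \<tau> r"
        using part[of r] r(1) by (simp add: \<tau>_def l_def)
      then show False
        using r \<open>r < Suc l\<close> that by (simp add: bead_def d_def)
    qed
    moreover have "M (n + int i + 1) = M (int i + 1)" "T (n + int i + 1) = T (int i + 1)"
      using runner_shift(1)[OF M, of "int i + 1"] runner_shift(1)[OF admD(1)[OF T], of "int i + 1"]
      by (simp_all add: ac_simps)
    moreover have Mi: "M (int i + 1) = int i + 1"
      using basedD(4)[OF b, of "int i + 1"] that by simp
    ultimately have "T (int i + 1) < n + int i + 1"
      using n_pos by (simp add: below_iff)
    moreover have "int i + 1 \<le> T (int i + 1)"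
      using admD(2)[OF T, of "int i + 1"] Mi by simp
    ultimately show ?thesis
      using mod_gap[of "int i + 1" "T (int i + 1)"] runner_mod[OF admD(1)[OF T], of "int i + 1"] by force
  qed
  show "q \<le> x" if x: "x \<in> set (take (length \<nu>) \<mu>)"
  proof -
    have l1: "1 \<le> l"
      using x by (cases "\<nu>") (auto simp: l_def)
    then have qk: "q \<le> k"
      by (intro qk) (auto simp: l_def)
    define X where "X = bead \<kappa> l + d"
    have X: "n + int q + 1 \<le> X"
      using hs(1)[OF l1] part[of l] l1 by (simp add: X_def bead_def d_def \<tau>_def l_def)
    have "\<mu> ! (l - 1) = card (gaps_below (beads d \<kappa>) X)"
    proof -
      have "Suc (l - 1) = l" "l - 1 < length \<kappa>"
        using l1 len len\<mu> by (simp_all add: l_def)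
      then show ?thesis
        using nth_core_to_bounded[OF p(2), of "l - 1" d] cb(2) by (simp only: X_def)
    qed
    moreover have between: "y \<notin> beads d \<kappa>" if "n + int i' < y" "y < X" for y
    proof
      assume "y \<in> beads d \<kappa>"
      then obtain j where j: "1 \<le> j" "y = bead \<kappa> j + d" by (auto simp: beads_def)
      then have "j < Suc l" "l < j"
        using that top\<kappa> bead_less_iff[OF p(2), of j "Suc l"] bead_less_iff[OF p(2), of l j] l1 by (auto simp: X_def)
      then show False by simp
    qed
    \<comment> \<open>Either the window of the last old row contains the at least q + 1 positions
      from \<open>n\<close> to \<open>X - 1\<close>, of which only \<open>n + i'\<close> can be a
      bead, or \<open>X - n\<close> is the bead of the new row and all k positions of the window are
      empty.\<close>
    have "q \<le> card (gaps_below (beads d \<kappa>) X)"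
    proof (cases "X - n \<le> n - 1")
      case True
      have "{n..<X} - {n + int i'} \<subseteq> gaps_below (beads d \<kappa>) X"
      proof
        fix y assume y: "y \<in> {n..<X} - {n + int i'}"
        then show "y \<in> gaps_below (beads d \<kappa>) X"
          using between[of y] lowbead[of y] True by (cases "n + int i' < y") (auto simp: gaps_below_def)
      qed
      then have "card ({n..<X} - {n + int i'}) \<le> card (gaps_below (beads d \<kappa>) X)"
        by (rule card_mono[OF finite_gaps_below])
      moreover have "card {n..<X} - 1 \<le> card ({n..<X} - {n + int i'})"
        using card_Diff1_le[of "{n..<X}" "n + int i'"] card_Diff_singleton_if[of "{n..<X}" "n + int i'"] by simp
      ultimately show ?thesis
        using X by simp
    next
      case False
      have "X - n \<in> beads d \<kappa>"
        using core_closed[of X] bead_in_beads[OF l1, of \<kappa> d] by (simp add: X_def)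
      then have "X - n = n + int i'"
        using between[of "X - n"] lowbead[of "X - n"] False n_pos by linarith
      then have "gaps_below (beads d \<kappa>) X = {X - n<..<X}"
        using between by (auto simp: gaps_below_def)
      then have "card (gaps_below (beads d \<kappa>) X) = k"
        by (simp add: n_def)
      then show ?thesis using qk by simp
    qed
    ultimately have "q \<le> \<mu> ! (l - 1)" by simp
    obtain j where j: "j < l" "x = \<mu> ! j"
      using x len\<mu> by (auto simp: in_set_conv_nth l_def)
    then have "\<mu> ! (l - 1) \<le> \<mu> ! j"
      using \<mu> len\<mu> sorted_wrt_nth_less[of "(\<ge>)" \<mu> j "l - 1"]
      by (cases "j = l - 1") (auto simp: bounded_partitions_def is_partition_def l_def)
    then show ?thesis
      using \<open>q \<le> \<mu> ! (l - 1)\<close> j by simp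
  qed
qed

section \<open>Compatibility of strips with the lift by rectangles\<close>

lemma prefix_moved:
  assumes b: "based M q" and T: "adm M T" and j: "1 \<le> j" "j + 1 \<le> int q" and m: "M (j + 1) < T (j + 1)"
  shows "M j < T j"
proof (rule ccontr)
  assume "\<not> M j < T j"
  then have "T j = j"
    using admD(2)[OF T, of j] basedD(4)[OF b, of j] j by simp
  \<comment> \<open>A class following an unmoved class with value \<open>j\<close> would be carried
    to \<open>j + 1\<close>, where it already is. Hence the moved classes among 1 to
    \<open>q\<close> form an initial segment.\<close>
  then show False
    using m admD(3)[OF T m] basedD(4)[OF b, of "j + 1"] j by simp
qed

lemma prefix_unmoved:
  assumes b: "based M q" and T: "adm M T" and ij: "1 \<le> i" "i \<le> j" "j \<le> int q" and m: "M i = T i"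
  shows "M j = T j"
  using ij(2,3)
proof (induction j rule: int_ge_induct)
  case (step j)
  show ?case
    using prefix_moved[OF b T, of j] step ij(1) admD(2)[OF T, of "j + 1"] by force
qed (rule m)

text \<open>A value between 1 and q is the original runner value of its own class, so a moved class
  always ends above q.\<close>

lemma small_eq:
  assumes b: "based M q" and y: "M y \<le> T y" "T y \<le> int q" and T: "runner T"
  shows "M y = T y"
proof -
  have "M (T y) = T y"
    using basedD[OF b] y by (meson order_trans)
  moreover have "M (T y) = M y"
    by (rule runner_cong[OF basedD(1)[OF b] runner_mod[OF T]])
  ultimately show ?thesis by simp
qed

lemma val_class: "based M q \<Longrightarrow> 1 \<le> j \<Longrightarrow> j \<le> int q \<Longrightarrow> y mod n = j mod n \<Longrightarrow> M y = j"
  using runner_cong[of M y j] basedD by metis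

text \<open>Both runners can be cut at the same height t: a moved class ends above t, and so does
  its predecessor, because otherwise the moved class would end at t + 1, which
  \<open>small_eq\<close> excludes for the base of length t + 1.\<close>

lemma adm_lift:
  assumes b: "based M (Suc t)" and a: "1 \<le> a" and T: "adm M T"
  shows "adm (lift (int t) a M) (lift (int t) a T)" "moved_classes (lift (int t) a M) (lift (int t) a T) = moved_classes M T"
proof -
  have rT: "runner T" by (rule admD[OF T])
  have M: "runner M" by (rule basedD[OF b])
  have na: "0 < n * int a" using n_pos a by simp
  have moved_gt: "int t < T y" if "M y < T y" for y
    using small_eq[OF b _ _ rT, of y] that by fastforce
  have iff: "lift (int t) a M y < lift (int t) a T y \<longleftrightarrow> M y < T y" for y
    using moved_gt[of y] na admD(2)[OF T, of y] unfolding lift_def by auto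
  have le: "lift (int t) a M y \<le> lift (int t) a T y" for y
    using na admD(2)[OF T, of y] unfolding lift_def by auto
  have "lift (int t) a T y = lift (int t) a T (y - 1) + 1" if m: "M y < T y" for y
  proof -
    have eq: "T y = T (y - 1) + 1"
      by (rule admD(3)[OF T m])
    have "int t < T (y - 1)"
    proof (rule ccontr)
      assume "\<not> int t < T (y - 1)"
      then have "T y = int (Suc t)"
        using eq moved_gt[OF m] by simp
      then show False
        using small_eq[OF b admD(2)[OF T, of y] _ rT] m by simp
    qed
    then show ?thesis
      using eq moved_gt[OF m] by (simp add: lift_def)
  qed
  then show "adm (lift (int t) a M) (lift (int t) a T)"
    using le iff runner_lift[OF rT] by (simp add: adm_def)
  show "moved_classes (lift (int t) a M) (lift (int t) a T) = moved_classes M T"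
    using iff by (simp add: moved_classes_def)
qed

lemma lift_adm_imp:
  assumes b: "based M (Suc t)" and a: "1 \<le> a" and T': "adm (lift (int t) a M) T'"
  shows "\<exists>T. adm M T \<and> T' = lift (int t) a T"
proof -
  define A where "A = n * int a"
  have A: "0 < A" using n_pos a by (simp add: A_def)
  have M: "runner M" by (rule basedD[OF b])
  have rT': "runner T'" by (rule admD[OF T'])
  have L: "lift (int t) a M y = (if int t < M y then M y + A else M y)" for y
    by (simp add: lift_def A_def)
  have le: "lift (int t) a M y \<le> T' y" for y by (rule admD(2)[OF T'])
  \<comment> \<open>The lift leaves no value in this range. A class with such a value has
    \<open>M y\<close> at most t and is moved, so its predecessor has the value one less; descending
    ends at the value t + 1, which belongs to a class whose own runner is already t + 1.\<close>
  have gap: "\<not> (int t < T' y \<and> T' y \<le> int t + A)" for y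
  proof (induction "nat (T' y)" arbitrary: y rule: less_induct)
    case less
    show ?case
    proof
      assume y: "int t < T' y \<and> T' y \<le> int t + A"
      have My: "M y \<le> int t"
        using le[of y] y by (auto simp: L split: if_splits)
      then have m: "lift (int t) a M y < T' y"
        using y by (simp add: L)
      have eq: "T' y = T' (y - 1) + 1"
        by (rule admD(3)[OF T' m])
      show False
      proof (cases "int t < T' (y - 1)")
        case True
        then show False
          using less.hyps[of "y - 1"] eq y by auto
      next
        case False
        then have "T' y = int (Suc t)"
          using eq y by simp
        then have "M y = int (Suc t)"
          using val_class[OF b, of "int (Suc t)" y] runner_mod[OF rT', of y] by simp
        then show False using My by simp
      qed
    qed
  qed
  define T where "T = (\<lambda>y. if int t < T' y then T' y - A else T' y)"
  have big: "int t + A < T' y" if "int t < T' y" for y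
    using gap[of y] that by auto
  have rT: "runner T"
  proof -
    have "(T' y - n * int a) mod n = T' y mod n" for y
      using mod_mult_self2[of "T' y - n * int a" n "int a"] by simp
    then show ?thesis
      using rT' by (simp add: runner_def T_def A_def)
  qed
  have T'T: "T' = lift (int t) a T"
  proof
    fix y
    show "T' y = lift (int t) a T y"
      using big[of y] A unfolding T_def lift_def A_def[symmetric] by auto
  qed
  have leMT: "M y \<le> T y" for y
    using le[of y] big[of y] A by (auto simp: L T_def split: if_splits)
  have "T y = T (y - 1) + 1" if m: "M y < T y" for y
  proof -
    have "lift (int t) a M y < T' y"
      using m A le[of y] by (auto simp: L T_def split: if_splits)
    from admD(3)[OF T' this] have eq: "T' y = T' (y - 1) + 1" .
    then have "int t < T' y \<longleftrightarrow> int t < T' (y - 1)"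
      using big[of y] A by (cases "int t < T' y") auto
    then show ?thesis
      using eq by (simp add: T_def)
  qed
  then have "adm M T"
    using rT leMT by (simp add: adm_def)
  then show ?thesis using T'T by blast
qed

text \<open>A step lowers the values inherited from moved classes by one, so the cut at t becomes a
  cut at t - 1 or t. Conflicts occur only at the value t after the step: if class t + 1 moves, so
  does class t, and no unmodified value of \<open>T\<close> is t; if it does not move, no lowered
  value is t.\<close>

lemma step_lift:
  assumes b: "based M (Suc t)" and t: "1 \<le> t" and a: "1 \<le> a" and T: "adm M T"
  defines "\<theta> \<equiv> (if M (int t + 1) < T (int t + 1) then int t - 1 else int t)"
  shows "step (lift (int t) a M) (lift (int t) a T) = lift \<theta> a (step M T)"
    "\<theta> < step M T y \<longleftrightarrow> (if M (y + 1) < T (y + 1) then int t < M (y + 1) else int t < T y)"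
proof -
  have M: "runner M" by (rule basedD[OF b])
  have rT: "runner T" by (rule admD[OF T])
  have M1: "M (int t + 1) = int t + 1" "M (int t) = int t"
    using basedD(4)[OF b] t by auto
  have iff: "lift (int t) a M y < lift (int t) a T y \<longleftrightarrow> M y < T y" for y
  proof -
    have "int t < T y" if "M y < T y"
      using small_eq[OF b _ _ rT, of y] that by fastforce
    moreover have "0 < n * int a" using n_pos a by simp
    ultimately show ?thesis
      using admD(2)[OF T, of y] unfolding lift_def by auto
  qed
  have cut: "\<theta> < step M T y \<longleftrightarrow> (if M (y + 1) < T (y + 1) then int t < M (y + 1) else int t < T y)" for y
  proof (cases "M (int t + 1) < T (int t + 1)")
    case True
    then have th: "\<theta> = int t - 1" by (simp add: \<theta>_def)
    have tm: "M (int t) < T (int t)"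
      using prefix_moved[OF b T, of "int t"] True t by simp
    show ?thesis
    proof (cases "M (y + 1) < T (y + 1)")
      case False
      have "T y \<noteq> int t"
      proof
        assume "T y = int t"
        then have "T (int t) = T y"
          using runner_cong[OF rT runner_mod[OF rT, of y]] by simp
        then show False
          using tm M1 \<open>T y = int t\<close> by simp
      qed
      then show ?thesis using False th by (auto simp: step_def)
    qed (use th in \<open>auto simp: step_def\<close>)
  next
    case unm: False
    then have th: "\<theta> = int t" by (simp add: \<theta>_def)
    show ?thesis
    proof (cases "M (y + 1) < T (y + 1)")
      case True
      have "M (y + 1) \<noteq> int t + 1"
      proof
        assume "M (y + 1) = int t + 1"
        then have "(y + 1) mod n = (int t + 1) mod n"
          using runner_mod[OF M, of "y + 1"] by simp
        then show False
          using True unm runner_cong[OF M] runner_cong[OF rT] by metis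
      qed
      then show ?thesis using True th by (auto simp: step_def)
    qed (use th in \<open>auto simp: step_def\<close>)
  qed
  then show "\<theta> < step M T y \<longleftrightarrow> (if M (y + 1) < T (y + 1) then int t < M (y + 1) else int t < T y)" .
  show "step (lift (int t) a M) (lift (int t) a T) = lift \<theta> a (step M T)"
  proof
    fix y
    show "step (lift (int t) a M) (lift (int t) a T) y = lift \<theta> a (step M T) y"
      using cut[of y] iff[of "y + 1"] unfolding step_def lift_def by auto
  qed
qed

lemma card_low_based:
  assumes b: "based M t" and t: "t \<le> k"
  shows "card {r \<in> {0..<n}. M r \<le> int t} = t"
proof -
  have "M r \<le> int t \<longleftrightarrow> 1 \<le> r \<and> r \<le> int t" if r: "r \<in> {0..<n}" for r
  proof
    assume "M r \<le> int t"
    then have "M r < n" "1 \<le> M r"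
      using t basedD(3)[OF b] by (simp_all add: n_def)
    then have "M r = r"
      using runner_mod[OF basedD(1)[OF b], of r] r by simp
    then show "1 \<le> r \<and> r \<le> int t"
      using \<open>1 \<le> M r\<close> \<open>M r \<le> int t\<close> by simp
  next
    assume "1 \<le> r \<and> r \<le> int t"
    then show "M r \<le> int t"
      using basedD(4)[OF b, of r] by simp
  qed
  then have "{r \<in> {0..<n}. M r \<le> int t} = {1..int t}"
    using t by (auto simp: n_def)
  then show ?thesis by simp
qed

lemma based_mono: "based M q \<Longrightarrow> q' \<le> q \<Longrightarrow> based M q'"
  by (auto simp: based_def)

text \<open>Let i be the number of moved classes among 1 to t. The step gives the classes 0 to i - 1
  the values 0 to i - 1, carries class i away, and keeps i + 1 to t. So again t classes are low, and
  the lift still adds copies of \<open>rect k t\<close>.\<close>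

lemma card_low_step:
  assumes b: "based M (Suc t)" and t: "1 \<le> t" "t \<le> k" and T: "adm M T"
  defines "\<theta> \<equiv> (if M (int t + 1) < T (int t + 1) then int t - 1 else int t)"
  shows "card {r \<in> {0..<n}. step M T r \<le> \<theta>} = t"
proof -
  have M: "runner M" by (rule basedD[OF b])
  have rT: "runner T" by (rule admD[OF T])
  define S where "S = {j \<in> {0..int t}. j = 0 \<or> M j < T j}"
  have fS: "finite S" "S \<noteq> {}"
    by (auto simp: S_def intro: finite_subset[of _ "{0..int t}"])
  define i where "i = Max S"
  have i: "i \<in> S" "\<And>j. j \<in> S \<Longrightarrow> j \<le> i"
    using fS by (auto simp: i_def)
  have i0: "0 \<le> i" "i \<le> int t"
    using i(1) by (auto simp: S_def)
  have moved: "M j < T j \<longleftrightarrow> j \<le> i" if j: "1 \<le> j" "j \<le> int t" for j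
  proof
    assume "M j < T j"
    then show "j \<le> i" using i(2)[of j] j by (simp add: S_def)
  next
    assume ji: "j \<le> i"
    then have "M i < T i" using i(1) j by (auto simp: S_def)
    then show "M j < T j"
      using prefix_unmoved[OF b T j(1) ji] i0 admD(2)[OF T, of j] by force
  qed
  have small: "M y \<le> int t \<longleftrightarrow> 1 \<le> y \<and> y \<le> int t" if y: "0 \<le> y" "y \<le> n" for y
  proof
    assume My: "M y \<le> int t"
    have 1: "1 \<le> M y" "M y < n"
      using basedD(3)[OF b] My t by (simp_all add: n_def)
    have "y \<noteq> 0 \<and> y \<noteq> n"
      using runner_mod[OF M, of y] 1 by auto
    then have "M y = y"
      using runner_mod[OF M, of y] 1 y by simp
    then show "1 \<le> y \<and> y \<le> int t" using My 1 by simp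
  next
    assume "1 \<le> y \<and> y \<le> int t"
    then show "M y \<le> int t" using basedD(4)[OF b, of y] by simp
  qed
  have iff: "step M T r \<le> \<theta> \<longleftrightarrow> r \<in> {0..int t} - {i}" if r: "r \<in> {0..<n}" for r
  proof (cases "M (r + 1) < T (r + 1)")
    case True
    have "step M T r \<le> \<theta> \<longleftrightarrow> M (r + 1) \<le> int t"
      using step_lift(2)[OF b t(1) _ T, of 1 r, folded \<theta>_def] True by auto
    also have "\<dots> \<longleftrightarrow> r < int t"
      using small[of "r + 1"] r by auto
    also have "\<dots> \<longleftrightarrow> r \<in> {0..int t} - {i}"
    proof
      assume "r < int t"
      then have "r + 1 \<le> i" using moved[of "r + 1"] True r by simp
      then show "r \<in> {0..int t} - {i}" using r i0 by simp
    next
      assume a: "r \<in> {0..int t} - {i}"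
      show "r < int t"
      proof (rule ccontr)
        assume "\<not> r < int t"
        then have "r = int t" using a by simp
        then have "M (int t) < T (int t)"
          using prefix_moved[OF b T, of "int t"] True t by simp
        then show False using moved[of "int t"] t a i0 \<open>r = int t\<close> by simp
      qed
    qed
    finally show ?thesis .
  next
    case False
    have "step M T r \<le> \<theta> \<longleftrightarrow> T r \<le> int t"
      using step_lift(2)[OF b t(1) _ T, of 1 r, folded \<theta>_def] False by auto
    also have "\<dots> \<longleftrightarrow> M r \<le> int t \<and> \<not> M r < T r"
      using small_eq[OF b admD(2)[OF T, of r] _ rT] admD(2)[OF T, of r] by auto
    also have "\<dots> \<longleftrightarrow> i < r \<and> r \<le> int t"
      using small[of r] moved[of r] r i0 by auto
    also have "\<dots> \<longleftrightarrow> r \<in> {0..int t} - {i}"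
    proof -
      have "\<not> r < i"
        using moved[of "r + 1"] False r i0 by auto
      then show ?thesis using r i0 by auto
    qed
    finally show ?thesis .
  qed
  have "{r \<in> {0..<n}. step M T r \<le> \<theta>} = {0..int t} - {i}"
  proof (intro set_eqI iffI)
    fix r assume "r \<in> {0..int t} - {i}"
    moreover from this have "r \<in> {0..<n}" using t by (simp add: n_def)
    ultimately show "r \<in> {r \<in> {0..<n}. step M T r \<le> \<theta>}" using iff by simp
  qed (use iff in auto)
  then show ?thesis
    using i0 by simp
qed

text \<open>A class with \<open>T\<close>-value t is followed by the value t + 1. These neighbours
  form no ascent, but the lift raises only the second one. All other neighbouring values keep their
  relation.\<close>

lemma card_ascents_lift:
  assumes b: "based M (Suc t)" and t: "1 \<le> t" "t \<le> k" and a: "1 \<le> a" and T: "adm M T"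
  shows "card (ascents (lift (int t) a T)) = card (ascents T) + of_bool (T (int t) = int t)"
proof -
  have M: "runner M" by (rule basedD[OF b])
  have rT: "runner T" by (rule admD[OF T])
  define A where "A = n * int a"
  have A: "1 \<le> A" using n_ge_2 a mult_mono[of 1 n 1 "int a"] by (simp add: A_def)
  have L: "lift (int t) a T y = (if int t < T y then T y + A else T y)" for y
    by (simp add: lift_def A_def)
  have next_val: "T y = int t + 1" if "T (y - 1) = int t" for y
  proof -
    have "(y - 1) mod n = int t mod n"
      using runner_mod[OF rT, of "y - 1"] that by simp
    then have y: "y mod n = (int t + 1) mod n"
      using mod_add_one_cong[of "y - 1" "int t" 1] by simp
    have My: "M y = int t + 1"
      using val_class[OF b _ _ y] by simp
    then show ?thesis
      using admD(2)[OF T, of y] admD(3)[OF T, of y] that by fastforce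
  qed
  have iff: "lift (int t) a T (y - 1) + 1 < lift (int t) a T y \<longleftrightarrow> T (y - 1) + 1 < T y \<or> T (y - 1) = int t" for y
    using next_val[of y] A unfolding L by auto
  have "ascents (lift (int t) a T) = ascents T \<union> {r \<in> {0..<n}. T (r - 1) = int t}"
    unfolding ascents_def iff by auto
  moreover have "ascents T \<inter> {r \<in> {0..<n}. T (r - 1) = int t} = {}"
    using next_val by (force simp: ascents_def)
  moreover have "finite (ascents T)"
    by (simp add: ascents_def)
  ultimately have "card (ascents (lift (int t) a T)) = card (ascents T) + card {r \<in> {0..<n}. T (r - 1) = int t}"
    by (simp add: card_Un_disjoint)
  also have "card {r \<in> {0..<n}. T (r - 1) = int t} = of_bool (T (int t) = int t)"
  proof -
    have "T (r - 1) = int t \<longleftrightarrow> T (int t) = int t \<and> r = (int t + 1) mod n" if r: "r \<in> {0..<n}" for r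
    proof
      assume h: "T (r - 1) = int t"
      then have m: "(r - 1) mod n = int t mod n"
        using runner_mod[OF rT, of "r - 1"] by simp
      then show "T (int t) = int t \<and> r = (int t + 1) mod n"
        using runner_cong[OF rT m] h mod_add_one_cong[OF m, of 1] r by simp
    next
      assume h: "T (int t) = int t \<and> r = (int t + 1) mod n"
      then have "(r - 1) mod n = int t mod n"
        by (simp add: mod_diff_left_eq)
      then show "T (r - 1) = int t"
        using runner_cong[OF rT] h by metis
    qed
    then have "{r \<in> {0..<n}. T (r - 1) = int t} = (if T (int t) = int t then {(int t + 1) mod n} else {})"
      using n_pos by auto
    then show ?thesis by simp
  qed
  finally show ?thesis .
qed

section \<open>Lengthening the top row by one cell\<close>

definition raise :: "int \<Rightarrow> (int \<Rightarrow> int) \<Rightarrow> int \<Rightarrow> int" where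
  "raise i T y = (if y mod n = (i + 1) mod n then T i + 1 else T y)"

lemma Suc_Suc_mod_neq:
  assumes "y mod n = (i + 1) mod n"
  shows "(y + 1) mod n \<noteq> (i + 1) mod n" "(y - 1) mod n \<noteq> (i + 1) mod n"
  using Suc_mod_neq[of y] Suc_mod_neq[of "y - 1"] assms by auto

text \<open>Class i + 1 joins the block of moved classes 1 to i, with the value forced by
  admissibility; on the result of the step this acts as \<open>bump\<close>. No ascent appears or
  vanishes: class i + 1 first lies below its predecessor and then continues it, and class i + 2
  first continues class i + 1 and then lies below it. For i = 0 there is no old row to remove from
  the multiset.\<close>

lemma raise_facts:
  assumes M: "runner M" and ge1: "\<And>y. 1 \<le> M y" and T: "adm M T" and ik: "Suc i \<le> k"
    and low: "\<And>j. 1 \<le> j \<Longrightarrow> j \<le> int i \<Longrightarrow> M j = j \<and> M j < T j"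
    and i1: "M (int i + 1) = int i + 1" "T (int i + 1) = int i + 1"
    and i2: "M (int i + 2) = T (int i + 2)"
  shows "adm M (raise (int i) T)"
    and "card (moved_classes M (raise (int i) T)) = Suc (card (moved_classes M T))"
    and "mset (shape (step M (raise (int i) T))) + (if i = 0 then {#} else {#i#}) =
      mset (shape (step M T)) + {#Suc i#}"
    and "M (int i + 2) = int i + 2 \<Longrightarrow> ascents (raise (int i) T) = ascents T"
proof -
  have rT: "runner T" by (rule admD[OF T])
  define u where "u = int i"
  define T2 where "T2 = raise u T"
  have Tu: "u < T u"
    using low[of u] ge1[of u] admD(2)[OF T, of u] by (cases "i = 0") (auto simp: u_def)
  have T2y: "T2 y = (if y mod n = (u + 1) mod n then T u + 1 else T y)" for y
    by (simp add: T2_def raise_def)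
  have cls: "M y = u + 1" "T y = u + 1" if "y mod n = (u + 1) mod n" for y
    using runner_cong[OF M that] runner_cong[OF rT that] i1 by (simp_all add: u_def)
  have cls2: "M y = T y" if "(y - 1) mod n = (u + 1) mod n" for y
  proof -
    have "y mod n = (u + 2) mod n"
      using mod_add_one_cong[OF that, of 1] by (simp add: add.assoc)
    then show ?thesis
      using runner_cong[OF M] runner_cong[OF rT] i2 unfolding u_def by metis
  qed
  have rT2: "runner T2"
    using rT mod_add_one_cong[OF runner_mod[OF rT, of u], of 1] by (auto simp: runner_def T2y)
  have adm: "adm M T2"
    unfolding adm_def
  proof (intro conjI allI impI rT2)
    fix y
    show "M y \<le> T2 y"
      using cls[of y] Tu admD(2)[OF T, of y] by (auto simp: T2y)
    assume m: "M y < T2 y"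
    show "T2 y = T2 (y - 1) + 1"
    proof (cases "y mod n = (u + 1) mod n")
      case True
      then have "(y - 1) mod n = u mod n"
        using mod_diff_one_cong[OF True, of 1] by simp
      then have "T (y - 1) = T u"
        by (rule runner_cong[OF rT])
      then show ?thesis
        using True Suc_Suc_mod_neq(2)[OF True] by (simp add: T2y)
    next
      case False
      then show ?thesis
        using m cls2[of y] admD(3)[OF T, of y] by (auto simp: T2y)
    qed
  qed
  then show "adm M (raise (int i) T)"
    by (simp add: T2_def u_def)
  have u1: "(u + 1) mod n = u + 1" "u + 1 < n"
    using ik by (simp_all add: u_def n_def)
  have "moved_classes M T2 = insert (u + 1) (moved_classes M T)"
  proof (intro set_eqI)
    fix r
    show "r \<in> moved_classes M T2 \<longleftrightarrow> r \<in> insert (u + 1) (moved_classes M T)"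
    proof (cases "r = u + 1")
      case True
      then show ?thesis
        using u1 Tu cls(1)[of r] by (simp add: moved_classes_def T2y u_def)
    next
      case False
      then have "r mod n \<noteq> (u + 1) mod n" if "0 \<le> r" "r < n"
        using that u1 by simp
      then show ?thesis
        using False by (auto simp: moved_classes_def T2y)
    qed
  qed
  moreover have "u + 1 \<notin> moved_classes M T"
    using cls[of "u + 1"] by (simp add: moved_classes_def)
  moreover have "finite (moved_classes M T)"
    by (simp add: moved_classes_def)
  ultimately show "card (moved_classes M (raise (int i) T)) = Suc (card (moved_classes M T))"
    by (simp add: T2_def u_def)
  show "ascents (raise (int i) T) = ascents T" if i2': "M (int i + 2) = int i + 2"
  proof -
    have "T2 (r - 1) + 1 < T2 r \<longleftrightarrow> T (r - 1) + 1 < T r" for r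
    proof -
      consider "r mod n = (u + 1) mod n" | "(r - 1) mod n = (u + 1) mod n"
        | "r mod n \<noteq> (u + 1) mod n" "(r - 1) mod n \<noteq> (u + 1) mod n"
        by blast
      then show ?thesis
      proof cases
        case 1
        then have "(r - 1) mod n = u mod n"
          using mod_diff_one_cong[OF 1, of 1] by simp
        then have "T (r - 1) = T u"
          by (rule runner_cong[OF rT])
        then show ?thesis
          using 1 Suc_Suc_mod_neq(2)[OF 1] cls(2)[OF 1] Tu by (simp add: T2y)
      next
        case 2
        have "r mod n = (u + 2) mod n"
          using mod_add_one_cong[OF 2, of 1] by (simp add: add.assoc)
        then have "T r = u + 2"
          using runner_cong[OF rT] i2 i2' unfolding u_def by metis
        moreover have "r mod n \<noteq> (u + 1) mod n"
          using Suc_Suc_mod_neq(1)[OF 2] by simp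
        ultimately show ?thesis
          using 2 cls(2)[OF 2] Tu by (simp add: T2y)
      next
        case 3
        then show ?thesis by (simp add: T2y)
      qed
    qed
    then show ?thesis
      by (simp add: ascents_def T2_def u_def)
  qed
  have m1: "\<not> M (u + 1) < T (u + 1)"
    using cls[of "u + 1"] by simp
  define N where "N = step M T"
  have rN: "runner N"
    unfolding N_def by (rule runner_step[OF M T])
  have Nu: "N u = T u" "N (u + 1) = u + 1"
  proof -
    have "M (u + 1 + 1) = T (u + 1 + 1)"
      by (rule cls2) (simp only: add_diff_cancel_right')
    then show "N u = T u" "N (u + 1) = u + 1"
      using m1 cls(2)[of "u + 1"] by (simp_all add: N_def step_def)
  qed
  have "step M T2 = bump u N"
  proof
    fix y
    consider "y mod n = u mod n" | "y mod n = (u + 1) mod n"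
      | "y mod n \<noteq> u mod n" "y mod n \<noteq> (u + 1) mod n"
      by blast
    then show "step M T2 y = bump u N y"
    proof cases
      case 1
      then have "(y + 1) mod n = (u + 1) mod n"
        by (rule mod_add_one_cong)
      then show ?thesis
        using 1 cls(1)[of "y + 1"] Tu by (simp add: step_def bump_def T2y)
    next
      case 2
      then have "(y + 1) mod n \<noteq> (u + 1) mod n"
        by (rule Suc_Suc_mod_neq)
      moreover have "M (y + 1) = T (y + 1)"
        using 2 by (intro cls2) simp
      ultimately show ?thesis
        using 2 Suc_mod_neq[of u] Nu by (simp add: step_def bump_def T2y)
    next
      case 3
      then have "(y + 1) mod n \<noteq> (u + 1) mod n"
        using mod_diff_one_cong[of "y + 1" "u + 1" 1] by auto
      then show ?thesis
        using 3 by (simp add: step_def bump_def T2y N_def)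
    qed
  qed
  moreover have "card {r \<in> {0..<n}. N r < u} = i"
  proof -
    have "N r < u \<longleftrightarrow> r < u" if r: "r \<in> {0..<n}" for r
    proof (cases "M (r + 1) < T (r + 1)")
      case True
      then have Nr: "N r = M (r + 1) - 1" by (simp add: N_def step_def)
      show ?thesis
      proof
        assume "r < u"
        then show "N r < u" using Nr low[of "r + 1"] r by (simp add: u_def)
      next
        assume Nr': "N r < u"
        define j where "j = M (r + 1)"
        have j: "1 \<le> j" "j \<le> u"
          using Nr Nr' ge1[of "r + 1"] by (simp_all add: j_def)
        have "(r + 1) mod n = j"
          using runner_mod[OF M, of "r + 1"] j u1 by (simp add: j_def)
        then show "r < u"
          using r j u1 by (cases "r + 1 = n") auto
      qed
    next
      case False
      have "\<not> r < u"
        using low[of "r + 1"] False r by (auto simp: u_def)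
      moreover have "\<not> N r < u"
      proof
        assume "N r < u"
        then have Tr: "T r < u" using False by (simp add: N_def step_def)
        have "1 \<le> T r" using ge1[of r] admD(2)[OF T, of r] by linarith
        then have "M (T r) = T r" "M (T r) < T (T r)"
          using low[of "T r"] Tr by (auto simp: u_def)
        then show False using runner_idem[OF rT, of r] by simp
      qed
      ultimately show ?thesis by simp
    qed
    then have "{r \<in> {0..<n}. N r < u} = {0..<u}"
      using u1 by auto
    then show ?thesis by (simp add: u_def)
  qed
  ultimately have cnt: "count (mset (shape (step M T2))) s + of_bool (s = i) = count (mset (shape N)) s + of_bool (s = Suc i)"
    if "1 \<le> s" for s
    using count_shape_bump[OF rN _ Nu(2) _ that, of i] Nu Tu by simp
  have "shape (step M T2) \<in> bounded_partitions k" "shape N \<in> bounded_partitions k"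
    using shape_in runner_step[OF M adm] rN by blast+
  note zero = this[THEN bounded_partition_zero]
  show "mset (shape (step M (raise (int i) T))) + (if i = 0 then {#} else {#i#}) =
      mset (shape (step M T)) + {#Suc i#}"
  proof (rule multiset_eqI)
    fix s
    show "count (mset (shape (step M (raise (int i) T))) + (if i = 0 then {#} else {#i#})) s =
      count (mset (shape (step M T)) + {#Suc i#}) s"
    proof (cases "s = 0")
      case True
      then show ?thesis
        unfolding True count_union u_def[symmetric] T2_def[symmetric] N_def[symmetric] zero by simp
    next
      case False
      then show ?thesis
        using cnt[of s] by (auto simp: T2_def u_def N_def of_bool_def split: if_splits)
    qed
  qed
qed

text \<open>If row \<open>l + 1\<close> is empty, \<open>part\<close> returns 0 and a new row of
  length 1 is appended.\<close>

definition inc :: "nat \<Rightarrow> nat list \<Rightarrow> nat list" where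
  "inc l \<mu> = take l \<mu> @ [Suc (part \<mu> (Suc l))]"

lemma take_append_last:
  assumes "length \<mu> \<le> Suc l" "l \<le> length \<mu>" "0 \<notin> set \<mu>"
  shows "\<mu> = take l \<mu> @ (if part \<mu> (Suc l) = 0 then [] else [part \<mu> (Suc l)])"
proof (cases "length \<mu> = Suc l")
  case True
  then have "part \<mu> (Suc l) = \<mu> ! l" "\<mu> ! l \<in> set \<mu>"
    by (auto simp: part_def)
  then have "part \<mu> (Suc l) \<noteq> 0"
    using assms(3) by metis
  then show ?thesis
    using True \<open>part \<mu> (Suc l) = \<mu> ! l\<close> by (simp add: take_Suc_conv_app_nth[symmetric])
next
  case False
  then show ?thesis
    using assms by (simp add: part_def)
qed

lemma zero_notin_bounded: "\<mu> \<in> bounded_partitions k \<Longrightarrow> 0 \<notin> set \<mu>"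
  by (auto simp: bounded_partitions_def is_partition_def)

lemma is_partition_snoc:
  "is_partition \<mu> \<Longrightarrow> (\<And>x. x \<in> set \<mu> \<Longrightarrow> y \<le> x) \<Longrightarrow> 0 < y \<Longrightarrow> is_partition (\<mu> @ [y])"
  by (auto simp: is_partition_def sorted_wrt_append)

lemma is_partition_take: "is_partition \<mu> \<Longrightarrow> is_partition (take l \<mu>)"
  by (auto simp: is_partition_def sorted_wrt_take dest: in_set_takeD)

end

text \<open>The base has length \<open>Suc t\<close> rather than \<open>t\<close>: besides the
  classes 1 to t that stay low under the lift, it contains class t + 1, on which the cut at t and
  the shift of \<open>raise\<close> depend. Such an \<open>M\<close> exists by
  \<open>exists_strip_setting\<close>.\<close>

locale strip_setting = k_bound +
  fixes t :: nat and \<nu> :: "nat list" and M :: "int \<Rightarrow> int"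
  assumes t: "1 \<le> t" "t \<le> k" and \<nu>: "\<nu> \<in> bounded_partitions k" and gt: "\<And>x. x \<in> set \<nu> \<Longrightarrow> t < x"
    and b: "based M (Suc t)" and sh: "shape M = \<nu>"
    and bel: "below M = beads (int (length \<nu>) + 1 + n) (bounded_to_core k \<nu>)"
    and prt: "\<And>i. 1 \<le> i \<Longrightarrow> i \<le> length \<nu> \<Longrightarrow> Suc t \<le> part (bounded_to_core k \<nu>) i"
begin

abbreviation l :: nat where "l \<equiv> length \<nu>"

lemma M: "runner M"
  by (rule basedD[OF b])

lemma Suc_t_le: "\<nu> \<noteq> [] \<Longrightarrow> Suc t \<le> k"
  using gt \<nu> by (cases \<nu>) (force simp: bounded_partitions_def)+

lemma rows:
  assumes "adm M T"
  defines "\<mu> \<equiv> shape (step M T)"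
  shows "l \<le> length \<mu>" "length \<mu> \<le> Suc l"
    and "1 \<le> j \<Longrightarrow> j \<le> int (part \<mu> (Suc l)) \<Longrightarrow> M j < T j"
    and "part \<mu> (Suc l) < Suc t \<Longrightarrow> T (int (part \<mu> (Suc l)) + 1) = int (part \<mu> (Suc l)) + 1"
    and "x \<in> set (take l \<mu>) \<Longrightarrow> t < x"
proof -
  note s = step_rows[OF \<nu> b sh bel _ _ assms(1), folded \<mu>_def]
  show "l \<le> length \<mu>"
    by (rule s(1)) (fact prt Suc_t_le)+
  show "length \<mu> \<le> Suc l"
    by (rule s(2)) (fact prt Suc_t_le)+
  show "M j < T j" if "1 \<le> j" "j \<le> int (part \<mu> (Suc l))"
    by (rule s(3)) (fact prt Suc_t_le that)+
  show "T (int (part \<mu> (Suc l)) + 1) = int (part \<mu> (Suc l)) + 1" if "part \<mu> (Suc l) < Suc t"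
    by (rule s(4)) (fact prt Suc_t_le Suc_leI[OF that])+
  show "t < x" if "x \<in> set (take l \<mu>)"
    by (rule Suc_le_lessD, rule s(5)) (fact prt Suc_t_le that)+
qed

lemma succ_elim:
  assumes "\<mu> \<in> weak_succ r \<nu>" "r \<le> k"
  obtains T where "adm M T" "card (moved_classes M T) \<le> r" "\<mu> = shape (step M T)"
    "sum_list \<mu> = sum_list \<nu> + card (moved_classes M T)" "num_res \<mu> \<nu> = card (ascents T)"
  using assms weak_succ_shape[OF M, of r] shape_step(3,4)[OF M] sh by auto

lemma succ_intro:
  "adm M T \<Longrightarrow> card (moved_classes M T) \<le> r \<Longrightarrow> r \<le> k \<Longrightarrow> shape (step M T) \<in> weak_succ r \<nu>"
  using weak_succ_shape[OF M, of r] sh by auto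

lemma succ_rows:
  assumes "\<mu> \<in> weak_succ r \<nu>" "r \<le> k"
  shows "l \<le> length \<mu>" "length \<mu> \<le> Suc l" "x \<in> set (take l \<mu>) \<Longrightarrow> t < x"
    "sum_list \<nu> \<le> sum_list \<mu>" "sum_list \<mu> \<le> sum_list \<nu> + r" "\<mu> \<in> bounded_partitions k"
proof -
  obtain T where T: "adm M T" "card (moved_classes M T) \<le> r" "\<mu> = shape (step M T)"
    "sum_list \<mu> = sum_list \<nu> + card (moved_classes M T)"
    using succ_elim[OF assms] by metis
  show "l \<le> length \<mu>" "length \<mu> \<le> Suc l" "x \<in> set (take l \<mu>) \<Longrightarrow> t < x"
    using rows(1,2,5)[OF T(1)] T(3) by (auto simp: Suc_le_eq)
  show "sum_list \<nu> \<le> sum_list \<mu>" "sum_list \<mu> \<le> sum_list \<nu> + r"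
    using T by simp_all
  show "\<mu> \<in> bounded_partitions k"
    using assms(1) by (simp add: weak_succ_def)
qed

text \<open>Class t is moved exactly if the moved initial segment, whose length is the new top row,
  reaches it. This turns the extra ascent of \<open>card_ascents_lift\<close> into a condition on
  the partition.\<close>

lemma T_at_t:
  assumes T: "adm M T"
  shows "T (int t) = int t \<longleftrightarrow> part (shape (step M T)) (Suc l) < t"
proof -
  define i where "i = part (shape (step M T)) (Suc l)"
  have Mt: "M (int t) = int t"
    using basedD(4)[OF b] t by simp
  show ?thesis
  proof (cases "i < t")
    case True
    then have "T (int i + 1) = int i + 1"
      using rows(4)[OF T] by (simp add: i_def)
    moreover have "M (int i + 1) = int i + 1"
      using basedD(4)[OF b] True by simp
    ultimately have "M (int t) = T (int t)"
      using prefix_unmoved[OF b T, of "int i + 1" "int t"] True by simp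
    then show ?thesis using True Mt by (simp add: i_def)
  next
    case False
    then have "M (int t) < T (int t)"
      using rows(3)[OF T, of "int t"] t by (simp add: i_def)
    then show ?thesis using False Mt by (simp add: i_def)
  qed
qed

lemma inc_step:
  assumes T: "adm M T" and i: "i = part (shape (step M T)) (Suc l)" "i < t"
  shows "adm M (raise (int i) T)" "shape (step M (raise (int i) T)) = inc l (shape (step M T))"
    "card (moved_classes M (raise (int i) T)) = Suc (card (moved_classes M T))"
    "ascents (raise (int i) T) = ascents T"
proof -
  have low: "M j = j \<and> M j < T j" if "1 \<le> j" "j \<le> int i" for j
    using rows(3)[OF T, of j] basedD(4)[OF b, of j] that i by simp
  have M1: "M (int i + 1) = int i + 1" "M (int i + 2) = int i + 2"
    using basedD(4)[OF b] i by simp_all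
  have T1: "T (int i + 1) = int i + 1"
    using rows(4)[OF T] i by simp
  have M2: "M (int i + 2) = T (int i + 2)"
    using prefix_unmoved[OF b T, of "int i + 1" "int i + 2"] M1 T1 i by simp
  note f = raise_facts[OF M basedD(3)[OF b] T _ low M1(1) T1 M2]
  have ik: "Suc i \<le> k" using i t by simp
  show adm: "adm M (raise (int i) T)"
    and "card (moved_classes M (raise (int i) T)) = Suc (card (moved_classes M T))"
    and "ascents (raise (int i) T) = ascents T"
    using f[OF ik] M1(2) by simp_all
  define \<mu> where "\<mu> = shape (step M T)"
  have \<mu>: "\<mu> \<in> bounded_partitions k"
    unfolding \<mu>_def by (rule shape_in[OF runner_step[OF M T]])
  have tl: "\<mu> = take l \<mu> @ (if i = 0 then [] else [i])"
    using take_append_last[OF _ _ zero_notin_bounded[OF \<mu>], of l] rows(1,2)[OF T]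
    unfolding i(1) \<mu>_def[symmetric] by blast
  have "mset (shape (step M (raise (int i) T))) = mset (inc l \<mu>)"
  proof -
    have "mset \<mu> = mset (take l \<mu>) + (if i = 0 then {#} else {#i#})"
      by (subst tl) simp
    moreover have "inc l \<mu> = take l \<mu> @ [Suc i]"
      unfolding inc_def i(1) \<mu>_def ..
    ultimately show ?thesis
      using f(3)[OF ik] unfolding \<mu>_def[symmetric] by simp
  qed
  moreover have "is_partition (inc l \<mu>)"
    unfolding inc_def
  proof (intro is_partition_snoc is_partition_take)
    show "is_partition \<mu>"
      using \<mu> by (simp add: bounded_partitions_def)
    show "Suc (part \<mu> (Suc l)) \<le> x" if "x \<in> set (take l \<mu>)" for x
      using rows(5)[OF T, of x] that i unfolding \<mu>_def by linarith
  qed simp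
  ultimately show "shape (step M (raise (int i) T)) = inc l (shape (step M T))"
    using shape_in[OF runner_step[OF M adm]] by (intro partition_eqI) (auto simp: bounded_partitions_def \<mu>_def)
qed

lemma inc_succ:
  assumes \<mu>: "\<mu> \<in> weak_succ r \<nu>" and r: "r \<le> k" and i: "part \<mu> (Suc l) < t" and s: "sum_list \<mu> < sum_list \<nu> + r"
  shows "inc l \<mu> \<in> weak_succ r \<nu>" "num_res (inc l \<mu>) \<nu> = num_res \<mu> \<nu>"
    "sum_list (inc l \<mu>) = Suc (sum_list \<mu>)"
proof -
  obtain T where T: "adm M T" "\<mu> = shape (step M T)"
    "sum_list \<mu> = sum_list \<nu> + card (moved_classes M T)" "num_res \<mu> \<nu> = card (ascents T)"
    using succ_elim[OF \<mu> r] by metis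
  note f = inc_step[OF T(1) refl i[unfolded T(2)], folded T(2)]
  show "inc l \<mu> \<in> weak_succ r \<nu>"
    using succ_intro[OF f(1) _ r] f(2,3) T(3) s by simp
  show "num_res (inc l \<mu>) \<nu> = num_res \<mu> \<nu>" "sum_list (inc l \<mu>) = Suc (sum_list \<mu>)"
    using shape_step(3,4)[OF M f(1)] f(2,3,4) T(3,4) sh by simp_all
qed

lemma dec_succ:
  assumes \<mu>: "\<mu> \<in> weak_succ r \<nu>" and r: "r \<le> k" and i: "1 \<le> part \<mu> (Suc l)" "part \<mu> (Suc l) \<le> t"
  shows "\<exists>\<mu>'\<in>weak_succ r \<nu>. part \<mu>' (Suc l) < t \<and> sum_list \<mu>' < sum_list \<nu> + r \<and> \<mu> = inc l \<mu>'"
proof -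
  obtain T where T: "adm M T" "card (moved_classes M T) \<le> r" "\<mu> = shape (step M T)"
    using succ_elim[OF \<mu> r] by metis
  have rT: "runner T" by (rule admD[OF T(1)])
  define i where "i = part \<mu> (Suc l)"
  have i: "1 \<le> i" "i \<le> t" using i by (simp_all add: i_def)
  have moved: "M j < T j" if "1 \<le> j" "j \<le> int i" for j
    using rows(3)[OF T(1), of j] that T(3) by (simp add: i_def)
  have T1: "T (int i + 1) = int i + 1"
    using rows(4)[OF T(1)] i T(3) by (simp add: i_def)
  \<comment> \<open>Class \<open>i\<close> ends the moved initial segment and class
    \<open>i + 1\<close> is not moved, so no moved class depends on class \<open>i\<close>. Putting
    it back gives an admissible runner from which \<open>raise\<close> recovers
    \<open>T\<close>.\<close>
  define T' where "T' = (\<lambda>y. if y mod n = int i mod n then M y else T y)"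
  have adm': "adm M T'"
    unfolding adm_def
  proof (intro conjI allI impI)
    show "runner T'"
      unfolding runner_def
    proof (intro conjI allI)
      fix y
      show "T' y mod n = y mod n"
        by (simp add: T'_def runner_mod[OF M] runner_mod[OF rT])
      have "M (y mod n) = M y" "T (y mod n) = T y"
        using M rT by (simp_all add: runner_def)
      then show "T' (y mod n) = T' y"
        by (simp only: T'_def mod_mod_trivial)
    qed
    fix y
    show "M y \<le> T' y" using admD(2)[OF T(1), of y] by (simp add: T'_def)
    assume m: "M y < T' y"
    then have y: "y mod n \<noteq> int i mod n" by (auto simp: T'_def)
    have "(y - 1) mod n \<noteq> int i mod n"
    proof
      assume "(y - 1) mod n = int i mod n"
      then have ymod: "y mod n = (int i + 1) mod n"
        using mod_add_one_cong[of "y - 1" "int i" 1] by simp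
      then have "T y = int i + 1" "M y = int i + 1"
        using runner_cong[OF rT ymod] runner_cong[OF M ymod] T1 basedD(4)[OF b, of "int i + 1"] i by simp_all
      then show False using m y by (simp add: T'_def)
    qed
    then show "T' y = T' (y - 1) + 1"
      using m y admD(3)[OF T(1), of y] by (simp add: T'_def)
  qed
  define i' where "i' = part (shape (step M T')) (Suc l)"
  have T'i: "T' (int i) = M (int i)" by (simp add: T'_def)
  have "i' < i"
  proof (rule ccontr)
    assume "\<not> i' < i"
    then show False
      using rows(3)[OF adm', of "int i"] T'i i by (simp add: i'_def)
  qed
  moreover have "\<not> Suc i' < i"
  proof
    assume c: "Suc i' < i"
    then have "T' (int i' + 1) = int i' + 1"
      using rows(4)[OF adm'] i by (simp add: i'_def)
    moreover have "(int i' + 1) mod n \<noteq> int i mod n"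
      using c i t by (simp add: n_def)
    ultimately show False
      using moved[of "int i' + 1"] c basedD(4)[OF b, of "int i' + 1"] i by (simp add: T'_def)
  qed
  ultimately have ii': "i = Suc i'" by simp
  have "raise (int i') T' = T"
  proof
    fix y
    have ne: "int i' mod n \<noteq> int i mod n"
      using Suc_mod_neq[of "int i'"] ii' by (simp add: add.commute)
    show "raise (int i') T' y = T y"
    proof (cases "y mod n = int i mod n")
      case True
      have "T (int i) = T (int i - 1) + 1"
        using admD(3)[OF T(1) moved[of "int i"]] i by simp
      then show ?thesis
        using True ne runner_cong[OF rT True] ii' by (simp add: raise_def T'_def add.commute)
    qed (use ii' in \<open>simp add: raise_def T'_def add.commute\<close>)
  qed
  moreover have "i' < t" using ii' i by simp
  note f = inc_step[OF adm' i'_def this]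
  ultimately have "\<mu> = inc l (shape (step M T'))" and c: "card (moved_classes M T) = Suc (card (moved_classes M T'))"
    using f(2,3) T(3) by simp_all
  moreover have "shape (step M T') \<in> weak_succ r \<nu>"
    using c T(2) by (intro succ_intro adm' r) simp
  moreover have "sum_list (shape (step M T')) < sum_list \<nu> + r"
    using shape_step(3)[OF M adm'] sh c T(2) by simp
  ultimately show ?thesis
    using \<open>i' < t\<close> unfolding i'_def by blast
qed

end

section \<open>The strip consisting of one new row\<close>

context k_bound begin

lemma adm_refl: "runner M \<Longrightarrow> adm M M" "step M M = M" "moved_classes M M = {}"
  by (auto simp: adm_def step_def moved_classes_def)

text \<open>Class 0 lies just before the block of classes 1 to \<open>s\<close>, so its largest bead
  \<open>M 0\<close> is the one carried along.\<close>

definition row_strip :: "(int \<Rightarrow> int) \<Rightarrow> nat \<Rightarrow> int \<Rightarrow> int" where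
  "row_strip M s y = (if 1 \<le> y mod n \<and> y mod n \<le> int s then M 0 + y mod n else M y)"

lemma row_strip_facts:
  assumes b: "based M r" and r: "r \<le> k" and s: "s \<le> r"
  shows "adm M (row_strip M s) \<and> card (moved_classes M (row_strip M s)) = s \<and>
    mset (shape (step M (row_strip M s))) = mset (shape M) + (if s = 0 then {#} else {#s#})"
  using s
proof (induction s)
  case 0
  have "row_strip M 0 = M"
    by (rule ext) (auto simp: row_strip_def)
  then show ?case
    using adm_refl(1)[OF basedD(1)[OF b]] adm_refl(2,3) by simp
next
  case (Suc s)
  note IH = Suc.IH[OF Suc_leD[OF Suc.prems]]
  have M: "runner M" by (rule basedD[OF b])
  have small: "(int j) mod n = int j" if "j \<le> k" for j
    using that by (simp add: n_def)
  have s1: "(int s + 1) mod n = int s + 1"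
    using small[of "Suc s"] Suc.prems r by (simp add: add.commute)
  have raise: "raise (int s) (row_strip M s) = row_strip M (Suc s)"
  proof
    fix y
    have "row_strip M s (int s) = M 0 + int s"
      using small[of s] Suc.prems r by (cases "s = 0") (simp_all add: row_strip_def)
    then show "raise (int s) (row_strip M s) y = row_strip M (Suc s) y"
      unfolding raise_def s1 by (auto simp: row_strip_def)
  qed
  have low: "M j = j \<and> M j < row_strip M s j" if "1 \<le> j" "j \<le> int s" for j
    using that basedD(3)[OF b, of 0] basedD(4)[OF b, of j] small[of "nat j"] Suc.prems r
    by (simp add: row_strip_def)
  have i1: "M (int s + 1) = int s + 1" "row_strip M s (int s + 1) = int s + 1"
    using basedD(4)[OF b, of "int s + 1"] Suc.prems s1 by (simp_all add: row_strip_def)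
  have i2: "M (int s + 2) = row_strip M s (int s + 2)"
  \<comment> \<open>For \<open>s + 2 = n\<close> the class in question is class 0, which
    \<open>row_strip\<close> does not move either.\<close>
  proof (cases "int s + 2 = n")
    case True
    then show ?thesis by (simp add: row_strip_def)
  next
    case False
    then have "(int s + 2) mod n = int s + 2"
      using Suc.prems r by (intro mod_pos_pos_trivial) (auto simp: n_def)
    then show ?thesis by (simp add: row_strip_def)
  qed
  note f = raise_facts[OF M basedD(3)[OF b] conjunct1[OF IH] _ low i1 i2, unfolded raise]
  have sk: "Suc s \<le> k" using Suc.prems r by simp
  show ?case
    using f(1,2,3)[OF sk] IH by (auto split: if_splits)
qed

text \<open>A top row of length at least r moves the classes 1 to r. This exhausts the allowed r
  moved classes, and admissibility then fixes all values of \<open>T\<close>. The resulting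
  uniqueness is the triangularity of the Pieri rule.\<close>

lemma snoc_weak_succ:
  assumes \<nu>: "\<nu> \<in> bounded_partitions k" and r: "1 \<le> r" "r \<le> k" and ge: "\<And>x. x \<in> set \<nu> \<Longrightarrow> r \<le> x"
  shows "\<nu> @ [r] \<in> weak_succ r \<nu>"
    and "\<mu> \<in> weak_succ r \<nu> \<Longrightarrow> r \<le> part \<mu> (Suc (length \<nu>)) \<Longrightarrow> \<mu> = \<nu> @ [r]"
proof -
  obtain M where b: "based M r" and sh: "shape M = \<nu>"
    and bel: "below M = beads (int (length \<nu>) + 1 + n) (bounded_to_core k \<nu>)"
    and prt: "\<And>i. 1 \<le> i \<Longrightarrow> i \<le> length \<nu> \<Longrightarrow> r \<le> part (bounded_to_core k \<nu>) i"
    using exists_based[OF \<nu> ge] r by (metis le_SucI)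
  have M: "runner M" by (rule basedD[OF b])
  note f = row_strip_facts[OF b r(2) order_refl]
  have adm: "adm M (row_strip M r)" using f by blast
  have part: "is_partition (\<nu> @ [r])"
    using \<nu> ge r by (intro is_partition_snoc) (auto simp: bounded_partitions_def)
  have eq: "shape (step M (row_strip M r)) = \<nu> @ [r]"
    using f r(1) sh shape_in[OF runner_step[OF M adm]]
    by (intro partition_eqI part) (auto simp: bounded_partitions_def)
  show "\<nu> @ [r] \<in> weak_succ r \<nu>"
    using weak_succ_shape[OF M r(2)] sh eq f by (auto intro!: image_eqI[of _ _ "row_strip M r"])
  show "\<mu> = \<nu> @ [r]" if \<mu>: "\<mu> \<in> weak_succ r \<nu>" and p: "r \<le> part \<mu> (Suc (length \<nu>))"
  proof -
    obtain T where T: "adm M T" "card (moved_classes M T) \<le> r" "\<mu> = shape (step M T)"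
      using \<mu> weak_succ_shape[OF M r(2)] sh by auto
    have rT: "runner T" by (rule admD[OF T(1)])
    have moved: "M j < T j" if "1 \<le> j" "j \<le> int r" for j
    proof (rule step_rows(3)[OF \<nu> b sh bel _ _ T(1)])
      show "j \<le> int (part (shape (step M T)) (Suc (length \<nu>)))"
        using that p T(3) by simp
    qed (use prt r that in auto)
    then have "{1..int r} \<subseteq> moved_classes M T"
      using r by (auto simp: moved_classes_def n_def)
    then have cls: "{1..int r} = moved_classes M T"
      using T(2) by (intro card_seteq) (auto simp: moved_classes_def)
    have unm: "T j = M j" if "0 \<le> j" "j < n" "j \<notin> {1..int r}" for j
      using that admD(2)[OF T(1), of j] unfolding cls by (auto simp: moved_classes_def)
    have row: "T (int j) = M 0 + int j" if "j \<le> r" for j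
      using that
    proof (induction j)
      case 0
      then show ?case using unm[of 0] n_pos by simp
    next
      case (Suc j)
      then show ?case
        using admD(3)[OF T(1) moved[of "int (Suc j)"]] by simp
    qed
    have "T = row_strip M r"
    proof
      fix y
      have T': "T y = T (y mod n)" "M y = M (y mod n)"
        using M rT by (simp_all add: runner_def)
      show "T y = row_strip M r y"
      proof (cases "1 \<le> y mod n \<and> y mod n \<le> int r")
        case True
        then show ?thesis
          using row[of "nat (y mod n)"] T' by (simp add: row_strip_def nat_le_iff)
      next
        case False
        then have "T (y mod n) = M (y mod n)"
          using n_pos by (intro unm) auto
        then show ?thesis using T' False by (auto simp: row_strip_def)
      qed
    qed
    then show ?thesis using T(3) eq by simp
  qed
qed

section \<open>Unions of rectangles and their weak successors\<close>

lemma mset_Union_parts: "mset (Union_parts \<nu>s) = sum_list (map mset \<nu>s)"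
  unfolding Union_parts_def by (induction \<nu>s) (simp_all add: mset_part_union)

lemma is_partition_Union_parts: "(\<And>\<nu>. \<nu> \<in> set \<nu>s \<Longrightarrow> is_partition \<nu>) \<Longrightarrow> is_partition (Union_parts \<nu>s)"
  unfolding Union_parts_def
  by (induction \<nu>s) (auto intro: is_partition_part_union simp: is_partition_def[of "[]"])

lemma mset_rect_power: "mset (rect_power k t a) = replicate_mset (a * (Suc k - t)) t"
proof -
  have "sum_list (replicate a (replicate_mset m t)) = replicate_mset (a * m) t" for m
    by (induction a) (auto intro!: multiset_eqI)
  then show ?thesis
    by (simp add: rect_power_def mset_Union_parts rect_def)
qed

lemma part_union_in:
  "\<nu> \<in> bounded_partitions k \<Longrightarrow> \<mu> \<in> bounded_partitions k \<Longrightarrow> part_union \<nu> \<mu> \<in> bounded_partitions k"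
  using is_partition_part_union[of \<nu> \<mu>] mset_part_union[of \<nu> \<mu>, THEN arg_cong[where f = set_mset]]
  by (auto simp: bounded_partitions_def)

lemma rect_power_in:
  assumes "1 \<le> t" "t \<le> k"
  shows "rect_power k t a \<in> bounded_partitions k"
proof -
  have "is_partition (rect k t)"
    using assms by (auto simp: is_partition_def rect_def sorted_wrt_iff_nth_less)
  then have "is_partition (rect_power k t a)"
    unfolding rect_power_def by (intro is_partition_Union_parts) auto
  moreover have "set (rect_power k t a) \<subseteq> {t}"
    using mset_rect_power[of t a, THEN arg_cong[where f = set_mset]] by (auto split: if_splits)
  ultimately show ?thesis
    using assms by (auto simp: bounded_partitions_def)
qed

lemma part_union_eqI:
  assumes "\<rho> \<in> bounded_partitions k" "\<nu> \<in> bounded_partitions k" "\<mu> \<in> bounded_partitions k"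
    "mset \<rho> = mset \<nu> + mset \<mu>"
  shows "\<rho> = part_union \<nu> \<mu>"
  using assms part_union_in[OF assms(2,3)]
  by (intro partition_eqI) (auto simp: bounded_partitions_def mset_part_union)

end

context strip_setting begin

text \<open>The lift is a bijection between the admissible runners over \<open>M\<close> and over
  its lift, preserves moved classes and commutes with the step up to the choice of the cut. The
  extra residue is that of \<open>card_ascents_lift\<close>, read off the top row by
  \<open>T_at_t\<close>.\<close>

lemma weak_succ_part_union:
  fixes a :: nat
  assumes a: "1 \<le> a" and r: "r \<le> k"
  defines "P \<equiv> rect_power k t a"
  shows "weak_succ r (part_union P \<nu>) = part_union P ` weak_succ r \<nu>"
    and "\<mu> \<in> weak_succ r \<nu> \<Longrightarrow>
      num_res (part_union P \<mu>) (part_union P \<nu>) = num_res \<mu> \<nu> + of_bool (part \<mu> (Suc l) < t)"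
proof -
  define L where "L = lift (int t) a M"
  have L: "runner L" unfolding L_def by (rule runner_lift[OF M])
  have P: "P \<in> bounded_partitions k"
    unfolding P_def by (rule rect_power_in[OF t])
  have U: "shape (lift \<theta> a N) = part_union P (shape N)"
    if "runner N" "card {r \<in> {0..<n}. N r \<le> \<theta>} = t" for N \<theta>
    using mset_shape_lift[OF that t(1), of a]
    by (intro part_union_eqI shape_in runner_lift that P) (simp add: P_def mset_rect_power add.commute)
  have "card {r \<in> {0..<n}. M r \<le> int t} = t"
    using card_low_based[OF based_mono[OF b]] t by simp
  then have shL: "shape L = part_union P \<nu>"
    unfolding L_def sh[symmetric] by (rule U[OF M])
  have lifted: "adm L (lift (int t) a T)" "moved_classes L (lift (int t) a T) = moved_classes M T"
    "shape (step L (lift (int t) a T)) = part_union P (shape (step M T))"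
    "card (ascents (lift (int t) a T)) = card (ascents T) + of_bool (part (shape (step M T)) (Suc l) < t)"
    if T: "adm M T" for T
    unfolding L_def
    using adm_lift[OF b a T] step_lift(1)[OF b t(1) a T] U[OF runner_step[OF M T] card_low_step[OF b t T]]
      card_ascents_lift[OF b t a T] T_at_t[OF T] by simp_all
  have Ts: "{T'. adm L T' \<and> card (moved_classes L T') \<le> r} =
      lift (int t) a ` {T. adm M T \<and> card (moved_classes M T) \<le> r}"
  proof (intro set_eqI iffI)
    fix T' assume T': "T' \<in> {T'. adm L T' \<and> card (moved_classes L T') \<le> r}"
    then obtain T where "adm M T" "T' = lift (int t) a T"
      using lift_adm_imp[OF b a, of T'] by (auto simp: L_def)
    then show "T' \<in> lift (int t) a ` {T. adm M T \<and> card (moved_classes M T) \<le> r}"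
      using lifted(2)[of T] T' by auto
  qed (use lifted in auto)
  show "weak_succ r (part_union P \<nu>) = part_union P ` weak_succ r \<nu>"
    unfolding shL[symmetric] weak_succ_shape[OF L r] Ts image_image
    unfolding sh[symmetric] weak_succ_shape[OF M r] image_image
    by (rule image_cong) (use lifted(3) in auto)
  show "num_res (part_union P \<mu>) (part_union P \<nu>) = num_res \<mu> \<nu> + of_bool (part \<mu> (Suc l) < t)"
    if \<mu>: "\<mu> \<in> weak_succ r \<nu>"
  proof -
    obtain T where T: "adm M T" "\<mu> = shape (step M T)" "num_res \<mu> \<nu> = card (ascents T)"
      using succ_elim[OF \<mu> r] by metis
    have "num_res (shape (step L (lift (int t) a T))) (shape L) = card (ascents (lift (int t) a T))"
      by (rule shape_step(4)[OF L lifted(1)[OF T(1)]])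
    then show ?thesis
      using lifted(3,4)[OF T(1)] shL T by simp
  qed
qed

end

section \<open>The Pieri rule and the factorization\<close>

context k_bound begin

lemma finite_bounded_sum:
  "finite {\<mu> \<in> bounded_partitions k. sum_list \<mu> \<le> N}"
proof (rule finite_subset)
  have "length \<mu> \<le> sum_list \<mu>" if "\<mu> \<in> bounded_partitions k" for \<mu>
    using that by (induction \<mu>) (auto simp: bounded_partitions_def is_partition_def)
  then show "{\<mu> \<in> bounded_partitions k. sum_list \<mu> \<le> N} \<subseteq> {\<mu>. set \<mu> \<subseteq> {..k} \<and> length \<mu> \<le> N}"
    by (force simp: bounded_partitions_def)
qed (rule finite_lists_length_le, simp)

lemma weak_succ_sum:
  assumes "\<mu> \<in> weak_succ r \<nu>" "\<nu> \<in> bounded_partitions k"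
  shows "\<mu> \<in> bounded_partitions k" "sum_list \<nu> \<le> sum_list \<mu>" "sum_list \<mu> \<le> sum_list \<nu> + r"
  using assms weak_strip_sum[of \<mu> \<nu>] by (auto simp: weak_succ_def)

lemma finite_weak_succ: "\<nu> \<in> bounded_partitions k \<Longrightarrow> finite (weak_succ r \<nu>)"
  by (rule finite_subset[OF _ finite_bounded_sum[of "sum_list \<nu> + r"]]) (auto dest: weak_succ_sum)

definition pieri_coeff :: "nat \<Rightarrow> nat \<Rightarrow> symfun" where
  "pieri_coeff m j = (- 1) ^ j * of_nat (m choose j)"

lemma pieri_coeff_0 [simp]: "pieri_coeff m 0 = 1"
  by (simp add: pieri_coeff_def)

lemma pieri_coeff_Suc: "pieri_coeff (Suc m) (Suc j) = pieri_coeff m (Suc j) - pieri_coeff m j"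
  by (simp add: pieri_coeff_def algebra_simps)

text \<open>The strip size s is the difference of the two sizes, so the double sum collapses into
  one sum over \<open>weak_succ\<close>.\<close>

lemma pieri:
  assumes g: "is_K_k_Schur k g" and \<nu>: "\<nu> \<in> bounded_partitions k" and r: "r \<le> k"
  shows "hsym r * g \<nu> = (\<Sum>\<mu>\<in>weak_succ r \<nu>. pieri_coeff (num_res \<mu> \<nu>) (sum_list \<nu> + r - sum_list \<mu>) * g \<mu>)"
proof -
  let ?W = "\<lambda>s. {\<mu> \<in> bounded_partitions k. weak_strip k s (bounded_to_core k \<mu>) (bounded_to_core k \<nu>)}"
  let ?f = "\<lambda>\<mu>. pieri_coeff (num_res \<mu> \<nu>) (sum_list \<nu> + r - sum_list \<mu>) * g \<mu>"
  have W: "?W s = {\<mu> \<in> weak_succ r \<nu>. sum_list \<mu> - sum_list \<nu> = s}" if "s \<le> r" for s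
    using that weak_strip_sum[OF _ \<nu>] by (auto simp: weak_succ_def)
  have "hsym r * g \<nu> = (\<Sum>s=0..r. (- 1) ^ (r - s) *
      (\<Sum>\<mu>\<in>?W s. of_nat (num_residues k (bounded_to_core k \<mu>) (bounded_to_core k \<nu>) choose (r - s)) * g \<mu>))"
    using g \<nu> r unfolding is_K_k_Schur_def by blast
  also have "\<dots> = (\<Sum>s=0..r. \<Sum>\<mu>\<in>?W s. ?f \<mu>)"
  proof (rule sum.cong[OF refl])
    fix s assume "s \<in> {0..r}"
    have "sum_list \<nu> + r - sum_list \<mu> = r - s" if "\<mu> \<in> ?W s" for \<mu>
      using weak_strip_sum[OF _ \<nu>, of \<mu> s] that by simp
    then show "(- 1) ^ (r - s) * (\<Sum>\<mu>\<in>?W s. of_nat (num_residues k (bounded_to_core k \<mu>) (bounded_to_core k \<nu>)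
        choose (r - s)) * g \<mu>) = (\<Sum>\<mu>\<in>?W s. ?f \<mu>)"
      unfolding sum_distrib_left by (intro sum.cong) (simp_all add: pieri_coeff_def num_res_def mult.assoc)
  qed
  also have "\<dots> = (\<Sum>s=0..r. \<Sum>\<mu>\<in>{\<mu> \<in> weak_succ r \<nu>. sum_list \<mu> - sum_list \<nu> = s}. ?f \<mu>)"
    using W by (intro sum.cong) auto
  also have "\<dots> = (\<Sum>\<mu>\<in>weak_succ r \<nu>. ?f \<mu>)"
    using finite_weak_succ[OF \<nu>] weak_succ_sum[OF _ \<nu>] by (intro sum.group) force+
  finally show ?thesis .
qed

definition dec :: "nat list \<Rightarrow> nat list" where
  "dec \<mu> = butlast \<mu> @ (if last \<mu> = 1 then [] else [last \<mu> - 1])"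

lemma dec_inc:
  assumes "l \<le> length \<mu>" "length \<mu> \<le> Suc l" "0 \<notin> set \<mu>"
  shows "dec (inc l \<mu>) = \<mu>"
proof -
  have "dec (inc l \<mu>) = take l \<mu> @ (if part \<mu> (Suc l) = 0 then [] else [part \<mu> (Suc l)])"
    by (simp add: dec_def inc_def butlast_append)
  then show ?thesis
    using take_append_last[OF assms(2,1,3)] by simp
qed

text \<open>
  The combination of the functions \<open>g (part_union P \<mu>)\<close> that obeys the Pieri rule of the \<open>g \<mu>\<close>:
  the extra factor \<open>1 - z\<close> that a short top row of \<open>\<mu>\<close> causes in the generating function of
  the coefficients is absorbed by Pascal's rule.
\<close>

definition corrected :: "nat \<Rightarrow> nat list \<Rightarrow> (nat list \<Rightarrow> symfun) \<Rightarrow> nat list \<Rightarrow> symfun" where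
  "corrected t P g \<mu> = g (part_union P \<mu>) -
     (if \<mu> \<noteq> [] \<and> last \<mu> \<le> t then g (part_union P (dec \<mu>)) else 0)"

end

context strip_setting begin

text \<open>The first l parts of a weak successor exceed t, so a last part of at most t can only be
  row l + 1.\<close>

lemma last_le_iff:
  assumes "\<mu> \<in> weak_succ r \<nu>" "r \<le> k"
  shows "\<mu> \<noteq> [] \<and> last \<mu> \<le> t \<longleftrightarrow> 1 \<le> part \<mu> (Suc l) \<and> part \<mu> (Suc l) \<le> t"
proof (cases "length \<mu> = Suc l")
  case True
  then have "last \<mu> = part \<mu> (Suc l)" "\<mu> \<noteq> []"
    by (cases \<mu> rule: rev_cases; simp add: part_def nth_append)+
  moreover from this have "last \<mu> \<noteq> 0"
    using zero_notin_bounded[OF succ_rows(6)[OF assms]] last_in_set by metis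
  ultimately show ?thesis by simp
next
  case False
  then have "length \<mu> = l"
    using succ_rows(1,2)[OF assms] by simp
  then show ?thesis
    using succ_rows(3)[OF assms, of "last \<mu>"] by (auto simp: part_def)
qed

text \<open>A top row shorter than t makes the residue count of the lifted strip larger by one.
  Pascal's rule splits the coefficient, and the surplus is the correction term of the partition with
  this row lengthened by one cell.\<close>

lemma pieri_corrected:
  fixes a :: nat
  assumes g: "is_K_k_Schur k g" and a: "1 \<le> a" and r: "r \<le> k"
  defines "P \<equiv> rect_power k t a"
  shows "hsym r * g (part_union P \<nu>) = (\<Sum>\<mu>\<in>weak_succ r \<nu>.
    pieri_coeff (num_res \<mu> \<nu>) (sum_list \<nu> + r - sum_list \<mu>) * corrected t P g \<mu>)"
proof -
  have P: "P \<in> bounded_partitions k"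
    unfolding P_def by (rule rect_power_in[OF t])
  let ?W = "weak_succ r \<nu>"
  let ?U = "part_union P"
  let ?c = "\<lambda>\<mu>. pieri_coeff (num_res \<mu> \<nu>) (sum_list \<nu> + r - sum_list \<mu>)"
  have fin: "finite ?W" by (rule finite_weak_succ[OF \<nu>])
  have bnd: "\<mu> \<in> bounded_partitions k" if "\<mu> \<in> ?W" for \<mu>
    using succ_rows(6)[OF that r] .
  have sumU: "sum_list (?U \<mu>) = sum_list P + sum_list \<mu>" for \<mu>
    using mset_part_union[of P \<mu>, THEN arg_cong[where f = sum_mset]] by (simp add: sum_mset_sum_list)
  have injU: "inj_on ?U ?W"
  proof (rule inj_onI)
    fix x y assume xy: "x \<in> ?W" "y \<in> ?W" "?U x = ?U y"
    then have "mset x = mset y"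
      using mset_part_union[of P x] mset_part_union[of P y] by simp
    then show "x = y"
      using bnd xy by (intro partition_eqI) (auto simp: bounded_partitions_def)
  qed
  \<comment> \<open>The condition on the sizes leaves out the coefficients with lower index 0, for
    which Pascal's rule has no second term.\<close>
  let ?A = "{\<mu> \<in> ?W. part \<mu> (Suc l) < t \<and> sum_list \<mu> < sum_list \<nu> + r}"
  let ?B = "{\<mu> \<in> ?W. \<mu> \<noteq> [] \<and> last \<mu> \<le> t}"
  have coeff: "pieri_coeff (num_res (?U \<mu>) (?U \<nu>)) (sum_list (?U \<nu>) + r - sum_list (?U \<mu>)) =
      ?c \<mu> - (if \<mu> \<in> ?A then pieri_coeff (num_res \<mu> \<nu>) (sum_list \<nu> + r - Suc (sum_list \<mu>)) else 0)"
    if \<mu>: "\<mu> \<in> ?W" for \<mu>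
  proof -
    have n: "num_res (?U \<mu>) (?U \<nu>) = num_res \<mu> \<nu> + of_bool (part \<mu> (Suc l) < t)"
      unfolding P_def by (rule weak_succ_part_union(2)[OF a r \<mu>])
    have s: "sum_list (?U \<nu>) + r - sum_list (?U \<mu>) = sum_list \<nu> + r - sum_list \<mu>"
      by (simp add: sumU)
    show ?thesis
    proof (cases "part \<mu> (Suc l) < t")
      case True
      show ?thesis
      proof (cases "sum_list \<mu> < sum_list \<nu> + r")
        case lt: True
        then have "sum_list \<nu> + r - sum_list \<mu> = Suc (sum_list \<nu> + r - Suc (sum_list \<mu>))"
          by simp
        then show ?thesis
          unfolding n s using True lt \<mu> by (simp add: pieri_coeff_Suc)
      next
        case False
        then show ?thesis unfolding n s by simp
      qed
    qed (simp add: n s)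
  qed
  have "hsym r * g (?U \<nu>) = (\<Sum>\<mu>\<in>?U ` ?W. pieri_coeff (num_res \<mu> (?U \<nu>)) (sum_list (?U \<nu>) + r - sum_list \<mu>) * g \<mu>)"
    using pieri[OF g part_union_in[OF P \<nu>] r] weak_succ_part_union(1)[OF a r] by (simp add: P_def)
  also have "\<dots> = (\<Sum>\<mu>\<in>?W. pieri_coeff (num_res (?U \<mu>) (?U \<nu>)) (sum_list (?U \<nu>) + r - sum_list (?U \<mu>)) * g (?U \<mu>))"
    by (simp add: sum.reindex[OF injU])
  also have "\<dots> = (\<Sum>\<mu>\<in>?W. ?c \<mu> * g (?U \<mu>) -
      (if \<mu> \<in> ?A then pieri_coeff (num_res \<mu> \<nu>) (sum_list \<nu> + r - Suc (sum_list \<mu>)) * g (?U \<mu>) else 0))"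
    by (rule sum.cong[OF refl]) (simp only: coeff, simp add: algebra_simps)
  also have "\<dots> = (\<Sum>\<mu>\<in>?W. ?c \<mu> * g (?U \<mu>)) -
      (\<Sum>\<mu>\<in>?A. pieri_coeff (num_res \<mu> \<nu>) (sum_list \<nu> + r - Suc (sum_list \<mu>)) * g (?U \<mu>))"
    unfolding sum_subtractf using fin by (simp add: sum.inter_filter[symmetric])
  \<comment> \<open>\<open>inc l\<close> maps \<open>?A\<close> onto \<open>?B\<close> with inverse
    \<open>dec\<close>. It keeps the residue count and raises the size by one, so the surplus
    coefficient of \<mu> is the ordinary coefficient of \<open>inc l \<mu>\<close>.\<close>
  also have "(\<Sum>\<mu>\<in>?A. pieri_coeff (num_res \<mu> \<nu>) (sum_list \<nu> + r - Suc (sum_list \<mu>)) * g (?U \<mu>)) =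
      (\<Sum>\<mu>\<in>?B. ?c \<mu> * g (?U (dec \<mu>)))"
  proof (rule sum.reindex_bij_witness[of _ dec "inc l"])
    fix \<mu> assume "\<mu> \<in> ?A"
    then have \<mu>: "\<mu> \<in> ?W" "part \<mu> (Suc l) < t" "sum_list \<mu> < sum_list \<nu> + r" by auto
    note f = inc_succ[OF \<mu>(1) r \<mu>(2,3)]
    show di: "dec (inc l \<mu>) = \<mu>"
      using succ_rows(1,2)[OF \<mu>(1) r] zero_notin_bounded[OF bnd[OF \<mu>(1)]] by (rule dec_inc)
    show "inc l \<mu> \<in> ?B"
      using f(1) \<mu>(2) by (simp add: inc_def)
    show "?c (inc l \<mu>) * g (?U (dec (inc l \<mu>))) =
        pieri_coeff (num_res \<mu> \<nu>) (sum_list \<nu> + r - Suc (sum_list \<mu>)) * g (?U \<mu>)"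
      using f(2,3) di by simp
  next
    fix \<mu> assume "\<mu> \<in> ?B"
    then have \<mu>: "\<mu> \<in> ?W" "1 \<le> part \<mu> (Suc l)" "part \<mu> (Suc l) \<le> t"
      using last_le_iff r by auto
    obtain \<mu>' where \<mu>': "\<mu>' \<in> ?A" "\<mu> = inc l \<mu>'"
      using dec_succ[OF \<mu>(1) r \<mu>(2,3)] by blast
    have "dec (inc l \<mu>') = \<mu>'"
      using succ_rows(1,2)[of \<mu>' r] zero_notin_bounded[OF bnd[of \<mu>']] r \<mu>' by (intro dec_inc) auto
    then show "dec \<mu> \<in> ?A" "inc l (dec \<mu>) = \<mu>"
      using \<mu>' by simp_all
  qed
  also have "(\<Sum>\<mu>\<in>?W. ?c \<mu> * g (?U \<mu>)) - (\<Sum>\<mu>\<in>?B. ?c \<mu> * g (?U (dec \<mu>))) =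
      (\<Sum>\<mu>\<in>?W. ?c \<mu> * corrected t P g \<mu>)"
  proof -
    have "(\<Sum>\<mu>\<in>?B. ?c \<mu> * g (?U (dec \<mu>))) =
        (\<Sum>\<mu>\<in>?W. if \<mu> \<noteq> [] \<and> last \<mu> \<le> t then ?c \<mu> * g (?U (dec \<mu>)) else 0)"
      by (rule sum.inter_filter[OF fin])
    then show ?thesis
      by (simp add: sum_subtractf[symmetric])
        (intro sum.cong refl, simp add: corrected_def algebra_simps)
  qed
  finally show ?thesis .
qed

end

section \<open>Induction along the triangular Pieri rule\<close>

context k_bound begin

lemma butlast_bounded: "\<mu> \<in> bounded_partitions k \<Longrightarrow> butlast \<mu> \<in> bounded_partitions k"
  by (cases \<mu> rule: rev_cases) (auto simp: bounded_partitions_def is_partition_def sorted_wrt_append)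

lemma exists_strip_setting:
  assumes "1 \<le> t" "t \<le> k" "\<nu> \<in> bounded_partitions k" "\<And>x. x \<in> set \<nu> \<Longrightarrow> t < x"
  shows "\<exists>M. strip_setting k t \<nu> M"
proof -
  have ge: "Suc t \<le> x" if "x \<in> set \<nu>" for x
    using assms(4)[OF that] by simp
  have "Suc t \<le> Suc k" using assms by simp
  from exists_based[OF assms(3) ge this] obtain M where
    "based M (Suc t)" "shape M = \<nu>" "below M = beads (int (length \<nu>) + 1 + n) (bounded_to_core k \<nu>)"
    "\<And>i. 1 \<le> i \<Longrightarrow> i \<le> length \<nu> \<Longrightarrow> Suc t \<le> part (bounded_to_core k \<nu>) i"
    by metis
  then show ?thesis
    using assms by (intro exI[of _ M]) (unfold_locales, auto)
qed

text \<open>Split off the last part r of \<mu> and apply the Pieri rule for \<open>hsym r\<close> to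
  the remaining \<nu>. In it \<mu> has coefficient 1, and every other successor is smaller than
  \<mu> in size, or has the same size and fewer rows, or agrees in both and has a shorter last row;
  this is the order given by \<open>measures\<close>.\<close>

lemma corrected_eq:
  fixes a :: nat
  assumes g: "is_K_k_Schur k g" and t: "1 \<le> t" "t \<le> k" and a: "1 \<le> a"
    and \<mu>: "\<mu> \<in> bounded_partitions k" "\<And>x. x \<in> set (butlast \<mu>) \<Longrightarrow> t < x"
  defines "P \<equiv> rect_power k t a"
  shows "corrected t P g \<mu> = g P * g \<mu>"
  using \<mu>
proof (induction \<mu> rule: wf_induct_rule[OF wf_measures[of "[sum_list, length, last]"]])
  case (1 \<mu>)
  have P: "P \<in> bounded_partitions k"
    unfolding P_def by (rule rect_power_in[OF t])
  show ?case
  proof (cases "\<mu> = []")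
    case True
    have "part_union P [] = P"
      using P by (intro part_union_eqI[symmetric]) (auto simp: bounded_partitions_def is_partition_def)
    moreover have "g [] = 1"
      using g by (simp add: is_K_k_Schur_def)
    ultimately show ?thesis
      using True by (simp add: corrected_def)
  next
    case False
    define \<nu> where "\<nu> = butlast \<mu>"
    define r where "r = last \<mu>"
    have \<mu>eq: "\<mu> = \<nu> @ [r]"
      using False by (simp add: \<nu>_def r_def)
    have \<nu>b: "\<nu> \<in> bounded_partitions k" "\<And>x. x \<in> set \<nu> \<Longrightarrow> t < x"
      using 1 butlast_bounded by (simp_all add: \<nu>_def)
    have r: "1 \<le> r" "r \<le> k" "\<And>x. x \<in> set \<nu> \<Longrightarrow> r \<le> x"
      using 1(2) unfolding \<mu>eq by (auto simp: bounded_partitions_def is_partition_def sorted_wrt_append)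
    obtain M where "strip_setting k t \<nu> M"
      using exists_strip_setting[OF t \<nu>b] by blast
    then interpret strip_setting k t \<nu> M .
    let ?c = "\<lambda>\<rho>. pieri_coeff (num_res \<rho> \<nu>) (sum_list \<nu> + r - sum_list \<rho>)"
    let ?W = "weak_succ r \<nu>"
    have "corrected t P g \<nu> = g P * g \<nu>"
    proof (rule 1(1))
      show "(\<nu>, \<mu>) \<in> measures [sum_list, length, last]"
        using r(1) by (simp add: \<mu>eq)
      show "x \<in> set (butlast \<nu>) \<Longrightarrow> t < x" for x
        using \<nu>b(2) in_set_butlastD by metis
    qed (rule \<nu>b)
    moreover have "corrected t P g \<nu> = g (part_union P \<nu>)"
      using \<nu>b(2)[of "last \<nu>"] by (auto simp: corrected_def)
    ultimately have U\<nu>: "g (part_union P \<nu>) = g P * g \<nu>" by simp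
    have IH: "corrected t P g \<rho> = g P * g \<rho>" if \<rho>: "\<rho> \<in> ?W" "\<rho> \<noteq> \<mu>" for \<rho>
    proof (rule 1(1))
      note rows = succ_rows[OF \<rho>(1) r(2)]
      show "\<rho> \<in> bounded_partitions k" by (rule rows)
      show "t < x" if "x \<in> set (butlast \<rho>)" for x
      proof -
        have "set (butlast \<rho>) \<subseteq> set (take l \<rho>)"
          using rows(1,2) by (auto simp: butlast_conv_take intro!: set_take_subset_set_take)
        then show ?thesis using rows(3) that by blast
      qed
      show "(\<rho>, \<mu>) \<in> measures [sum_list, length, last]"
      proof (cases "length \<rho> = Suc l")
        case True
        then have "last \<rho> = part \<rho> (Suc l)"
          by (cases \<rho> rule: rev_cases) (simp_all add: part_def nth_append)
        moreover have "\<not> r \<le> part \<rho> (Suc l)"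
          using snoc_weak_succ(2)[OF \<nu>b(1) r \<rho>(1)] \<rho>(2) \<mu>eq by blast
        ultimately show ?thesis
          using rows(5) True by (auto simp: \<mu>eq)
      next
        case False
        then show ?thesis
          using rows(1,2,5) by (auto simp: \<mu>eq)
      qed
    qed
    have \<mu>W: "\<mu> \<in> ?W"
      unfolding \<mu>eq by (rule snoc_weak_succ(1)[OF \<nu>b(1) r])
    have c\<mu>: "?c \<mu> = 1"
      by (simp add: \<mu>eq)
    \<comment> \<open>Both sides are \<open>hsym r * g P * g \<nu>\<close>: the left one by
      \<open>pieri_corrected\<close> and the known factorization for \<nu>, the right one by
      \<open>pieri\<close>.\<close>
    have "(\<Sum>\<rho>\<in>?W. ?c \<rho> * corrected t P g \<rho>) = g P * (\<Sum>\<rho>\<in>?W. ?c \<rho> * g \<rho>)"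
      unfolding pieri[OF g \<nu>b(1) r(2), symmetric]
      using pieri_corrected[OF g a r(2), folded P_def] unfolding U\<nu> by (simp add: mult.left_commute)
    also have "\<dots> = (\<Sum>\<rho>\<in>?W. ?c \<rho> * (g P * g \<rho>))"
      by (simp add: sum_distrib_left mult.left_commute)
    finally have "corrected t P g \<mu> + (\<Sum>\<rho>\<in>?W - {\<mu>}. ?c \<rho> * corrected t P g \<rho>) =
        g P * g \<mu> + (\<Sum>\<rho>\<in>?W - {\<mu>}. ?c \<rho> * (g P * g \<rho>))"
      unfolding sum.remove[OF finite_weak_succ[OF \<nu>b(1)] \<mu>W] c\<mu> mult_1_left .
    moreover have "(\<Sum>\<rho>\<in>?W - {\<mu>}. ?c \<rho> * corrected t P g \<rho>) = (\<Sum>\<rho>\<in>?W - {\<mu>}. ?c \<rho> * (g P * g \<rho>))"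
      using IH by (intro sum.cong) auto
    ultimately show ?thesis by simp
  qed
qed

lemma rect_power_factor:
  fixes a :: nat
  assumes "is_K_k_Schur k g" "1 \<le> t" "t \<le> k" "1 \<le> a"
    and \<mu>: "\<mu> \<in> bounded_partitions k" "\<And>x. x \<in> set \<mu> \<Longrightarrow> t < x"
  shows "g (part_union (rect_power k t a) \<mu>) = g (rect_power k t a) * g \<mu>"
proof -
  have "corrected t (rect_power k t a) g \<mu> = g (part_union (rect_power k t a) \<mu>)"
    using \<mu>(2)[of "last \<mu>"] by (auto simp: corrected_def)
  then show ?thesis
    using corrected_eq[OF assms(1-5)] \<mu>(2) in_set_butlastD by metis
qed

text \<open>The three claims are proved together because splitting off the next rectangle requires
  that the remaining union is bounded and that its parts are among the larger values of
  \<open>t\<close>.\<close>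

lemma Union_parts_factor:
  fixes a :: "'a \<Rightarrow> nat"
  assumes g: "is_K_k_Schur k g"
    and "\<And>i. i \<in> set js \<Longrightarrow> 1 \<le> t i \<and> t i \<le> k \<and> 1 \<le> a i"
    and "sorted_wrt (\<lambda>i j. t i < t j) js"
  shows "g (Union_parts (map (\<lambda>i. rect_power k (t i) (a i)) js)) =
      prod_list (map (\<lambda>i. g (rect_power k (t i) (a i))) js)"
    and "Union_parts (map (\<lambda>i. rect_power k (t i) (a i)) js) \<in> bounded_partitions k"
    and "set (Union_parts (map (\<lambda>i. rect_power k (t i) (a i)) js)) \<subseteq> t ` set js"
  using assms(2,3)
proof (induction js)
  case Nil
  {
    case 1
    then show ?case using g by (simp add: Union_parts_def is_K_k_Schur_def)
  next
    case 2
    then show ?case by (simp add: Union_parts_def bounded_partitions_def is_partition_def)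
  next
    case 3
    then show ?case by (simp add: Union_parts_def)
  }
next
  case (Cons i js)
  let ?Q = "Union_parts (map (\<lambda>i. rect_power k (t i) (a i)) js)"
  let ?P = "rect_power k (t i) (a i)"
  have Un: "Union_parts (map (\<lambda>i. rect_power k (t i) (a i)) (i # js)) = part_union ?P ?Q"
    by (simp add: Union_parts_def)
  {
    case 1
    then have i: "1 \<le> t i" "t i \<le> k" "1 \<le> a i" and lt: "\<And>j. j \<in> set js \<Longrightarrow> t i < t j"
      by auto
    have "?Q \<in> bounded_partitions k" "set ?Q \<subseteq> t ` set js"
      and "g ?Q = prod_list (map (\<lambda>i. g (rect_power k (t i) (a i))) js)"
      using Cons.IH 1 by auto
    moreover from this have "g (part_union ?P ?Q) = g ?P * g ?Q"
      using lt by (intro rect_power_factor g i) auto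
    ultimately show ?case
      unfolding Un by simp
  next
    case 2
    then show ?case
      unfolding Un using Cons.IH by (intro part_union_in rect_power_in) auto
  next
    case 3
    have "set ?P \<subseteq> {t i}"
      using mset_rect_power[of "t i" "a i", THEN arg_cong[where f = set_mset]] by (auto split: if_splits)
    moreover have "set (part_union ?P ?Q) = set ?P \<union> set ?Q"
      by (simp add: part_union_def)
    ultimately show ?case
      unfolding Un using Cons.IH 3 by auto
  }
qed

end

theorem theorem5p8:
  fixes k m :: nat and t a :: "nat \<Rightarrow> nat" and g :: "nat list \<Rightarrow> symfun"
  assumes "k \<ge> 1" and "m \<ge> 1"
    and "\<And>i. i \<in> {1..m} \<Longrightarrow> 1 \<le> t i \<and> t i \<le> k"
    and "strict_mono_on {1..m} t"
    and "\<And>i. i \<in> {1..m} \<Longrightarrow> a i \<ge> 1"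
    and "is_K_k_Schur k g"
  shows "g (Union_parts (map (\<lambda>i. rect_power k (t i) (a i)) [1..<m + 1])) =
         (\<Prod>i=1..m. g (rect_power k (t i) (a i)))"
proof -
  interpret k_bound k
    by unfold_locales (rule assms(1))
  have set: "set [1..<m + 1] = {1..m}"
    by auto
  have "sorted_wrt (\<lambda>i j. t i < t j) [1..<m + 1]"
  proof (rule sorted_wrt_mono_rel)
    show "sorted_wrt (<) [1..<m + 1]"
      by (rule sorted_wrt_upt)
    show "t i < t j" if "i \<in> set [1..<m + 1]" "j \<in> set [1..<m + 1]" "i < j" for i j
      using assms(4) that unfolding set by (rule strict_mono_onD)
  qed
  then have "g (Union_parts (map (\<lambda>i. rect_power k (t i) (a i)) [1..<m + 1])) =
      prod_list (map (\<lambda>i. g (rect_power k (t i) (a i))) [1..<m + 1])"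
    using assms(3,5) by (intro Union_parts_factor(1) assms(6)) (simp_all add: set del: upt_Suc)
  also have "\<dots> = (\<Prod>i=1..m. g (rect_power k (t i) (a i)))"
    using prod.distinct_set_conv_list[OF distinct_upt, of "\<lambda>i. g (rect_power k (t i) (a i))" 1 "m + 1"]
    unfolding set by (rule sym)
  finally show ?thesis .
qed

end
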